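(* Let $\Omega_1,\Omega_2\subseteq\mathbb{C}$ be open. Let $f:\Omega_2\to\mathbb{C}$ be holomorphic, with only simple zeros, and suppose $g:\Omega_1\to\mathbb{C}$ is equal to $\frac{\partial G}{\partial\bar z}$ for some $G\in\mathcal{C}^r(\Omega_1)$, $r=0,1,2,\ldots,\infty,\omega$. If $v:\Omega_1\to\Omega_2$ is continuous, satisfies condition $( * )$ on $\Omega_1$ (the partial derivatives $v_x$, $v_y$ exist at every point of $\Omega_1$ except for countably many), and $\frac{\partial v}{\partial\bar z}=f(v)g(z)$ almost everywhere in $\Omega_1$, then $v\in\mathcal{C}^r(\Omega_1)$.
   Context: Write $z=x+iy$. For a complex valued function $v$ on an open subset of $\mathbb{C}=\mathbb{R}^2$, $v_x,v_y$ denote the pointwise classical partial derivatives, and at points where both exist, $\frac{\partial v}{\partial\bar z}=\frac12(v_x+iv_y)$; this is the pointwise, not the distributional, derivative. That $g$ equals $\frac{\partial G}{\partial\bar z}$ on $\Omega_1$ includes the assertion that the partial derivatives $G_x$, $G_y$ exist at every point of $\Omega_1$. $\mathcal{C}^r$ is in the sense of real variables (continuous for $r=0$, $r$ times continuously differentiable for $r=1,2,\ldots$, smooth for $r=\infty$, real analytic for $r=\omega$). *)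

theory Defs
  imports "HOL-Complex_Analysis.Complex_Analysis"
begin

definition has_partials_at :: "(complex \<Rightarrow> complex) \<Rightarrow> complex \<Rightarrow> bool" where
  "has_partials_at v z \<longleftrightarrow>
     (\<lambda>t::real. v (z + of_real t)) differentiable (at 0) \<and>
     (\<lambda>t::real. v (z + \<i> * of_real t)) differentiable (at 0)"

text \<open>The next three functions are meaningful only at points where \<open>has_partials_at\<close> holds.\<close>

definition partial_x :: "(complex \<Rightarrow> complex) \<Rightarrow> complex \<Rightarrow> complex" where
  "partial_x v z = vector_derivative (\<lambda>t::real. v (z + of_real t)) (at 0)"

definition partial_y :: "(complex \<Rightarrow> complex) \<Rightarrow> complex \<Rightarrow> complex" where
  "partial_y v z = vector_derivative (\<lambda>t::real. v (z + \<i> * of_real t)) (at 0)"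

definition dbar :: "(complex \<Rightarrow> complex) \<Rightarrow> complex \<Rightarrow> complex" where
  "dbar v z = (partial_x v z + \<i> * partial_y v z) / 2"

definition condition_star :: "(complex \<Rightarrow> complex) \<Rightarrow> complex set \<Rightarrow> bool" where
  "condition_star v U \<longleftrightarrow> countable {z \<in> U. \<not> has_partials_at v z}"

text \<open>On an open set \<open>U\<close>, \<open>Ck_on k v U\<close> says that all iterated partial derivatives of \<open>v\<close> of
  order at most \<open>k\<close>, in any order of differentiation, exist and are continuous on \<open>U\<close>.\<close>

fun Ck_on :: "nat \<Rightarrow> (complex \<Rightarrow> complex) \<Rightarrow> complex set \<Rightarrow> bool" where
  "Ck_on 0 v U \<longleftrightarrow> continuous_on U v"
| "Ck_on (Suc k) v U \<longleftrightarrow>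
     continuous_on U v \<and> (\<forall>z\<in>U. has_partials_at v z) \<and>
     Ck_on k (partial_x v) U \<and> Ck_on k (partial_y v) U"

text \<open>Real analyticity on an open set: near each point, \<open>v\<close> is the (unconditionally convergent)
  sum of a power series in the two real variables, with complex coefficients.\<close>

definition real_analytic_on :: "(complex \<Rightarrow> complex) \<Rightarrow> complex set \<Rightarrow> bool" where
  "real_analytic_on v U \<longleftrightarrow>
     (\<forall>w\<in>U. \<exists>\<rho>>0. \<exists>a :: nat \<Rightarrow> nat \<Rightarrow> complex. \<forall>z\<in>ball w \<rho>.
        ((\<lambda>(m, n). a m n * of_real (Re (z - w)) ^ m * of_real (Im (z - w)) ^ n)
           has_sum v z) UNIV)"

datatype smoothness = Order nat | Smooth | Analytic

fun Cr_on :: "smoothness \<Rightarrow> (complex \<Rightarrow> complex) \<Rightarrow> complex set \<Rightarrow> bool" where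
  "Cr_on (Order k) v U \<longleftrightarrow> Ck_on k v U"
| "Cr_on Smooth v U \<longleftrightarrow> (\<forall>k. Ck_on k v U)"
| "Cr_on Analytic v U \<longleftrightarrow> real_analytic_on v U"

definition only_simple_zeros :: "(complex \<Rightarrow> complex) \<Rightarrow> complex set \<Rightarrow> bool" where
  "only_simple_zeros f U \<longleftrightarrow> (\<forall>w\<in>U. f w = 0 \<longrightarrow> deriv f w \<noteq> 0)"

end

theory Submission
  imports Defs
begin

text \<open>
The equation \<open>dbar v = f(v) g\<close> is reduced to the Cauchy--Riemann equation by an explicit change of
the dependent variable. Near any value \<open>a\<close> of \<open>v\<close> there are a constant \<open>\<mu>\<close> and a local holomorphic
coordinate \<open>h\<close> with \<open>h' f = \<mu> h\<close> (\<open>linearising_coordinate\<close>; this uses that the zeros of \<open>f\<close> are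
simple). As \<open>g = dbar G\<close>, the product \<open>u = h(v) * exp (- \<mu> * G)\<close> satisfies \<open>dbar u = 0\<close> almost
everywhere. If \<open>u\<close> is holomorphic, then \<open>v\<close> is obtained locally from \<open>G\<close> and holomorphic functions
by products and compositions, and these operations preserve each of the classes \<open>C^r\<close>
(\<open>Cr_on_mult\<close>, \<open>Cr_on_compose\<close>).

The function \<open>u\<close> is only known to be continuous, with partial derivatives off a countable set and
the Cauchy--Riemann equation almost everywhere. That such functions are holomorphic is the theorem
of Looman and Menchoff (\<open>Looman_Menchoff\<close>). A Baire category argument reduces it to a function
that is holomorphic off a closed set \<open>F\<close> and satisfies, at the points of \<open>F\<close>, a uniform Lipschitz
condition along the coordinate axes (\<open>axis_lipschitz_CR\<close>). For such a function the increments
across a rectangle differ from the area integrals of the partial derivatives over \<open>F\<close> by at most a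
multiple of the area outside \<open>F\<close> (\<open>horizontal_increment_vs_area_integral\<close>). By the Cauchy--Riemann
equation the contour integral around the rectangle has the same bound (\<open>rect_integral_bound\<close>), and
repeated subdivision shows that it vanishes (\<open>rect_integral_0\<close>). Morera's theorem for rectangles
then gives holomorphy.

For finite and infinite \<open>r\<close> the closure properties follow from the product and chain rules by
induction on the order. In the real analytic case they are read off from absolutely convergent
sums of monomials, indexed by pairs for products and by words for compositions
(\<open>real_analytic_atI\<close>).
\<close>

section \<open>Lipschitz functions on closed sets of real numbers\<close>

lemma has_vector_derivative_within_alt:
  fixes f :: "real \<Rightarrow> 'a::real_normed_vector"
  shows "(f has_vector_derivative D) (at x within S) \<longleftrightarrow>
    (\<forall>e>0. \<exists>d>0. \<forall>y\<in>S. \<bar>y - x\<bar> < d \<longrightarrow> norm (f y - f x - (y - x) *\<^sub>R D) \<le> e * \<bar>y - x\<bar>)"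
  unfolding has_vector_derivative_def has_derivative_within_alt
  by (simp add: bounded_linear_scaleR_left)

lemma has_vector_derivative_quotient_tendsto:
  fixes f :: "real \<Rightarrow> 'a::real_normed_vector"
  assumes "(f has_vector_derivative D) (at x within S)"
  shows "((\<lambda>y. (f y - f x) /\<^sub>R (y - x)) \<longlongrightarrow> D) (at x within S)"
proof (rule tendstoI)
  fix e :: real assume "e > 0"
  then obtain d where d: "d > 0" "\<And>y. y \<in> S \<Longrightarrow> \<bar>y - x\<bar> < d \<Longrightarrow>
      norm (f y - f x - (y - x) *\<^sub>R D) \<le> e / 2 * \<bar>y - x\<bar>"
    using assms unfolding has_vector_derivative_within_alt by (meson half_gt_zero)
  have "dist ((f y - f x) /\<^sub>R (y - x)) D < e" if "y \<in> S" "y \<noteq> x" "\<bar>y - x\<bar> < d" for y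
  proof -
    have "(f y - f x) /\<^sub>R (y - x) - D = (f y - f x - (y - x) *\<^sub>R D) /\<^sub>R (y - x)"
      using that by (simp add: scaleR_diff_right)
    then have "dist ((f y - f x) /\<^sub>R (y - x)) D = norm (f y - f x - (y - x) *\<^sub>R D) / \<bar>y - x\<bar>"
      by (simp add: dist_norm divide_inverse)
    also have "\<dots> \<le> e / 2"
      using d(2)[OF that(1,3)] that(2) by (simp add: pos_divide_le_eq)
    also have "\<dots> < e" using \<open>e > 0\<close> by simp
    finally show ?thesis .
  qed
  then show "\<forall>\<^sub>F y in at x within S. dist ((f y - f x) /\<^sub>R (y - x)) D < e"
    unfolding eventually_at using d(1) by (auto simp: dist_real_def)
qed

text \<open>
A Lipschitz function is the integral of its derivative as soon as the derivative exists off a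
countable set. The forward difference quotients are bounded by the Lipschitz constant, so their
integrals converge to the integral of the derivative by dominated convergence; on the other hand
the integral of a difference quotient over an interval telescopes to a difference of two short
averages of the function itself, which converge to its values at the end points.
\<close>
lemma lipschitz_fundamental_theorem:
  fixes h :: "real \<Rightarrow> complex"
  assumes ab: "a \<le> b"
    and lip: "\<And>x y. norm (h x - h y) \<le> N * \<bar>x - y\<bar>"
    and der: "\<And>x. x \<in> {a<..<b} - E \<Longrightarrow> (h has_vector_derivative h' x) (at x)"
    and E: "countable E"
  shows "has_bochner_integral lborel (\<lambda>x. indicator ({a<..<b} - E) x *\<^sub>R h' x) (h b - h a)"
proof -
  define A where "A = {a<..<b} - E"
  define q where "q n x = real (Suc n) *\<^sub>R (h (x + 1 / real (Suc n)) - h x)" for n x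
  have N: "N \<ge> 0" using order_trans[OF norm_ge_zero lip[of 1 0]] by simp
  have conth: "continuous_on UNIV h"
    unfolding continuous_on_iff dist_norm
  proof (intro ballI allI impI)
    fix x e :: real assume "e > 0"
    moreover have "norm (h x' - h x) < e" if "norm (x' - x) < e / (N + 1)" for x'
    proof -
      have "norm (h x' - h x) \<le> N * \<bar>x' - x\<bar>" by (rule lip)
      also have "\<dots> \<le> (N + 1) * \<bar>x' - x\<bar>" by (simp add: mult_right_mono)
      also have "\<dots> < e" using that N by (simp add: field_simps)
      finally show ?thesis .
    qed
    ultimately show "\<exists>d>0. \<forall>x'\<in>UNIV. norm (x' - x) < d \<longrightarrow> norm (h x' - h x) < e"
      using N by (intro exI[of _ "e / (N + 1)"]) auto
  qed
  have conth': "continuous_on S (\<lambda>x. h (x + c))" for S c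
    by (rule continuous_on_compose2[OF conth]) (auto intro!: continuous_intros)
  have conth0: "continuous_on S h" for S
    using conth' [of S 0] by simp
  have Tc: "(\<lambda>n. c + 1 / real (Suc n)) \<longlonglongrightarrow> c" for c
    using LIMSEQ_inverse_real_of_nat_add[of c] by (simp only: inverse_eq_divide)
  have hm[measurable]: "h \<in> borel_measurable borel"
    using conth by (rule borel_measurable_continuous_onI)
  have Am[measurable]: "A \<in> sets borel"
    unfolding A_def using sets.countable[OF _ E, of borel] by (intro sets.Diff) auto
  have qm[measurable]: "q n \<in> borel_measurable borel" for n
    unfolding q_def
    by (intro borel_measurable_continuous_onI continuous_on_scaleR continuous_on_diff
          continuous_on_const conth' conth0)
  have qbound: "norm (q n x) \<le> N" for n x
  proof -
    have "norm (q n x) = real (Suc n) * norm (h (x + 1 / real (Suc n)) - h x)"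
      unfolding q_def norm_scaleR by (simp only: abs_of_nat)
    also have "\<dots> \<le> real (Suc n) * (N * \<bar>x + 1 / real (Suc n) - x\<bar>)"
      by (intro mult_left_mono lip) simp
    also have "\<bar>x + 1 / real (Suc n) - x\<bar> = 1 / real (Suc n)"
      by (simp only: add_diff_cancel_left' abs_divide abs_of_nat abs_one)
    also have "real (Suc n) * (N * (1 / real (Suc n))) = N"
      using of_nat_neq_0[of n, where 'a=real] by (simp del: of_nat_Suc)
    finally show ?thesis .
  qed
  have lim: "(\<lambda>n. q n x) \<longlonglongrightarrow> h' x" if "x \<in> A" for x
  proof -
    have "((\<lambda>y. (h y - h x) /\<^sub>R (y - x)) \<longlongrightarrow> h' x) (at x)"
      using der[of x] that unfolding A_def by (intro has_vector_derivative_quotient_tendsto) auto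
    moreover have "filterlim (\<lambda>n. x + 1 / real (Suc n)) (at x) sequentially"
      unfolding filterlim_at using Tc by simp
    ultimately have "(\<lambda>n. (h (x + 1 / real (Suc n)) - h x) /\<^sub>R (x + 1 / real (Suc n) - x)) \<longlonglongrightarrow> h' x"
      by (rule filterlim_compose)
    then show ?thesis
      by (simp only: q_def add_diff_cancel_left' inverse_divide div_by_1 inverse_eq_divide divide_divide_eq_right mult_1_left)
  qed
  have lim': "(\<lambda>n. indicator A x *\<^sub>R q n x) \<longlonglongrightarrow> indicator A x *\<^sub>R h' x" for x
    using lim[of x] by (cases "x \<in> A") auto
  have meas: "(\<lambda>x. indicator A x *\<^sub>R h' x) \<in> borel_measurable lborel"
    by (rule borel_measurable_LIMSEQ_metric[OF _ lim']) measurable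
  have int1: "integrable lborel (\<lambda>x. N * indicator {a..b} x)"
    by (intro integrable_mult_right integrable_real_indicator) (simp_all add: emeasure_lborel_Icc_eq)
  have bd: "norm (indicator A x *\<^sub>R q n x) \<le> N * indicator {a..b} x" for n x
    using qbound[of n x] N by (auto simp: A_def indicator_def)
  have integ: "integrable lborel (\<lambda>x. indicator A x *\<^sub>R h' x)"
    by (rule integrable_dominated_convergence[OF meas _ int1, where s = "\<lambda>n x. indicator A x *\<^sub>R q n x"])
       (use lim' bd in auto)
  have conv: "(\<lambda>n. \<integral>x. indicator A x *\<^sub>R q n x \<partial>lborel) \<longlonglongrightarrow> (\<integral>x. indicator A x *\<^sub>R h' x \<partial>lborel)"
    by (rule integral_dominated_convergence[OF meas _ int1]) (use lim' bd in auto)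
  \<comment> \<open>\<open>P\<close> is differentiated at \<open>b\<close> from the right as well, hence the interval \<open>{a..b+1}\<close> below.\<close>
  define P where "P x = integral {a..x} h" for x
  have ion: "h integrable_on {u..v}" for u v
    by (rule integrable_continuous_real[OF conth0])
  have Pder: "(P has_vector_derivative h x) (at x within {a..b+1})" if "x \<in> {a..b+1}" for x
    unfolding P_def by (rule integral_has_vector_derivative[OF conth0 that])
  have qint: "(\<integral>x. indicator A x *\<^sub>R q n x \<partial>lborel)
      = real (Suc n) *\<^sub>R ((P (b + 1 / Suc n) - P b) - (P (a + 1 / Suc n) - P a))" (is "?l = ?r") for n
  proof -
    have nullE: "AE x in lborel. x \<notin> insert a (insert b E)"
      using E by (intro AE_not_in countable_imp_null_set_lborel) auto
    have "?l = (\<integral>x. indicator {a..b} x *\<^sub>R q n x \<partial>lborel)"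
    proof (rule integral_cong_AE)
      show "AE x in lborel. indicator A x *\<^sub>R q n x = indicator {a..b} x *\<^sub>R q n x"
        using nullE by eventually_elim (auto simp: A_def indicator_def)
    qed measurable
    also have "\<dots> = integral {a..b} (q n)"
    proof -
      have "set_integrable lborel {a..b} (q n)"
        unfolding q_def
        by (intro borel_integrable_atLeastAtMost' continuous_on_scaleR continuous_on_diff
              continuous_on_const conth' conth0)
      from set_borel_integral_eq_integral(2)[OF this] show ?thesis
        by (simp add: set_lebesgue_integral_def)
    qed
    also have "\<dots> = real (Suc n) *\<^sub>R (integral {a..b} (\<lambda>x. h (x + 1 / Suc n)) - integral {a..b} h)"
      unfolding q_def integral_cmul
      by (subst integral_diff) (intro refl integrable_continuous_real conth' conth0)+
    also have "integral {a..b} (\<lambda>x. h (x + 1 / Suc n)) = integral {a + 1/Suc n..b + 1 / Suc n} h"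
      using integral_shift_real_ivl[of "a + 1 / Suc n" "1 / Suc n" "b + 1 / Suc n" h] by simp
    also have "\<dots> = P (b + 1 / Suc n) - P (a + 1 / Suc n)"
      unfolding P_def 
      using Henstock_Kurzweil_Integration.integral_combine[OF _ _ ion, of a "a + 1 / Suc n" "b + 1 / Suc n"] ab
      by (simp add: algebra_simps)
    also have "integral {a..b} h = P b - P a" by (simp add: P_def)
    finally show ?thesis by (simp add: algebra_simps)
  qed
  have limP: "(\<lambda>n. real (Suc n) *\<^sub>R (P (c + 1 / Suc n) - P c)) \<longlonglongrightarrow> h c" if "c \<in> {a..b}" for c
  proof -
    have "((\<lambda>y. (P y - P c) /\<^sub>R (y - c)) \<longlongrightarrow> h c) (at c within {a..b+1})"
      using Pder[of c] that by (intro has_vector_derivative_quotient_tendsto) auto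
    moreover have "filterlim (\<lambda>n. c + 1 / real (Suc n)) (at c within {a..b+1}) sequentially"
    proof -
      have "c + 1 / real (Suc n) \<in> {a..b + 1}" "c + 1 / real (Suc n) \<noteq> c" for n
      proof -
        have "0 < 1 / real (Suc n)" "1 / real (Suc n) \<le> 1" by simp_all
        then show "c + 1 / real (Suc n) \<in> {a..b + 1}" "c + 1 / real (Suc n) \<noteq> c"
          using that unfolding atLeastAtMost_iff by linarith+
      qed
      then show ?thesis
        unfolding filterlim_at using Tc[of c] by (blast intro: always_eventually)
    qed
    ultimately have "(\<lambda>n. (P (c + 1 / real (Suc n)) - P c) /\<^sub>R (c + 1 / real (Suc n) - c)) \<longlonglongrightarrow> h c"
      by (rule filterlim_compose)
    then show ?thesis
      by (simp only: add_diff_cancel_left' inverse_divide div_by_1 inverse_eq_divide divide_divide_eq_right mult_1_left)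
  qed
  have "(\<lambda>n. \<integral>x. indicator A x *\<^sub>R q n x \<partial>lborel) \<longlonglongrightarrow> h b - h a"
    unfolding qint using tendsto_diff[OF limP[of b] limP[of a]] ab by (simp add: scaleR_diff_right)
  with conv have "(\<integral>x. indicator A x *\<^sub>R h' x \<partial>lborel) = h b - h a"
    by (rule LIMSEQ_unique)
  with integ show ?thesis
    by (simp add: has_bochner_integral_iff A_def)
qed

text \<open>
The points of \<open>K\<close> that are left end points of gaps of \<open>K\<close>: a rational number chosen in each gap
tells them apart.
\<close>
lemma countable_right_isolated:
  fixes K :: "real set"
  shows "countable {p\<in>K. \<exists>d>0. {p<..<p+d} \<inter> K = {}}" (is "countable ?E")
proof -
  have "\<forall>p\<in>?E. \<exists>q::rat. p < of_rat q \<and> {p<..<of_rat q} \<inter> K = {}"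
  proof
    fix p assume "p \<in> ?E"
    then obtain d where d: "d > 0" "{p<..<p+d} \<inter> K = {}" by blast
    then obtain q :: rat where "p < of_rat q" "of_rat q < p + d"
      using of_rat_dense[of p "p + d"] by auto
    moreover from this have "{p<..<of_rat q} \<subseteq> {p<..<p+d}" by auto
    ultimately show "\<exists>q::rat. p < of_rat q \<and> {p<..<of_rat q} \<inter> K = {}"
      using d(2) by blast
  qed
  from bchoice[OF this] obtain q :: "real \<Rightarrow> rat"
    where q: "\<And>p. p \<in> ?E \<Longrightarrow> p < of_rat (q p) \<and> {p<..<of_rat (q p)} \<inter> K = {}" by blast
  have *: False if "x \<in> ?E" "y \<in> ?E" "q x = q y" "x < y" for x y
  proof -
    have "y \<in> {x<..<of_rat (q x)}" using q[OF that(2)] that(3,4) by simp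
    moreover have "y \<in> K" using that(2) by blast
    ultimately show False using q[OF that(1)] by blast
  qed
  have "inj_on q ?E"
  proof (rule inj_onI)
    fix x y assume "x \<in> ?E" "y \<in> ?E" "q x = q y"
    then show "x = y" using *[of x y] *[of y x] by (cases x y rule: linorder_cases) simp_all
  qed
  then show ?thesis by (rule countable_image_inj_on[rotated]) simp
qed

lemma countable_left_isolated:
  fixes K :: "real set"
  shows "countable {p\<in>K. \<exists>d>0. {p-d<..<p} \<inter> K = {}}" (is "countable ?E")
proof -
  have "p \<in> uminus ` {p \<in> uminus ` K. \<exists>d>0. {p<..<p+d} \<inter> uminus ` K = {}}" if p: "p \<in> ?E" for p
  proof -
    from p obtain d where d: "p \<in> K" "d > 0" "{p-d<..<p} \<inter> K = {}" by blast
    have "x \<notin> uminus ` K" if "- p < x" "x < - p + d" for x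
    proof
      assume "x \<in> uminus ` K"
      then obtain k where "k \<in> K" "x = - k" by blast
      then have "k \<in> {p-d<..<p} \<inter> K" using that by auto
      then show False using d(3) by blast
    qed
    then have "{- p<..<- p + d} \<inter> uminus ` K = {}"
      unfolding disjoint_iff greaterThanLessThan_iff by blast
    then have "- p \<in> {p \<in> uminus ` K. \<exists>d>0. {p<..<p+d} \<inter> uminus ` K = {}}"
      using d(1,2) by blast
    then show ?thesis by (rule rev_image_eqI) simp
  qed
  then have "?E \<subseteq> uminus ` {p \<in> uminus ` K. \<exists>d>0. {p<..<p+d} \<inter> uminus ` K = {}}" by blast
  then show ?thesis
    using countable_right_isolated[of "uminus ` K"] by (meson countable_image countable_subset)
qed

text \<open>
Linear interpolation does not increase an error that is measured relative to the distance from a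
point \<open>p\<close> outside the open interval \<open>(l, r)\<close>: the distance to \<open>p\<close> is itself affine on \<open>[l, r]\<close>.
With \<open>D = 0\<close> this transfers Lipschitz bounds to the interpolant, with \<open>D\<close> a derivative and \<open>e\<close>
small it transfers differentiability at \<open>p\<close>.
\<close>
lemma affine_interpolation_error:
  fixes f :: "real \<Rightarrow> complex"
  assumes "l \<le> x" "x \<le> r" "p \<le> l \<or> r \<le> p"
    and l: "norm (f l - f p - (l - p) *\<^sub>R D) \<le> e * \<bar>l - p\<bar>"
    and r: "norm (f r - f p - (r - p) *\<^sub>R D) \<le> e * \<bar>r - p\<bar>"
  shows "norm (f l + ((x - l) / (r - l)) *\<^sub>R (f r - f l) - f p - (x - p) *\<^sub>R D) \<le> e * \<bar>x - p\<bar>"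
proof (cases "l = r")
  case True then show ?thesis using assms by simp
next
  case False
  define t where "t = (x - l) / (r - l)"
  have t: "0 \<le> t" "t \<le> 1" and x: "x = l + t * (r - l)"
    using False assms(1,2) by (auto simp: t_def field_simps)
  have "f l + t *\<^sub>R (f r - f l) - f p - (x - p) *\<^sub>R D
      = (1 - t) *\<^sub>R (f l - f p - (l - p) *\<^sub>R D) + t *\<^sub>R (f r - f p - (r - p) *\<^sub>R D)"
    unfolding x by (simp add: algebra_simps scaleR_diff_left scaleR_add_left scaleR_diff_right)
  also have "norm \<dots> \<le> (1 - t) * (e * \<bar>l - p\<bar>) + t * (e * \<bar>r - p\<bar>)"
    using t l r by (intro norm_triangle_le add_mono) (auto intro!: mult_left_mono)
  also have "\<dots> = e * ((1 - t) * \<bar>l - p\<bar> + t * \<bar>r - p\<bar>)" by (simp add: algebra_simps)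
  also have "(1 - t) * \<bar>l - p\<bar> + t * \<bar>r - p\<bar> = \<bar>x - p\<bar>"
  proof -
    from assms(3) show ?thesis
    proof
      assume "p \<le> l" then have "\<bar>l - p\<bar> = l - p" "\<bar>r - p\<bar> = r - p" "\<bar>x - p\<bar> = x - p"
        using assms by auto
      then show ?thesis unfolding x by (simp add: algebra_simps)
    next
      assume "r \<le> p" then have "\<bar>l - p\<bar> = p - l" "\<bar>r - p\<bar> = p - r" "\<bar>x - p\<bar> = p - x"
        using assms by auto
      then show ?thesis unfolding x by (simp add: algebra_simps)
    qed
  qed
  finally show ?thesis by (simp add: t_def)
qed

text \<open>
The increment of \<open>f\<close> over \<open>[a, b]\<close> is the integral of its derivative over \<open>K\<close>, up to an error
bounded by the length of the gaps of \<open>K\<close>. Only the values of \<open>f\<close> on \<open>K\<close> matter, so replace \<open>f\<close> by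
the function that agrees with it on \<open>K\<close> and is affine on each gap. It is \<open>N\<close>-Lipschitz, it has the
same derivative as \<open>f\<close> at the points of \<open>K\<close> that are limits of \<open>K\<close> from both sides, and its slope
in the gaps is at most \<open>N\<close>.
\<close>
lemma lipschitz_increment_vs_integral:
  fixes f :: "real \<Rightarrow> complex"
  assumes K: "closed K" "a \<in> K" "b \<in> K" "K \<subseteq> {a..b}"
    and lip: "\<And>x y. x \<in> K \<Longrightarrow> y \<in> K \<Longrightarrow> norm (f x - f y) \<le> N * \<bar>x - y\<bar>"
    and der: "\<And>x. x \<in> K - C \<Longrightarrow> (f has_vector_derivative D x) (at x within K)"
    and C: "countable C"
    and bd: "\<And>x. x \<in> K \<Longrightarrow> norm (D x) \<le> M"
    and meas: "(\<lambda>x. indicator K x *\<^sub>R D x) \<in> borel_measurable borel"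
    and N: "N \<ge> 0"
  shows "norm (f b - f a - (\<integral>x. indicator K x *\<^sub>R D x \<partial>lborel)) \<le> N * measure lborel ({a..b} - K)"
proof -
  have ab: "a \<le> b" using K by auto
  define L where "L x = Sup (K \<inter> {..x})" for x
  define R where "R x = Inf (K \<inter> {x..})" for x
  have L: "L x \<in> K" "L x \<le> x" "\<And>k. k \<in> K \<Longrightarrow> k \<le> x \<Longrightarrow> k \<le> L x" if "a \<le> x" for x
  proof -
    have "closed (K \<inter> {..x})" "K \<inter> {..x} \<noteq> {}" and bdd: "bdd_above (K \<inter> {..x})"
      using K that by (auto intro!: closed_Int bdd_aboveI[of _ x])
    then have "L x \<in> K \<inter> {..x}" unfolding L_def by (intro closed_contains_Sup) auto
    then show "L x \<in> K" "L x \<le> x" by auto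
    show "\<And>k. k \<in> K \<Longrightarrow> k \<le> x \<Longrightarrow> k \<le> L x" unfolding L_def using bdd by (intro cSup_upper) auto
  qed
  have R: "R x \<in> K" "x \<le> R x" "\<And>k. k \<in> K \<Longrightarrow> x \<le> k \<Longrightarrow> R x \<le> k" if "x \<le> b" for x
  proof -
    have "closed (K \<inter> {x..})" "K \<inter> {x..} \<noteq> {}" and bdd: "bdd_below (K \<inter> {x..})"
      using K that by (auto intro!: closed_Int bdd_belowI[of _ x])
    then have "R x \<in> K \<inter> {x..}" unfolding R_def by (intro closed_contains_Inf) auto
    then show "R x \<in> K" "x \<le> R x" by auto
    show "\<And>k. k \<in> K \<Longrightarrow> x \<le> k \<Longrightarrow> R x \<le> k" unfolding R_def using bdd by (intro cInf_lower) auto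
  qed
  \<comment> \<open>On \<open>K\<close> both end points coincide with \<open>x\<close>, and the quotient \<open>0 / 0 = 0\<close> makes \<open>g x = f x\<close>.\<close>
  define g where "g x = f (L x) + ((x - L x) / (R x - L x)) *\<^sub>R (f (R x) - f (L x))" for x
  have LK: "L x = x" "R x = x" if "x \<in> K" for x
    using that L[of x] R[of x] K by (auto intro!: antisym)
  have gK: "g x = f x" if "x \<in> K" for x
    using LK[OF that] by (simp add: g_def)
  have sides: "p \<le> L x \<or> R x \<le> p" if "p \<in> K" "x \<in> {a..b}" for p x
    using L(3)[of x p] R(3)[of x p] that by fastforce
  have gp: "norm (g x - g p) \<le> N * \<bar>x - p\<bar>" if "p \<in> K" "x \<in> {a..b}" for p x
  proof -
    have "norm (g x - f p - (x - p) *\<^sub>R 0) \<le> N * \<bar>x - p\<bar>"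
      unfolding g_def using that L R sides[OF that] by (intro affine_interpolation_error) (auto intro!: lip)
    then show ?thesis by (simp add: gK that)
  qed
  have glip: "norm (g x - g y) \<le> N * \<bar>x - y\<bar>" if "x \<in> {a..b}" "y \<in> {a..b}" for x y
    using that
  proof (induction x y rule: linorder_wlog)
    case (sym x y) then show ?case by (simp add: norm_minus_commute abs_minus_commute)
  next
    case (le x y)
    show ?case
    proof (cases "\<exists>k\<in>K. x \<le> k \<and> k \<le> y")
      case True
      then obtain k where k: "k \<in> K" "x \<le> k" "k \<le> y" by auto
      have "norm (g x - g y) \<le> norm (g x - g k) + norm (g y - g k)"
        using norm_triangle_ineq4[of "g x - g k" "g y - g k"] by simp
      also have "\<dots> \<le> N * \<bar>x - k\<bar> + N * \<bar>y - k\<bar>"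
        using le k by (intro add_mono gp) auto
      also have "\<dots> = N * \<bar>x - y\<bar>" using k by (simp add: algebra_simps)
      finally show ?thesis .
    next
      case False
      have "L x = L y" "R x = R y"
      proof -
        have "L y \<le> x" "y \<le> R x"
          using False L(1,2)[of y] R(1,2)[of x] le by fastforce+
        then have "L x \<le> L y" "L y \<le> L x" "R x \<le> R y" "R y \<le> R x"
          using L(3)[of y "L x"] L(3)[of x "L y"] R(3)[of x "R y"] R(3)[of y "R x"]
            L(1,2)[of x] L(1,2)[of y] R(1,2)[of x] R(1,2)[of y] le by auto
        then show "L x = L y" "R x = R y" by auto
      qed
      then have eq: "g x - g y = ((x - y) / (R x - L x)) *\<^sub>R (f (R x) - f (L x))"
        unfolding g_def by (simp add: diff_divide_distrib scaleR_diff_left)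
      have LR: "L x < R x"
      proof (rule ccontr)
        assume "\<not> L x < R x"
        then have "L x = x" using L(2)[of x] R(2)[of x] le by auto
        then show False using False L(1)[of x] le by auto
      qed
      have "norm (g x - g y) = \<bar>x - y\<bar> / (R x - L x) * norm (f (R x) - f (L x))"
        using LR by (simp add: eq)
      also have "\<dots> \<le> \<bar>x - y\<bar> / (R x - L x) * (N * \<bar>R x - L x\<bar>)"
        using LR le L R by (intro mult_left_mono lip) auto
      also have "\<dots> = N * \<bar>x - y\<bar>" using LR by simp
      finally show ?thesis .
    qed
  qed
  \<comment> \<open>Clamping extends \<open>g\<close> to a Lipschitz function on the whole line.\<close>
  define h where "h x = g (max a (min b x))" for x
  have hg: "h x = g x" if "x \<in> {a..b}" for x using that by (simp add: h_def)
  have hlip: "norm (h x - h y) \<le> N * \<bar>x - y\<bar>" for x y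
  proof -
    have "norm (h x - h y) \<le> N * \<bar>max a (min b x) - max a (min b y)\<bar>"
      unfolding h_def using ab by (intro glip) auto
    also have "\<dots> \<le> N * \<bar>x - y\<bar>" using N by (intro mult_left_mono) auto
    finally show ?thesis .
  qed
  define E where "E = C \<union> {p\<in>K. \<exists>d>0. {p<..<p+d} \<inter> K = {}} \<union> {p\<in>K. \<exists>d>0. {p-d<..<p} \<inter> K = {}}"
  have E: "countable E"
    unfolding E_def using C countable_right_isolated[of K] countable_left_isolated[of K] by blast
  define h' where "h' x = (if x \<in> K then D x else (f (R x) - f (L x)) /\<^sub>R (R x - L x))" for x
  have hder: "(h has_vector_derivative h' x) (at x)" if x: "x \<in> {a<..<b} - E" for x
  proof (cases "x \<in> K")
    case True
    show ?thesis
      unfolding has_vector_derivative_within_alt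
    proof (intro allI impI)
      fix e :: real assume "e > 0"
      have "(f has_vector_derivative D x) (at x within K)"
        using der[of x] x True by (simp add: E_def)
      then obtain d where d: "d > 0"
        and *: "\<And>y. y \<in> K \<Longrightarrow> \<bar>y - x\<bar> < d \<Longrightarrow> norm (f y - f x - (y - x) *\<^sub>R D x) \<le> e * \<bar>y - x\<bar>"
        using \<open>e > 0\<close> unfolding has_vector_derivative_within_alt by meson
      have "{x<..<x+d} \<inter> K \<noteq> {}"
        using x True d unfolding E_def by simp
      then obtain w where w: "w \<in> K" "x < w" "w < x + d" by auto
      have "{x-d<..<x} \<inter> K \<noteq> {}"
        using x True d unfolding E_def by simp
      then obtain u where "u \<in> K" "x - d < u" "u < x" by auto
      note uw = this(1) w(1) this(2,3) w(2,3)
      have "norm (h y - h x - (y - x) *\<^sub>R h' x) \<le> e * \<bar>y - x\<bar>" if "\<bar>y - x\<bar> < min (x - u) (w - x)" for y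
      proof -
        have y: "u < y" "y < w" using that by auto
        then have yab: "y \<in> {a..b}" using uw K by force
        have "u \<le> L y" "L y \<le> y" "y \<le> R y" "R y \<le> w"
          using L[of y] R[of y] yab uw y by auto
        then have near: "\<bar>L y - x\<bar> < d" "\<bar>R y - x\<bar> < d" using uw y by auto
        have "norm (g y - f x - (y - x) *\<^sub>R D x) \<le> e * \<bar>y - x\<bar>"
          unfolding g_def using sides[OF True yab] L[of y] R[of y] yab near
          by (intro affine_interpolation_error *) auto
        then show ?thesis using True yab x by (simp add: hg h'_def gK)
      qed
      then show "\<exists>d>0. \<forall>y\<in>UNIV. \<bar>y - x\<bar> < d \<longrightarrow> norm (h y - h x - (y - x) *\<^sub>R h' x) \<le> e * \<bar>y - x\<bar>"
        using uw by (intro exI[of _ "min (x - u) (w - x)"]) auto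
    qed
  next
    case False
    have Lx: "L x < x" "x < R x"
      using L[of x] R[of x] x False by (auto simp: less_le)
    have eq: "h y = f (L x) + ((y - L x) / (R x - L x)) *\<^sub>R (f (R x) - f (L x))" if "y \<in> {L x<..<R x}" for y
    proof -
      have y: "y \<in> {a..b}" using that L(1)[of x] R(1)[of x] x K(4) by fastforce
      have "L y = L x"
      proof (rule antisym)
        show "L x \<le> L y" using L[of y] L[of x] x y that by auto
        show "L y \<le> L x"
        proof (rule ccontr)
          assume "\<not> L y \<le> L x"
          then have "x < L y" using L(3)[of x "L y"] L(1)[of y] x y by fastforce
          then have "R x \<le> L y" using R(3)[of x "L y"] L(1)[of y] x y by auto
          then show False using L(2)[of y] that y by auto
        qed
      qed
      moreover have "R y = R x"
      proof (rule antisym)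
        show "R y \<le> R x" using R[of y] R[of x] x y that by auto
        show "R x \<le> R y"
        proof (rule ccontr)
          assume "\<not> R x \<le> R y"
          then have "R y < x" using R(3)[of x "R y"] R(1)[of y] x y by fastforce
          then have "R y \<le> L x" using L(3)[of x "R y"] R(1)[of y] x y by auto
          then show False using R(2)[of y] that y by auto
        qed
      qed
      ultimately show ?thesis using y by (simp add: hg g_def)
    qed
    have "((\<lambda>y. f (L x) + ((y - L x) / (R x - L x)) *\<^sub>R (f (R x) - f (L x))) has_vector_derivative h' x) (at x)"
      using False Lx by (auto intro!: derivative_eq_intros simp: h'_def divide_inverse)
    then show ?thesis
      by (rule has_vector_derivative_transform_within_open[of _ _ _ "{L x<..<R x}"]) (use Lx eq in auto)
  qed
  have FTC: "has_bochner_integral lborel (\<lambda>x. indicator ({a<..<b} - E) x *\<^sub>R h' x) (f b - f a)"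
    using lipschitz_fundamental_theorem[OF ab hlip hder E] ab K gK by (simp add: hg)
  have Kb[measurable]: "K \<in> sets borel" using K by simp
  have intK: "integrable lborel (\<lambda>x. indicator K x *\<^sub>R D x)"
  proof (rule Bochner_Integration.integrable_bound)
    show "integrable lborel (\<lambda>x. M * indicator {a..b} x)"
      by (intro integrable_mult_right integrable_real_indicator) (simp_all add: emeasure_lborel_Icc_eq)
    have M: "M \<ge> 0" using bd[of a] K by (meson norm_ge_zero order_trans)
    show "AE x in lborel. norm (indicator K x *\<^sub>R D x) \<le> norm (M * indicator {a..b} x)"
    proof (intro AE_I2)
      fix x show "norm (indicator K x *\<^sub>R D x) \<le> norm (M * indicator {a..b} x)"
        using bd[of x] K(4) M by (cases "x \<in> K") (auto simp: subset_iff)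
    qed
  qed (use meas in simp)
  have intN: "integrable lborel (\<lambda>x. N * indicator ({a..b} - K) x)"
  proof (intro integrable_mult_right integrable_real_indicator)
    have "emeasure lborel ({a..b} - K) \<le> emeasure lborel {a..b}" by (intro emeasure_mono) auto
    also have "\<dots> < \<infinity>" by (simp add: emeasure_lborel_Icc_eq)
    finally show "emeasure lborel ({a..b} - K) < \<infinity>" .
  qed simp
  have slope: "norm (h' x) \<le> N" if "x \<in> {a..b} - K" for x
  proof -
    have "L x \<noteq> R x" using L[of x] R[of x] that by auto
    have "L x < R x" using L[of x] R[of x] that \<open>L x \<noteq> R x\<close> by auto
    have "norm (h' x) = norm (f (R x) - f (L x)) / (R x - L x)"
      using that \<open>L x < R x\<close> by (simp add: h'_def divide_inverse)
    also have "\<dots> \<le> N"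
      using lip[of "R x" "L x"] L(1)[of x] R(1)[of x] that \<open>L x < R x\<close>
      by (subst pos_divide_le_eq) auto
    finally show ?thesis .
  qed
  have "AE x in lborel. x \<notin> insert a (insert b E)"
    using E by (intro AE_not_in countable_imp_null_set_lborel) auto
  then have ae: "AE x in lborel. norm (indicator ({a<..<b} - E) x *\<^sub>R h' x - indicator K x *\<^sub>R D x)
      \<le> N * indicator ({a..b} - K) x"
  proof eventually_elim
    case (elim x)
    then show ?case using slope[of x] K by (auto simp: indicator_def h'_def)
  qed
  have "f b - f a - (\<integral>x. indicator K x *\<^sub>R D x \<partial>lborel)
      = (\<integral>x. indicator ({a<..<b} - E) x *\<^sub>R h' x - indicator K x *\<^sub>R D x \<partial>lborel)"
    using FTC intK by (subst Bochner_Integration.integral_diff) (auto simp: has_bochner_integral_iff)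
  also have "norm \<dots> \<le> (\<integral>x. norm (indicator ({a<..<b} - E) x *\<^sub>R h' x - indicator K x *\<^sub>R D x) \<partial>lborel)"
    by (rule integral_norm_bound)
  also have "\<dots> \<le> (\<integral>x. N * indicator ({a..b} - K) x \<partial>lborel)"
    using FTC intK by (intro integral_mono_AE[OF _ intN ae]) (auto simp: has_bochner_integral_iff)
  also have "\<dots> = N * measure lborel ({a..b} - K)" by simp
  finally show ?thesis .
qed

section \<open>Increments across a rectangle and area integrals of partial derivatives\<close>

lemma closed_subset_imp_compact:
  fixes S :: "'a::heine_borel set"
  shows "closed S \<Longrightarrow> compact T \<Longrightarrow> S \<subseteq> T \<Longrightarrow> compact S"
  by (meson bounded_subset compact_eq_bounded_closed)

lemma integrable_bounded_compact_support:
  fixes f :: "'a::euclidean_space \<Rightarrow> 'b::{banach, second_countable_topology}"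
  assumes "(\<lambda>x. indicator S x *\<^sub>R f x) \<in> borel_measurable borel" "compact S"
    and "\<And>x. x \<in> S \<Longrightarrow> norm (f x) \<le> M"
  shows "integrable lborel (\<lambda>x. indicator S x *\<^sub>R f x)"
proof (rule Bochner_Integration.integrable_bound)
  show "integrable lborel (\<lambda>x. \<bar>M\<bar> * indicator S x)"
    using emeasure_compact_finite[OF assms(2)] borel_compact[OF assms(2)]
    by (intro integrable_mult_right integrable_real_indicator) simp_all
  show "AE x in lborel. norm (indicator S x *\<^sub>R f x) \<le> norm (\<bar>M\<bar> * indicator S x)"
    using assms(3) by (intro AE_I2) (auto simp: indicator_def intro: order_trans[OF _ abs_ge_self])
qed (use assms in simp)

text \<open>
This is the central estimate. The set \<open>F\<close> lies in the rectangle \<open>[a, b] \<times> [c, d]\<close>, and the smaller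
rectangle \<open>[a1, b1] \<times> [c1, d1]\<close> contains \<open>F\<close> and has points of \<open>F\<close> on its left and right sides.
For each height \<open>y\<close> the increment of \<open>W\<close> along the horizontal line is compared with the integral
of \<open>D\<close> over the slice of \<open>F\<close>. If the slice is nonempty, the error is controlled by the length of
the complement of the slice, by the one-dimensional lemma. If the slice is empty, the increment is
bounded by a multiple of \<open>b - a\<close>, with a factor that depends on the aspect ratio \<open>\<kappa>\<close>, and \<open>b - a\<close>
is again the length of the complement: walk from one side to the other along vertical and
horizontal lines through the points of \<open>F\<close> on the two sides. Integrating over \<open>y\<close> turns the
lengths into the area of the complement of \<open>F\<close>.
\<close>
lemma horizontal_increment_vs_area_integral:
  fixes W :: "real \<Rightarrow> real \<Rightarrow> complex" and D :: "real \<times> real \<Rightarrow> complex"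
  assumes F: "closed F" "F \<subseteq> {a..b} \<times> {c..d}" "F \<subseteq> {a1..b1} \<times> {c1..d1}"
    and side: "(a1, ya) \<in> F" "(b1, yb) \<in> F"
    and cd: "c \<le> c1" "d1 \<le> d"
    and hx: "\<And>x x0 y. (x0, y) \<in> F \<Longrightarrow> x \<in> {a..b} \<Longrightarrow> norm (W x y - W x0 y) \<le> N * \<bar>x - x0\<bar>"
    and hy: "\<And>x y y0. (x, y0) \<in> F \<Longrightarrow> y \<in> {c..d} \<Longrightarrow> norm (W x y - W x y0) \<le> N * \<bar>y - y0\<bar>"
    and der: "\<And>x y. (x, y) \<in> F - C \<Longrightarrow> ((\<lambda>x. W x y) has_vector_derivative D (x, y)) (at x within {a..b})"
    and C: "countable C"
    and bd: "\<And>z. z \<in> F \<Longrightarrow> norm (D z) \<le> N"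
    and meas: "(\<lambda>z. indicator F z *\<^sub>R D z) \<in> borel_measurable borel"
    and cont: "continuous_on ({a..b} \<times> {c..d}) (\<lambda>(x, y). W x y)"
    and ratio: "d - c \<le> \<kappa> * (b - a)" "\<kappa> \<ge> 0" and N: "N \<ge> 0"
  shows "norm (integral {c1..d1} (\<lambda>y. W b1 y - W a1 y) - (\<integral>z. indicator F z *\<^sub>R D z \<partial>lborel))
      \<le> N * (1 + 3 * \<kappa>) * measure lborel ({a..b} \<times> {c..d} - F)"
proof -
  define B where "B = N * (1 + 3 * \<kappa>)"
  have B: "B \<ge> 0" "N \<le> B" using N ratio by (auto simp: B_def algebra_simps)
  have ab1: "a \<le> a1" "a1 \<le> b1" "b1 \<le> b" "ya \<in> {c1..d1}" "yb \<in> {c1..d1}"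
    using F side by auto
  have [measurable]: "F \<in> sets borel" "F \<in> sets (borel \<Otimes>\<^sub>M borel)" using borel_closed[OF F(1)] unfolding borel_prod by simp_all
  have [measurable]: "(\<lambda>z. indicator F z *\<^sub>R D z) \<in> borel_measurable (borel \<Otimes>\<^sub>M borel)"
    using meas by (simp add: borel_prod)
  define \<Phi> where "\<Phi> y = (\<integral>x. indicator F (x, y) *\<^sub>R D (x, y) \<partial>lborel)" for y
  define Fs where "Fs y = {x. (x, y) \<in> F}" for y
  have Fs: "closed (Fs y)" "Fs y \<subseteq> {a..b}" "Fs y \<subseteq> {a1..b1}" for y
  proof -
    have "Fs y = (\<lambda>x. (x, y)) -` F" by (auto simp: Fs_def)
    then show "closed (Fs y)" using F(1) by (simp add: closed_vimage continuous_on_Pair)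
  qed (use F in \<open>auto simp: Fs_def\<close>)
  have slice: "norm (W b1 y - W a1 y - \<Phi> y) \<le> B * measure lborel ({a..b} - Fs y)"
    if y: "y \<in> {c1..d1}" for y
  proof (cases "Fs y = {}")
    case True
    then have "\<And>x. indicator F (x, y) = (0::real)" by (auto simp: Fs_def)
    then have "\<Phi> y = 0" by (simp add: \<Phi>_def)
    \<comment> \<open>The route is \<open>(b1, y)\<close>, \<open>(b1, yb)\<close>, \<open>(b1, ya)\<close>, \<open>(a1, ya)\<close>, \<open>(a1, y)\<close>; each leg has an end in \<open>F\<close>.\<close>
    have "norm (W b1 y - W a1 y) \<le> norm (W b1 y - W b1 yb) + norm (W b1 ya - W b1 yb)
        + norm (W b1 ya - W a1 ya) + norm (W a1 y - W a1 ya)"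
      by norm
    also have "\<dots> \<le> N * \<bar>y - yb\<bar> + N * \<bar>ya - yb\<bar> + N * \<bar>b1 - a1\<bar> + N * \<bar>y - ya\<bar>"
      using y ab1 cd side by (intro add_mono hx hy) auto
    also have "\<dots> = N * (\<bar>y - yb\<bar> + \<bar>ya - yb\<bar> + \<bar>b1 - a1\<bar> + \<bar>y - ya\<bar>)"
      by (simp add: algebra_simps)
    also have "\<dots> \<le> N * ((b - a) + 3 * (d - c))"
      using y ab1 cd N by (intro mult_left_mono) auto
    also have "\<dots> \<le> N * ((b - a) + 3 * (\<kappa> * (b - a)))"
      using N ratio by (intro mult_left_mono add_mono) auto
    also have "\<dots> = B * measure lborel ({a..b} - Fs y)"
      using True ab1 by (simp add: B_def algebra_simps)
    finally show ?thesis using \<open>\<Phi> y = 0\<close> by simp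
  next
    case False
    then obtain p where p: "(p, y) \<in> F" by (auto simp: Fs_def)
    define K where "K = insert a1 (insert b1 (Fs y))"
    define D' where "D' x = (if (x, y) \<in> F then D (x, y) else 0)" for x
    have KD: "indicator K x *\<^sub>R D' x = indicator F (x, y) *\<^sub>R D (x, y)" for x
      by (auto simp: K_def D'_def Fs_def indicator_def)
    have "norm (W b1 y - W a1 y - (\<integral>x. indicator K x *\<^sub>R D' x \<partial>lborel)) \<le> N * measure lborel ({a1..b1} - K)"
    proof (rule lipschitz_increment_vs_integral)
      show "closed K" "a1 \<in> K" "b1 \<in> K" "K \<subseteq> {a1..b1}"
        using Fs[of y] ab1 by (auto simp: K_def)
      show "norm (W u y - W v y) \<le> N * \<bar>u - v\<bar>" if "u \<in> K" "v \<in> K" for u v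
      proof -
        consider "(v, y) \<in> F" | "(u, y) \<in> F" | "u = v" | "u \<in> {a1,b1}" "v \<in> {a1,b1}" "u \<noteq> v"
          using \<open>u \<in> K\<close> \<open>v \<in> K\<close> by (auto simp: K_def Fs_def)
        then show ?thesis
        proof cases
          case 1 then show ?thesis using that Fs[of y] ab1 by (intro hx) (auto simp: K_def)
        next
          case 2 then have "norm (W v y - W u y) \<le> N * \<bar>v - u\<bar>"
            using that Fs[of y] ab1 by (intro hx) (auto simp: K_def)
          then show ?thesis by (simp add: norm_minus_commute abs_minus_commute)
        next
          case 3 then show ?thesis by simp
        next
          case 4
          have "norm (W u y - W v y) \<le> norm (W u y - W p y) + norm (W v y - W p y)" by norm
          also have "\<dots> \<le> N * \<bar>u - p\<bar> + N * \<bar>v - p\<bar>"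
            using p 4 ab1 by (intro add_mono hx) auto
          also have "\<dots> = N * (\<bar>u - p\<bar> + \<bar>v - p\<bar>)" by (simp add: algebra_simps)
          also have "\<bar>u - p\<bar> + \<bar>v - p\<bar> = \<bar>u - v\<bar>" using 4 p F(3) by auto
          finally show ?thesis .
        qed
      qed
      show "((\<lambda>x. W x y) has_vector_derivative D' x) (at x within K)"
        if "x \<in> K - insert a1 (insert b1 {x. (x, y) \<in> C})" for x
      proof -
        have "(x, y) \<in> F - C" using that by (auto simp: K_def Fs_def)
        then have "((\<lambda>x. W x y) has_vector_derivative D' x) (at x within {a..b})"
          using der[of x y] by (simp add: D'_def)
        then show ?thesis by (rule has_vector_derivative_within_subset) (use Fs[of y] ab1 in \<open>auto simp: K_def\<close>)
      qed
      have "{x. (x, y) \<in> C} \<subseteq> fst ` C" by force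
      then have "countable {x. (x, y) \<in> C}" using C by (meson countable_image countable_subset)
      then show "countable (insert a1 (insert b1 {x. (x, y) \<in> C}))" by simp
      show "norm (D' x) \<le> N" for x using bd[of "(x, y)"] N by (auto simp: D'_def)
      show "(\<lambda>x. indicator K x *\<^sub>R D' x) \<in> borel_measurable borel"
        unfolding KD by measurable
    qed (use N in auto)
    also have "\<dots> \<le> B * measure lborel ({a..b} - Fs y)"
    proof (intro mult_mono B measure_nonneg)
      have "{a..b} - Fs y \<in> fmeasurable lborel"
        using closed_subset_imp_compact[OF Fs(1) compact_Icc Fs(2)]
        by (intro fmeasurable.Diff fmeasurable_compact compact_Icc)
      then show "measure lborel ({a1..b1} - K) \<le> measure lborel ({a..b} - Fs y)"
        using ab1 Fs(1)[of y] by (intro measure_mono_fmeasurable) (auto simp: K_def)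
    qed
    finally show ?thesis by (simp add: KD \<Phi>_def)
  qed
  have compF: "compact F"
    by (rule closed_subset_imp_compact[OF F(1) _ F(2)]) (intro compact_Times compact_Icc)
  have intF: "integrable (lborel \<Otimes>\<^sub>M lborel) (\<lambda>z. indicator F z *\<^sub>R D z)"
    using integrable_bounded_compact_support[OF meas compF bd] by (simp add: lborel_prod)
  have \<Phi>int: "(\<integral>z. indicator F z *\<^sub>R D z \<partial>lborel) = (\<integral>y. \<Phi> y \<partial>lborel)" and \<Phi>i: "integrable lborel \<Phi>"
    using lborel_pair.integral_snd[of "\<lambda>x y. indicator F (x, y) *\<^sub>R D (x, y)"]
      lborel_pair.integrable_snd[of "\<lambda>x y. indicator F (x, y) *\<^sub>R D (x, y)"] intF
    by (simp_all add: \<Phi>_def[abs_def] lborel_prod split_def)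
  have \<Phi>0: "\<Phi> y = 0" if "y \<notin> {c1..d1}" for y
  proof -
    have "\<And>x. indicator F (x, y) = (0::real)" using that F(3) by (auto simp: indicator_def)
    then show ?thesis by (simp add: \<Phi>_def)
  qed
  define G where "G x y = (indicator ({a..b} \<times> {c..d} - F) (x, y) :: real)" for x y
  have Gint: "integrable (lborel \<Otimes>\<^sub>M lborel) (\<lambda>(x, y). G x y)"
  proof -
    have "emeasure lborel ({a..b} \<times> {c..d} - F) \<le> emeasure lborel ({a..b} \<times> {c..d})"
      using F(1) by (intro emeasure_mono) (auto intro!: borel_closed closed_Times)
    also have "\<dots> < \<infinity>" by (intro emeasure_compact_finite compact_Times compact_Icc)
    finally have "integrable lborel (indicator ({a..b} \<times> {c..d} - F) :: _ \<Rightarrow> real)"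
      using borel_closed[OF F(1)] borel_closed[OF closed_Times[OF closed_atLeastAtMost closed_atLeastAtMost], of a b c d]
      by (intro integrable_real_indicator) auto
    then show ?thesis by (simp add: G_def lborel_prod)
  qed
  have Gx: "(\<integral>x. G x y \<partial>lborel) = indicator {c..d} y * measure lborel ({a..b} - Fs y)" for y
  proof -
    have "G x y = indicator {c..d} y * indicator ({a..b} - Fs y) x" for x
      by (auto simp: G_def Fs_def indicator_def)
    then show ?thesis using Fs(1)[of y] by simp
  qed
  have Gm: "(\<integral>y. \<integral>x. G x y \<partial>lborel \<partial>lborel) = measure lborel ({a..b} \<times> {c..d} - F)"
    and Gi: "integrable lborel (\<lambda>y. \<integral>x. G x y \<partial>lborel)"
    using lborel_pair.integral_snd[OF Gint] lborel_pair.integrable_snd[OF Gint]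
    by (simp_all add: G_def lborel_prod split_def)
  have contW: "continuous_on {c1..d1} (\<lambda>y. W b1 y - W a1 y)"
  proof -
    have "continuous_on {c1..d1} (\<lambda>y. (\<lambda>(x, y). W x y) (x, y))" if "x \<in> {a..b}" for x
      by (rule continuous_on_compose2[OF cont]) (use that cd in \<open>auto intro!: continuous_intros\<close>)
    from this[of b1] this[of a1] show ?thesis using ab1 by (intro continuous_on_diff) auto
  qed
  have Wi: "set_integrable lborel {c1..d1} (\<lambda>y. W b1 y - W a1 y)"
    by (rule borel_integrable_atLeastAtMost'[OF contW])
  have "integral {c1..d1} (\<lambda>y. W b1 y - W a1 y) - (\<integral>z. indicator F z *\<^sub>R D z \<partial>lborel)
      = (\<integral>y. indicator {c1..d1} y *\<^sub>R (W b1 y - W a1 y) - \<Phi> y \<partial>lborel)"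
    using Wi \<Phi>i unfolding \<Phi>int set_borel_integral_eq_integral(2)[OF Wi, symmetric]
    by (simp add: set_lebesgue_integral_def set_integrable_def)
  also have "norm \<dots> \<le> (\<integral>y. B * (\<integral>x. G x y \<partial>lborel) \<partial>lborel)"
  proof (rule Bochner_Integration.integral_norm_bound_integral)
    show "integrable lborel (\<lambda>y. indicator {c1..d1} y *\<^sub>R (W b1 y - W a1 y) - \<Phi> y)"
      using Wi \<Phi>i by (simp add: set_integrable_def)
    show "integrable lborel (\<lambda>y. B * (\<integral>x. G x y \<partial>lborel))" using Gi by simp
    show "norm (indicator {c1..d1} y *\<^sub>R (W b1 y - W a1 y) - \<Phi> y) \<le> B * (\<integral>x. G x y \<partial>lborel)" for y
    proof (cases "y \<in> {c1..d1}")
      case True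
      then show ?thesis using slice[OF True] cd by (simp add: Gx)
    next
      case False
      then show ?thesis using B \<Phi>0[OF False] by (simp add: Gx)
    qed
  qed
  also have "\<dots> = B * measure lborel ({a..b} \<times> {c..d} - F)"
    by (simp add: Gm)
  finally show ?thesis by (simp add: B_def)
qed

lemma has_vector_derivative_shift:
  assumes "(f has_vector_derivative D) (at (0::real))"
  shows "((\<lambda>x. f (x - a)) has_vector_derivative D) (at a)"
proof -
  have "((\<lambda>x. x - a) has_vector_derivative 1) (at a)" by (auto intro!: derivative_eq_intros)
  from vector_diff_chain_at[OF this, of f D] assms show ?thesis by (simp add: o_def)
qed

lemma has_vector_derivative_shift_0:
  assumes "(f has_vector_derivative D) (at (a::real))"
  shows "((\<lambda>t. f (a + t)) has_vector_derivative D) (at 0)"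
proof -
  have "((\<lambda>t. a + t) has_vector_derivative 1) (at 0)" by (auto intro!: derivative_eq_intros)
  from vector_diff_chain_at[OF this, of f D] assms show ?thesis by (simp add: o_def)
qed

lemma has_partials_at_slices:
  assumes "has_partials_at w (Complex x y)"
  shows "((\<lambda>s. w (Complex s y)) has_vector_derivative partial_x w (Complex x y)) (at x)"
    and "((\<lambda>s. w (Complex x s)) has_vector_derivative partial_y w (Complex x y)) (at y)"
proof -
  have "((\<lambda>t. w (Complex x y + of_real t)) has_vector_derivative partial_x w (Complex x y)) (at 0)"
    and "((\<lambda>t. w (Complex x y + \<i> * of_real t)) has_vector_derivative partial_y w (Complex x y)) (at 0)"
    using assms by (simp_all add: has_partials_at_def partial_x_def partial_y_def flip: vector_derivative_works)
  note * = has_vector_derivative_shift[OF this(1), of x] has_vector_derivative_shift[OF this(2), of y]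
  have "Complex x y + of_real (s - x) = Complex s y" "Complex x y + \<i> * of_real (s - y) = Complex x s" for s
    by (simp_all add: complex_eq_iff)
  with * show "((\<lambda>s. w (Complex s y)) has_vector_derivative partial_x w (Complex x y)) (at x)"
    and "((\<lambda>s. w (Complex x s)) has_vector_derivative partial_y w (Complex x y)) (at y)" by simp_all
qed

text \<open>
The derivative is a pointwise limit of difference quotients of the function extended by zero,
which is Borel measurable.
\<close>
lemma borel_measurable_directional_derivative:
  fixes W :: "'a::euclidean_space \<Rightarrow> complex"
  assumes U: "open U" "continuous_on U W" and S: "S \<in> sets borel" "S \<subseteq> U"
    and der: "\<And>p. p \<in> S \<Longrightarrow> ((\<lambda>t. W (p + t *\<^sub>R e)) has_vector_derivative D p) (at 0)"
  shows "(\<lambda>p. indicator S p *\<^sub>R D p) \<in> borel_measurable borel"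
proof -
  define V where "V p = indicator U p *\<^sub>R W p" for p
  have [measurable]: "V \<in> borel_measurable borel"
    unfolding V_def by (rule borel_measurable_continuous_on_indicator[OF _ U(2)]) (use U in simp)
  have [measurable]: "(\<lambda>p. V (p + c *\<^sub>R e)) \<in> borel_measurable borel" for c
    by (rule measurable_compose[OF _ \<open>V \<in> borel_measurable borel\<close>]) measurable
  note S(1)[measurable]
  define q where "q n p = indicator S p *\<^sub>R (real (Suc n) *\<^sub>R (V (p + (1 / real (Suc n)) *\<^sub>R e) - V p))" for n p
  have lim: "(\<lambda>n. q n p) \<longlonglongrightarrow> indicator S p *\<^sub>R D p" for p
  proof (cases "p \<in> S")
    case True
    have T: "(\<lambda>n. 1 / real (Suc n)) \<longlonglongrightarrow> 0"
      using LIMSEQ_inverse_real_of_nat by (simp only: inverse_eq_divide)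
    have "filterlim (\<lambda>n. 1 / real (Suc n)) (at 0) sequentially"
      unfolding filterlim_at using T by simp
    from filterlim_compose[OF has_vector_derivative_quotient_tendsto[OF der[OF True]] this]
    have "(\<lambda>n. (W (p + (1 / real (Suc n)) *\<^sub>R e) - W p) /\<^sub>R (1 / real (Suc n))) \<longlonglongrightarrow> D p"
      by (simp only: diff_0_right scaleR_zero_left add_0_right)
    moreover have "\<forall>\<^sub>F n in sequentially. (W (p + (1 / real (Suc n)) *\<^sub>R e) - W p) /\<^sub>R (1 / real (Suc n)) = q n p"
    proof -
      have "(\<lambda>n. p + (1 / real (Suc n)) *\<^sub>R e) \<longlonglongrightarrow> p + 0 *\<^sub>R e"
        by (intro tendsto_intros T)
      then have "\<forall>\<^sub>F n in sequentially. p + (1 / real (Suc n)) *\<^sub>R e \<in> U"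
        using topological_tendstoD[OF _ U(1)] True S(2) by auto
      then show ?thesis
        by eventually_elim
          (use True S(2) in \<open>auto simp: q_def V_def inverse_eq_divide simp del: of_nat_Suc\<close>)
    qed
    ultimately show ?thesis using True by (auto intro: Lim_transform_eventually)
  qed (simp add: q_def)
  have "q n \<in> borel_measurable borel" for n
    unfolding q_def by measurable
  then show ?thesis by (rule borel_measurable_LIMSEQ_metric) (rule lim)
qed

text \<open>
The same estimate for the other coordinate direction, by exchanging the coordinates.
\<close>
lemma vertical_increment_vs_area_integral:
  fixes W :: "real \<Rightarrow> real \<Rightarrow> complex" and D :: "real \<times> real \<Rightarrow> complex"
  assumes F: "closed F" "F \<subseteq> {a..b} \<times> {c..d}" "F \<subseteq> {a1..b1} \<times> {c1..d1}"
    and side: "(xc, c1) \<in> F" "(xd, d1) \<in> F"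
    and ab: "a \<le> a1" "b1 \<le> b"
    and hx: "\<And>x x0 y. (x0, y) \<in> F \<Longrightarrow> x \<in> {a..b} \<Longrightarrow> norm (W x y - W x0 y) \<le> N * \<bar>x - x0\<bar>"
    and hy: "\<And>x y y0. (x, y0) \<in> F \<Longrightarrow> y \<in> {c..d} \<Longrightarrow> norm (W x y - W x y0) \<le> N * \<bar>y - y0\<bar>"
    and der: "\<And>x y. (x, y) \<in> F - C \<Longrightarrow> ((\<lambda>y. W x y) has_vector_derivative D (x, y)) (at y within {c..d})"
    and C: "countable C"
    and bd: "\<And>z. z \<in> F \<Longrightarrow> norm (D z) \<le> N"
    and meas: "(\<lambda>z. indicator F z *\<^sub>R D z) \<in> borel_measurable borel"
    and cont: "continuous_on ({a..b} \<times> {c..d}) (\<lambda>(x, y). W x y)"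
    and ratio: "b - a \<le> \<kappa> * (d - c)" "\<kappa> \<ge> 0" and N: "N \<ge> 0"
  shows "norm (integral {a1..b1} (\<lambda>x. W x d1 - W x c1) - (\<integral>z. indicator F z *\<^sub>R D z \<partial>lborel))
      \<le> N * (1 + 3 * \<kappa>) * measure lborel ({a..b} \<times> {c..d} - F)"
proof -
  define F' where "F' = prod.swap -` F"
  have swap: "continuous_on UNIV (prod.swap :: real \<times> real \<Rightarrow> _)"
    by (intro continuous_on_swap)
  have ind: "indicator F' z = (indicator F (prod.swap z) :: real)" for z
    by (simp add: F'_def indicator_def)
  have [measurable]: "(prod.swap :: real \<times> real \<Rightarrow> _) \<in> borel_measurable borel"
    by (rule borel_measurable_continuous_onI[OF swap])
  have swap_integral: "(\<integral>z. f (prod.swap z) \<partial>lborel) = (\<integral>z. f z \<partial>lborel)"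
    if "f \<in> borel_measurable borel" for f :: "real \<times> real \<Rightarrow> 'b::{banach, second_countable_topology}"
    using lborel_pair.integral_product_swap[of f] that by (simp add: lborel_prod split_def prod.swap_def)
  have "norm (integral {a1..b1} (\<lambda>x. W x d1 - W x c1) - (\<integral>z. indicator F' z *\<^sub>R D (prod.swap z) \<partial>lborel))
      \<le> N * (1 + 3 * \<kappa>) * measure lborel ({c..d} \<times> {a..b} - F')"
  proof (rule horizontal_increment_vs_area_integral[where W = "\<lambda>y x. W x y" and C = "prod.swap -` C"])
    show "closed F'" unfolding F'_def by (rule closed_vimage[OF F(1) swap])
    show "F' \<subseteq> {c..d} \<times> {a..b}" "F' \<subseteq> {c1..d1} \<times> {a1..b1}" using F by (auto simp: F'_def)
    show "(c1, xc) \<in> F'" "(d1, xd) \<in> F'" using side by (auto simp: F'_def)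
    have "prod.swap -` C \<subseteq> prod.swap ` C"
    proof
      fix p :: "real \<times> real" assume "p \<in> prod.swap -` C"
      then show "p \<in> prod.swap ` C" by (intro image_eqI[of _ _ "prod.swap p"]) auto
    qed
    then show "countable (prod.swap -` C)" using C by (meson countable_image countable_subset)
    show "norm (W y x - W y x0) \<le> N * \<bar>x - x0\<bar>" if "(x0, y) \<in> F'" "x \<in> {c..d}" for x x0 y
      using that by (intro hy) (auto simp: F'_def)
    show "norm (W y x - W y0 x) \<le> N * \<bar>y - y0\<bar>" if "(x, y0) \<in> F'" "y \<in> {a..b}" for x y y0
      using that by (intro hx) (auto simp: F'_def)
    show "((\<lambda>x. W y x) has_vector_derivative D (prod.swap (x, y))) (at x within {c..d})"
      if "(x, y) \<in> F' - prod.swap -` C" for x y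
      using der[of y x] that by (simp add: F'_def)
    show "norm (D (prod.swap z)) \<le> N" if "z \<in> F'" for z
      using bd[of "prod.swap z"] that by (simp add: F'_def)
    show "continuous_on ({c..d} \<times> {a..b}) (\<lambda>(y, x). W x y)"
    proof -
      have "prod.swap ` ({c..d} \<times> {a..b}) \<subseteq> {a..b} \<times> {c..d}" by force
      from continuous_on_compose2[OF cont continuous_on_subset[OF swap subset_UNIV] this]
      show ?thesis by (simp add: split_def)
    qed
    have "(\<lambda>z. (\<lambda>z. indicator F z *\<^sub>R D z) (prod.swap z)) \<in> borel_measurable borel"
      by (rule measurable_compose[OF _ meas]) measurable
    then show "(\<lambda>z. indicator F' z *\<^sub>R D (prod.swap z)) \<in> borel_measurable borel"
      by (simp only: ind)
  qed (rule ab ratio N)+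
  moreover have "(\<integral>z. indicator F' z *\<^sub>R D (prod.swap z) \<partial>lborel) = (\<integral>z. indicator F z *\<^sub>R D z \<partial>lborel)"
    using swap_integral[OF meas] by (simp only: ind)
  moreover have "measure lborel ({c..d} \<times> {a..b} - F') = measure lborel ({a..b} \<times> {c..d} - F)"
  proof -
    have meas: "{a..b} \<times> {c..d} - F \<in> sets borel"
      using F(1) by (intro sets.Diff borel_closed closed_Times closed_atLeastAtMost)
    have "measure lborel ({c..d} \<times> {a..b} - F') = (\<integral>z. indicator ({c..d} \<times> {a..b} - F') z \<partial>lborel)"
      by simp
    also have "\<dots> = (\<integral>z. indicator ({a..b} \<times> {c..d} - F) (prod.swap z) \<partial>lborel)"
      by (intro Bochner_Integration.integral_cong) (auto simp: F'_def indicator_def)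
    also have "\<dots> = (\<integral>z. indicator ({a..b} \<times> {c..d} - F) z \<partial>lborel)"
      by (rule swap_integral) (use meas in simp)
    finally show ?thesis by simp
  qed
  ultimately show ?thesis by simp
qed

lemma vector_derivative_norm_bound:
  fixes f :: "real \<Rightarrow> complex"
  assumes "(f has_vector_derivative D) (at x within {a..b})" "a < b" "x \<in> {a..b}"
    and "\<And>y. y \<in> {a..b} \<Longrightarrow> norm (f y - f x) \<le> N * \<bar>y - x\<bar>"
  shows "norm D \<le> N"
proof (rule tendsto_upperbound)
  show "((\<lambda>y. norm ((f y - f x) /\<^sub>R (y - x))) \<longlongrightarrow> norm D) (at x within {a..b})"
    by (intro tendsto_norm has_vector_derivative_quotient_tendsto assms)
  show "\<forall>\<^sub>F y in at x within {a..b}. norm ((f y - f x) /\<^sub>R (y - x)) \<le> N"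
    unfolding eventually_at_filter
  proof (intro always_eventually allI impI)
    fix y assume y: "y \<noteq> x" "y \<in> {a..b}"
    have "norm ((f y - f x) /\<^sub>R (y - x)) = norm (f y - f x) / \<bar>y - x\<bar>"
      by (simp only: norm_scaleR abs_inverse divide_inverse mult.commute)
    also have "\<dots> \<le> N" using assms(4)[OF y(2)] y(1) by (simp add: pos_divide_le_eq)
    finally show "norm ((f y - f x) /\<^sub>R (y - x)) \<le> N" .
  qed
  show "at x within {a..b} \<noteq> bot"
    using assms(2,3) by (simp add: trivial_limit_within islimpt_Icc)
qed

section \<open>Integrals around rectangles\<close>

text \<open>
The contour integral of \<open>w\<close> along the positively oriented boundary of \<open>[a, b] \<times> [c, d]\<close>. Written
with four real integrals it makes sense for degenerate rectangles and is directly comparable with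
the increments studied above.
\<close>
definition rect_integral :: "(complex \<Rightarrow> complex) \<Rightarrow> real \<Rightarrow> real \<Rightarrow> real \<Rightarrow> real \<Rightarrow> complex" where
  "rect_integral w a b c d =
     (integral {a..b} (\<lambda>x. w (Complex x c)) - integral {a..b} (\<lambda>x. w (Complex x d)))
     + \<i> * (integral {c..d} (\<lambda>y. w (Complex b y)) - integral {c..d} (\<lambda>y. w (Complex a y)))"

lemma in_cbox_Complex: "Complex x y \<in> cbox (Complex a c) (Complex b d) \<longleftrightarrow> x \<in> {a..b} \<and> y \<in> {c..d}"
  by (auto simp: in_cbox_complex_iff)

lemma has_vector_derivative_Complex:
  "((\<lambda>x. Complex x y) has_vector_derivative 1) F" "((\<lambda>y. Complex x y) has_vector_derivative \<i>) F"
  unfolding Complex_eq by (auto intro!: derivative_eq_intros)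

lemma continuous_on_horizontal:
  assumes "continuous_on S w" "\<And>x. x \<in> T \<Longrightarrow> Complex x y \<in> S"
  shows "continuous_on T (\<lambda>x. w (Complex x y))"
  by (rule continuous_on_compose2[OF assms(1)])
     (use assms(2) in \<open>auto simp: Complex_eq intro!: continuous_intros\<close>)

lemma continuous_on_vertical:
  assumes "continuous_on S w" "\<And>y. y \<in> T \<Longrightarrow> Complex x y \<in> S"
  shows "continuous_on T (\<lambda>y. w (Complex x y))"
  by (rule continuous_on_compose2[OF assms(1)])
     (use assms(2) in \<open>auto simp: Complex_eq intro!: continuous_intros\<close>)

text \<open>
Cauchy's theorem with continuity only up to the boundary: a primitive exists on the closed
rectangle, and the four real integrals telescope by the fundamental theorem of calculus.
\<close>
lemma rect_integral_eq_0:
  assumes ab: "a \<le> b" "c \<le> d"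
    and cont: "continuous_on (cbox (Complex a c) (Complex b d)) w"
    and hol: "w holomorphic_on box (Complex a c) (Complex b d)"
  shows "rect_integral w a b c d = 0"
proof -
  let ?Q = "cbox (Complex a c) (Complex b d)"
  obtain g where g: "\<And>z. z \<in> ?Q \<Longrightarrow> (g has_field_derivative w z) (at z within ?Q)"
    using holomorphic_convex_primitive[of ?Q "{}" w] cont hol
    by (metis Diff_empty convex_box(1) finite.emptyI holomorphic_on_imp_differentiable_at interior_cbox open_box)
  have hor: "integral {a..b} (\<lambda>x. w (Complex x y)) = g (Complex b y) - g (Complex a y)" if y: "y \<in> {c..d}" for y
  proof (rule integral_unique, rule fundamental_theorem_of_calculus[OF ab(1)])
    fix x assume x: "x \<in> {a..b}"
    have "((\<lambda>x. g (Complex x y)) has_vector_derivative 1 * w (Complex x y)) (at x within {a..b})"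
      by (rule field_vector_diff_chain_within[where f="\<lambda>x. Complex x y" and g=g, unfolded o_def])
         (use x y in \<open>auto intro!: has_field_derivative_subset[OF g] has_vector_derivative_Complex
            simp: in_cbox_Complex\<close>)
    then show "((\<lambda>x. g (Complex x y)) has_vector_derivative w (Complex x y)) (at x within {a..b})" by simp
  qed
  have ver: "\<i> * integral {c..d} (\<lambda>y. w (Complex x y)) = g (Complex x d) - g (Complex x c)" if x: "x \<in> {a..b}" for x
  proof -
    have "((\<lambda>y. \<i> * w (Complex x y)) has_integral g (Complex x d) - g (Complex x c)) {c..d}"
    proof (rule fundamental_theorem_of_calculus[OF ab(2)])
      fix y assume y: "y \<in> {c..d}"
      show "((\<lambda>y. g (Complex x y)) has_vector_derivative \<i> * w (Complex x y)) (at y within {c..d})"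
        by (rule field_vector_diff_chain_within[where f="\<lambda>y. Complex x y" and g=g, unfolded o_def])
           (use x y in \<open>auto intro!: has_field_derivative_subset[OF g] has_vector_derivative_Complex
              simp: in_cbox_Complex\<close>)
    qed
    from integral_unique[OF this] show ?thesis by simp
  qed
  show ?thesis
    using ab ver[of a] ver[of b] by (simp add: rect_integral_def hor ring_distribs)
qed

lemma rect_integral_split_Re:
  assumes "a \<le> m" "m \<le> b" "c \<le> d" and cont: "continuous_on (cbox (Complex a c) (Complex b d)) w"
  shows "rect_integral w a b c d = rect_integral w a m c d + rect_integral w m b c d"
proof -
  have "integral {a..m} (\<lambda>x. w (Complex x y)) + integral {m..b} (\<lambda>x. w (Complex x y))
      = integral {a..b} (\<lambda>x. w (Complex x y))" if "y \<in> {c..d}" for y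
    using assms that by (intro Henstock_Kurzweil_Integration.integral_combine integrable_continuous_real continuous_on_horizontal[OF cont])
      (auto simp: in_cbox_Complex)
  from this[of c, symmetric] this[of d, symmetric] show ?thesis
    using assms by (simp add: rect_integral_def algebra_simps)
qed

lemma rect_integral_split_Im:
  assumes "c \<le> m" "m \<le> d" "a \<le> b" and cont: "continuous_on (cbox (Complex a c) (Complex b d)) w"
  shows "rect_integral w a b c d = rect_integral w a b c m + rect_integral w a b m d"
proof -
  have "integral {c..m} (\<lambda>y. w (Complex x y)) + integral {m..d} (\<lambda>y. w (Complex x y))
      = integral {c..d} (\<lambda>y. w (Complex x y))" if "x \<in> {a..b}" for x
    using assms that by (intro Henstock_Kurzweil_Integration.integral_combine integrable_continuous_real continuous_on_vertical[OF cont])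
      (auto simp: in_cbox_Complex)
  from this[of a, symmetric] this[of b, symmetric] show ?thesis
    using assms by (simp add: rect_integral_def algebra_simps)
qed

text \<open>
On a small square, integrate from the lower left corner first horizontally and then vertically. As
the integral around rectangles vanishes, the opposite order gives the same function. One order
shows that its derivative in the vertical direction is \<open>\<i> * w\<close>, the other one that its horizontal
derivative is \<open>w\<close>; both are continuous, so it is a holomorphic primitive of \<open>w\<close>.
\<close>
lemma Morera_rectangle:
  assumes S: "open S" and cont: "continuous_on S w"
    and rect: "\<And>a b c d. a < b \<Longrightarrow> c < d \<Longrightarrow> cbox (Complex a c) (Complex b d) \<subseteq> S \<Longrightarrow> rect_integral w a b c d = 0"
  shows "w holomorphic_on S"
proof -
  have "w field_differentiable at z0" if z0: "z0 \<in> S" for z0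
  proof -
    obtain e where e: "e > 0" "cball z0 (2 * e) \<subseteq> S"
    proof -
      obtain e where "e > 0" "cball z0 e \<subseteq> S" using S z0 open_contains_cball by blast
      then show ?thesis using that[of "e / 2"] by simp
    qed
    define a b c d where "a = Re z0 - e" and "b = Re z0 + e" and "c = Im z0 - e" and "d = Im z0 + e"
    have QS: "cbox (Complex a c) (Complex b d) \<subseteq> S"
    proof
      fix z assume z: "z \<in> cbox (Complex a c) (Complex b d)"
      have "norm (z0 - z) \<le> \<bar>Re (z0 - z)\<bar> + \<bar>Im (z0 - z)\<bar>" by (rule cmod_le)
      also have "\<dots> \<le> 2 * e" using z by (auto simp: in_cbox_complex_iff a_def b_def c_def d_def)
      finally show "z \<in> S" using e(2) by (auto simp: dist_norm)
    qed
    have contQ: "continuous_on (cbox (Complex a c) (Complex b d)) w"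
      by (rule continuous_on_subset[OF cont QS])
    define \<Phi> where "\<Phi> x y = integral {a..x} (\<lambda>t. w (Complex t c)) + \<i> * integral {c..y} (\<lambda>s. w (Complex x s))" for x y
    have \<Phi>': "\<Phi> x y = \<i> * integral {c..y} (\<lambda>s. w (Complex a s)) + integral {a..x} (\<lambda>t. w (Complex t y))"
      if x: "x \<in> {a<..<b}" and y: "y \<in> {c<..<d}" for x y
    proof -
      have "cbox (Complex a c) (Complex x y) \<subseteq> cbox (Complex a c) (Complex b d)"
        using x y by (auto simp: in_cbox_complex_iff)
      with QS have "rect_integral w a x c y = 0" using x y by (intro rect) auto
      then show ?thesis by (simp add: rect_integral_def \<Phi>_def algebra_simps)
    qed
    have dx: "((\<lambda>x. \<Phi> x y) has_vector_derivative w (Complex x y)) (at x within {a<..<b})"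
      if x: "x \<in> {a<..<b}" and y: "y \<in> {c<..<d}" for x y
    proof -
      have "((\<lambda>x. integral {a..x} (\<lambda>t. w (Complex t y))) has_vector_derivative w (Complex x y)) (at x within {a..b})"
        using x y by (intro integral_has_vector_derivative continuous_on_horizontal[OF contQ]) (auto simp: in_cbox_Complex)
      then have "((\<lambda>x. \<i> * integral {c..y} (\<lambda>s. w (Complex a s)) + integral {a..x} (\<lambda>t. w (Complex t y)))
           has_vector_derivative w (Complex x y)) (at x within {a<..<b})"
        by (auto intro!: derivative_eq_intros elim: has_vector_derivative_within_subset)
      then show ?thesis
        by (rule has_vector_derivative_transform[OF x, rotated]) (use \<Phi>' y in auto)
    qed
    have dy: "((\<lambda>y. \<Phi> x y) has_vector_derivative \<i> * w (Complex x y)) (at y within {c<..<d})"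
      if x: "x \<in> {a<..<b}" and y: "y \<in> {c<..<d}" for x y
    proof -
      have "((\<lambda>y. integral {c..y} (\<lambda>s. w (Complex x s))) has_vector_derivative w (Complex x y)) (at y within {c..d})"
        using x y by (intro integral_has_vector_derivative continuous_on_vertical[OF contQ]) (auto simp: in_cbox_Complex)
      then have "((\<lambda>y. integral {c..y} (\<lambda>s. w (Complex x s))) has_vector_derivative w (Complex x y)) (at y within {c<..<d})"
        by (rule has_vector_derivative_within_subset) auto
      then show ?thesis unfolding \<Phi>_def by (auto intro!: derivative_eq_intros)
    qed
    have hd: "((\<lambda>(x, y). \<Phi> x y) has_derivative
        (\<lambda>(s, t). s *\<^sub>R w (Complex x y) + blinfun_scaleR_left (\<i> * w (Complex x y)) t))
        (at (x, y) within {a<..<b} \<times> {c<..<d})" if x: "x \<in> {a<..<b}" and y: "y \<in> {c<..<d}" for x y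
    proof (rule has_derivative_partialsI[where fy = "\<lambda>x y. blinfun_scaleR_left (\<i> * w (Complex x y))"])
      show "((\<lambda>x. \<Phi> x y) has_derivative (\<lambda>s. s *\<^sub>R w (Complex x y))) (at x within {a<..<b})"
        using dx[OF x y] by (simp add: has_vector_derivative_def)
      show "((\<lambda>y. \<Phi> x y) has_derivative blinfun_apply (blinfun_scaleR_left (\<i> * w (Complex x y)))) (at y within {c<..<d})"
        if "x \<in> {a<..<b}" "y \<in> {c<..<d}" for x y
        using dy[OF that] by (simp add: has_vector_derivative_def)
      have "continuous_on ({a<..<b} \<times> {c<..<d}) (\<lambda>z. w (Complex (fst z) (snd z)))"
        by (rule continuous_on_compose2[OF contQ])
           (auto simp: in_cbox_Complex intro!: continuous_on_Complex continuous_on_fst continuous_on_snd continuous_on_id)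
      then have "((\<lambda>z. w (Complex (fst z) (snd z))) \<longlongrightarrow> w (Complex x y)) (at (x, y) within {a<..<b} \<times> {c<..<d})"
        using x y unfolding continuous_on_def by force
      then show "continuous (at (x, y) within {a<..<b} \<times> {c<..<d}) (\<lambda>(x, y). blinfun_scaleR_left (\<i> * w (Complex x y)))"
        unfolding split_def continuous_within fst_conv snd_conv by (intro bounded_linear.tendsto[OF bounded_linear_blinfun_scaleR_left] tendsto_mult_left)
    qed (use y in auto)
    have fd: "((\<lambda>z. \<Phi> (Re z) (Im z)) has_field_derivative w z) (at z)" if z: "z \<in> box (Complex a c) (Complex b d)" for z
    proof -
      have xy: "Re z \<in> {a<..<b}" "Im z \<in> {c<..<d}" using z by (auto simp: in_box_complex_iff)
      have op: "open ({a<..<b} \<times> {c<..<d})" by (intro open_Times) auto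
      have "((\<lambda>(x, y). \<Phi> x y) has_derivative (\<lambda>(s, t). s *\<^sub>R w z + t *\<^sub>R (\<i> * w z))) (at (Re z, Im z))"
        using hd[OF xy] at_within_open[OF _ op, of "(Re z, Im z)"] xy by simp
      moreover have "((\<lambda>z. (Re z, Im z)) has_derivative (\<lambda>h. (Re h, Im h))) (at z)"
        by (auto intro!: derivative_eq_intros)
      ultimately have "((\<lambda>z. \<Phi> (Re z) (Im z)) has_derivative (\<lambda>h. Re h *\<^sub>R w z + Im h *\<^sub>R (\<i> * w z))) (at z)"
        using has_derivative_compose[where f="\<lambda>z. (Re z, Im z)" and g="\<lambda>(x, y). \<Phi> x y" and s=UNIV and x=z] by fastforce
      also have "(\<lambda>h. Re h *\<^sub>R w z + Im h *\<^sub>R (\<i> * w z)) = (*) (w z)"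
        by (auto simp: fun_eq_iff complex_eq_iff algebra_simps)
      finally show ?thesis by (simp add: has_field_derivative_def)
    qed
    have "w holomorphic_on box (Complex a c) (Complex b d)"
      by (rule derivative_is_holomorphic[OF open_box fd])
    moreover have "z0 \<in> box (Complex a c) (Complex b d)"
      using e by (auto simp: in_box_complex_iff a_def b_def c_def d_def)
    ultimately show ?thesis using holomorphic_on_imp_differentiable_at[OF _ open_box] by blast
  qed
  then show ?thesis using S by (simp add: holomorphic_on_def field_differentiable_at_within)
qed

section \<open>Functions with Lipschitz bounds along the axes\<close>

lemma infdist_eq_0_closed: "closed S \<Longrightarrow> S \<noteq> {} \<Longrightarrow> infdist x S \<le> 0 \<longleftrightarrow> x \<in> S"
  using infdist_nonneg[of x S] in_closed_iff_infdist_zero[of S x] by force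

text \<open>
The situation to which the Baire category theorem reduces the Looman--Menchoff theorem. The set
\<open>F\<close> contains the points where \<open>w\<close> might fail to be holomorphic; there \<open>w\<close> satisfies a Lipschitz
condition along the two axes with one constant, and the Cauchy--Riemann equation up to a null set
\<open>Z\<close>. The countable set \<open>C\<close> consists of points without partial derivatives.
\<close>
locale axis_lipschitz_CR =
  fixes U F C Z :: "complex set" and w :: "complex \<Rightarrow> complex" and N :: real
  assumes U: "open U" and cont: "continuous_on U w"
    and F: "closed F" and hol: "w holomorphic_on U - F"
    and N: "N \<ge> 0"
    and lip: "\<And>z z'. z \<in> F \<inter> U \<Longrightarrow> z' \<in> U \<Longrightarrow> Re z' = Re z \<or> Im z' = Im z \<Longrightarrow>
      norm (w z' - w z) \<le> N * norm (z' - z)"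
    and C: "countable C" and partials: "\<And>z. z \<in> F \<inter> U - C \<Longrightarrow> has_partials_at w z"
    and Z: "negligible Z" and CR: "\<And>z. z \<in> F \<inter> U - Z \<Longrightarrow> dbar w z = 0"
begin

lemma continuous_on_cbox: "cbox z z' \<subseteq> U \<Longrightarrow> continuous_on (cbox z z') w"
  by (rule continuous_on_subset[OF cont])

lemma rect_integral_off_F:
  assumes "a \<le> b" "c \<le> d" "cbox (Complex a c) (Complex b d) \<subseteq> U"
    and "F \<inter> box (Complex a c) (Complex b d) = {}"
  shows "rect_integral w a b c d = 0"
proof (rule rect_integral_eq_0[OF assms(1,2) continuous_on_cbox[OF assms(3)]])
  have "box (Complex a c) (Complex b d) \<subseteq> U - F"
    using assms(3,4) box_subset_cbox by blast
  then show "w holomorphic_on box (Complex a c) (Complex b d)"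
    by (rule holomorphic_on_subset[OF hol])
qed

text \<open>
Between the two rectangles there is no point of \<open>F\<close>, so by Cauchy's theorem only the part that
carries \<open>F\<close> contributes.
\<close>
lemma rect_integral_shrink:
  assumes Q: "cbox (Complex a c) (Complex b d) \<subseteq> U"
    and ord: "a \<le> a1" "a1 \<le> b1" "b1 \<le> b" "c \<le> c1" "c1 \<le> d1" "d1 \<le> d"
    and FR: "F \<inter> cbox (Complex a c) (Complex b d) \<subseteq> cbox (Complex a1 c1) (Complex b1 d1)"
  shows "rect_integral w a b c d = rect_integral w a1 b1 c1 d1"
proof -
  have sub: "cbox (Complex s u) (Complex t v) \<subseteq> U"
    if "a \<le> s" "t \<le> b" "c \<le> u" "v \<le> d" for s t u v
    using Q that by (auto simp: in_cbox_complex_iff subset_iff)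
  have zero: "rect_integral w s t u v = 0"
    if "a \<le> s" "s \<le> t" "t \<le> b" "c \<le> u" "u \<le> v" "v \<le> d"
      and "t \<le> a1 \<or> b1 \<le> s \<or> v \<le> c1 \<or> d1 \<le> u" for s t u v
  proof (rule rect_integral_off_F)
    show "F \<inter> box (Complex s u) (Complex t v) = {}"
    proof (rule ccontr)
      assume "F \<inter> box (Complex s u) (Complex t v) \<noteq> {}"
      then obtain z where z: "z \<in> F" "z \<in> box (Complex s u) (Complex t v)" by blast
      then have "z \<in> cbox (Complex a c) (Complex b d)"
        using that by (auto simp: in_cbox_complex_iff in_box_complex_iff)
      with z FR have "z \<in> cbox (Complex a1 c1) (Complex b1 d1)" by blast
      with z that show False by (auto simp: in_cbox_complex_iff in_box_complex_iff)
    qed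
  qed (use that sub in auto)
  have "rect_integral w a b c d = rect_integral w a a1 c d + rect_integral w a1 b c d"
    using ord by (intro rect_integral_split_Re continuous_on_cbox sub) auto
  also have "rect_integral w a1 b c d = rect_integral w a1 b1 c d + rect_integral w b1 b c d"
    using ord by (intro rect_integral_split_Re continuous_on_cbox sub) auto
  also have "rect_integral w a1 b1 c d = rect_integral w a1 b1 c c1 + rect_integral w a1 b1 c1 d"
    using ord by (intro rect_integral_split_Im continuous_on_cbox sub) auto
  also have "rect_integral w a1 b1 c1 d = rect_integral w a1 b1 c1 d1 + rect_integral w a1 b1 d1 d"
    using ord by (intro rect_integral_split_Im continuous_on_cbox sub) auto
  finally show ?thesis
    using ord by (simp add: zero)
qed

text \<open>
The integral around a rectangle that meets \<open>F\<close> is at most a constant times the area of the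
rectangle outside \<open>F\<close>. First shrink the rectangle to the smallest one that contains the relevant
part of \<open>F\<close>, so that each side touches \<open>F\<close>. The two increment estimates then express the integral,
up to such an area, as the integral over \<open>F\<close> of a multiple of \<open>dbar w\<close>, which is zero. The
constant depends on the aspect ratio \<open>\<kappa>\<close> of the rectangle.
\<close>
lemma rect_integral_bound:
  assumes ab: "a < b" "c < d" and Q: "cbox (Complex a c) (Complex b d) \<subseteq> U"
    and ratio: "d - c \<le> \<kappa> * (b - a)" "b - a \<le> \<kappa> * (d - c)" "\<kappa> \<ge> 0"
    and F0_def: "F0 = {p \<in> {a..b} \<times> {c..d}. Complex (fst p) (snd p) \<in> F}" and ne: "F0 \<noteq> {}"
  shows "norm (rect_integral w a b c d) \<le> 2 * N * (1 + 3 * \<kappa>) * measure lborel ({a..b} \<times> {c..d} - F0)"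
proof -
  have contC: "continuous_on S (\<lambda>p. Complex (fst p) (snd p))" for S
    by (intro continuous_on_Complex continuous_on_fst continuous_on_snd continuous_on_id)
  have QI: "Complex x y \<in> U" if "x \<in> {a..b}" "y \<in> {c..d}" for x y
    using Q that by (auto simp: in_cbox_Complex)
  have F0U: "Complex x y \<in> F \<inter> U" "x \<in> {a..b}" "y \<in> {c..d}" if "(x, y) \<in> F0" for x y
    using that QI by (auto simp: F0_def)
  have clF0: "closed F0"
  proof -
    have "F0 = ({a..b} \<times> {c..d}) \<inter> (\<lambda>p. Complex (fst p) (snd p)) -` F" by (auto simp: F0_def)
    then show ?thesis
      using closed_vimage[OF F contC] by (auto intro!: closed_Int closed_Times)
  qed
  have F0sub: "F0 \<subseteq> {a..b} \<times> {c..d}" by (auto simp: F0_def)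
  have comp: "compact F0"
    by (rule closed_subset_imp_compact[OF clF0 _ F0sub]) (intro compact_Times compact_Icc)
  have cfst: "continuous_on F0 fst" and csnd: "continuous_on F0 snd"
    by (intro continuous_on_fst continuous_on_snd continuous_on_id)+
  obtain a1 ya where a1: "(a1, ya) \<in> F0" "\<And>x y. (x, y) \<in> F0 \<Longrightarrow> a1 \<le> x"
    using continuous_attains_inf[OF comp ne cfst] by (metis fst_conv surj_pair)
  obtain b1 yb where b1: "(b1, yb) \<in> F0" "\<And>x y. (x, y) \<in> F0 \<Longrightarrow> x \<le> b1"
    using continuous_attains_sup[OF comp ne cfst] by (metis fst_conv surj_pair)
  obtain xc c1 where c1: "(xc, c1) \<in> F0" "\<And>x y. (x, y) \<in> F0 \<Longrightarrow> c1 \<le> y"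
    using continuous_attains_inf[OF comp ne csnd] by (metis snd_conv surj_pair)
  obtain xd d1 where d1: "(xd, d1) \<in> F0" "\<And>x y. (x, y) \<in> F0 \<Longrightarrow> y \<le> d1"
    using continuous_attains_sup[OF comp ne csnd] by (metis snd_conv surj_pair)
  have ord: "a \<le> a1" "a1 \<le> b1" "b1 \<le> b" "c \<le> c1" "c1 \<le> d1" "d1 \<le> d"
    using a1 b1 c1 d1 F0U by fastforce+
  have F0R: "F0 \<subseteq> {a1..b1} \<times> {c1..d1}" using a1(2) b1(2) c1(2) d1(2) by auto
  have shrink: "rect_integral w a b c d = rect_integral w a1 b1 c1 d1"
  proof (rule rect_integral_shrink[OF Q ord])
    show "F \<inter> cbox (Complex a c) (Complex b d) \<subseteq> cbox (Complex a1 c1) (Complex b1 d1)"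
    proof
      fix z assume "z \<in> F \<inter> cbox (Complex a c) (Complex b d)"
      then have "(Re z, Im z) \<in> F0" by (auto simp: F0_def in_cbox_complex_iff)
      then show "z \<in> cbox (Complex a1 c1) (Complex b1 d1)" using F0R by (auto simp: in_cbox_complex_iff)
    qed
  qed
  define W where "W x y = w (Complex x y)" for x y
  define C' where "C' = {p. Complex (fst p) (snd p) \<in> C}"
  have C': "countable C'"
  proof -
    have "C' \<subseteq> (\<lambda>z. (Re z, Im z)) ` C"
      by (auto simp: C'_def intro!: image_eqI[of _ _ "Complex _ _"])
    then show ?thesis using C by (meson countable_image countable_subset)
  qed
  define Dx where "Dx p = (if p \<in> F0 - C' then partial_x w (Complex (fst p) (snd p)) else 0)" for p
  define Dy where "Dy p = (if p \<in> F0 - C' then partial_y w (Complex (fst p) (snd p)) else 0)" for p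
  have der: "((\<lambda>s. W s y) has_vector_derivative Dx (x, y)) (at x)"
       "((\<lambda>s. W x s) has_vector_derivative Dy (x, y)) (at y)" if "(x, y) \<in> F0 - C'" for x y
    using has_partials_at_slices[OF partials, of x y] F0U[of x y] that
    by (auto simp: W_def Dx_def Dy_def C'_def)
  have hx: "norm (W x y - W x0 y) \<le> N * \<bar>x - x0\<bar>" if "(x0, y) \<in> F0" "x \<in> {a..b}" for x x0 y
    using lip[of "Complex x0 y" "Complex x y"] F0U[OF that(1)] that(2) QI[of x y]
    by (simp add: W_def cmod_def)
  have hy: "norm (W x y - W x y0) \<le> N * \<bar>y - y0\<bar>" if "(x, y0) \<in> F0" "y \<in> {c..d}" for x y y0
    using lip[of "Complex x y0" "Complex x y"] F0U[OF that(1)] that(2) QI[of x y]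
    by (simp add: W_def cmod_def)
  have bx: "norm (Dx p) \<le> N" if "p \<in> F0" for p
  proof (cases "p \<in> C'")
    case False
    obtain x y where p: "p = (x, y)" by force
    have xy: "(x, y) \<in> F0" "(x, y) \<in> F0 - C'" using that False p by auto
    from has_vector_derivative_at_within[OF der(1)[OF xy(2)]]
    have "norm (Dx (x, y)) \<le> N"
      by (rule vector_derivative_norm_bound[OF _ ab(1) F0U(2)[OF xy(1)]]) (rule hx[OF xy(1)])
    then show ?thesis by (simp add: p)
  qed (use N in \<open>simp add: Dx_def\<close>)
  have "norm (Dy p) \<le> N" if "p \<in> F0" for p
  proof (cases "p \<in> C'")
    case False
    obtain x y where p: "p = (x, y)" by force
    have xy: "(x, y) \<in> F0" "(x, y) \<in> F0 - C'" using that False p by auto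
    from has_vector_derivative_at_within[OF der(2)[OF xy(2)]]
    have "norm (Dy (x, y)) \<le> N"
      by (rule vector_derivative_norm_bound[OF _ ab(2) F0U(3)[OF xy(1)]]) (rule hy[OF xy(1)])
    then show ?thesis by (simp add: p)
  qed (use N in \<open>simp add: Dy_def\<close>)
  note by' = this
  define U' where "U' = (\<lambda>p. Complex (fst p) (snd p)) -` U"
  have U': "open U'" unfolding U'_def by (rule open_vimage[OF U contC])
  have contU': "continuous_on U' (\<lambda>p. W (fst p) (snd p))"
    unfolding W_def by (rule continuous_on_compose2[OF cont contC]) (auto simp: U'_def)
  have Sb: "F0 - C' \<in> sets borel" and SU: "F0 - C' \<subseteq> U'"
    using sets.countable[OF _ C', of borel] borel_closed[OF clF0] F0U by (auto simp: U'_def)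
  have "(\<lambda>p. indicator (F0 - C') p *\<^sub>R Dx p) \<in> borel_measurable borel"
  proof (rule borel_measurable_directional_derivative[OF U' contU' Sb SU, where e = "(1, 0)"])
    fix p assume p: "p \<in> F0 - C'"
    obtain x y where xy: "p = (x, y)" by force
    have "((\<lambda>s. W (x + s) y) has_vector_derivative Dx (x, y)) (at 0)"
      using has_vector_derivative_shift_0[OF der(1)] p xy by simp
    then show "((\<lambda>t. W (fst (p + t *\<^sub>R (1, 0))) (snd (p + t *\<^sub>R (1, 0)))) has_vector_derivative Dx p) (at 0)"
      by (simp add: xy)
  qed
  moreover have "indicator (F0 - C') p *\<^sub>R Dx p = indicator F0 p *\<^sub>R Dx p" for p
    by (auto simp: Dx_def indicator_def)
  ultimately have mx: "(\<lambda>p. indicator F0 p *\<^sub>R Dx p) \<in> borel_measurable borel" by simp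
  have "(\<lambda>p. indicator (F0 - C') p *\<^sub>R Dy p) \<in> borel_measurable borel"
  proof (rule borel_measurable_directional_derivative[OF U' contU' Sb SU, where e = "(0, 1)"])
    fix p assume p: "p \<in> F0 - C'"
    obtain x y where xy: "p = (x, y)" by force
    have "((\<lambda>s. W x (y + s)) has_vector_derivative Dy (x, y)) (at 0)"
      using has_vector_derivative_shift_0[OF der(2)] p xy by simp
    then show "((\<lambda>t. W (fst (p + t *\<^sub>R (0, 1))) (snd (p + t *\<^sub>R (0, 1)))) has_vector_derivative Dy p) (at 0)"
      by (simp add: xy)
  qed
  moreover have "indicator (F0 - C') p *\<^sub>R Dy p = indicator F0 p *\<^sub>R Dy p" for p
    by (auto simp: Dy_def indicator_def)
  ultimately have my: "(\<lambda>p. indicator F0 p *\<^sub>R Dy p) \<in> borel_measurable borel" by simp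
  have contW: "continuous_on ({a..b} \<times> {c..d}) (\<lambda>(x, y). W x y)"
  proof -
    have "{a..b} \<times> {c..d} \<subseteq> U'" using QI by (auto simp: U'_def)
    from continuous_on_subset[OF contU' this] show ?thesis by (simp add: split_def)
  qed
  define A where "A = (\<integral>p. indicator F0 p *\<^sub>R Dx p \<partial>lborel)"
  define B where "B = (\<integral>p. indicator F0 p *\<^sub>R Dy p \<partial>lborel)"
  let ?m = "measure lborel ({a..b} \<times> {c..d} - F0)"
  have X: "norm (integral {c1..d1} (\<lambda>y. W b1 y - W a1 y) - A) \<le> N * (1 + 3 * \<kappa>) * ?m"
    unfolding A_def
    by (rule horizontal_increment_vs_area_integral[OF clF0 F0sub F0R a1(1) b1(1) ord(4,6) hx hy _ C' bx mx contW ratio(1,3) N])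
      (auto intro: has_vector_derivative_at_within der)
  have Y: "norm (integral {a1..b1} (\<lambda>x. W x d1 - W x c1) - B) \<le> N * (1 + 3 * \<kappa>) * ?m"
    unfolding B_def
    by (rule vertical_increment_vs_area_integral[OF clF0 F0sub F0R c1(1) d1(1) ord(1,3) hx hy _ C' by' my contW ratio(2,3) N])
      (auto intro: has_vector_derivative_at_within der)
  have AB: "A + \<i> * B = 0"
  proof -
    have ix: "integrable lborel (\<lambda>p. indicator F0 p *\<^sub>R Dx p)" and iy: "integrable lborel (\<lambda>p. indicator F0 p *\<^sub>R Dy p)"
      by (rule integrable_bounded_compact_support[OF mx comp bx] integrable_bounded_compact_support[OF my comp by'], assumption)+
    have "negligible ((\<lambda>z. (Re z, Im z)) ` Z)"
      by (rule negligible_differentiable_image_negligible[OF _ Z])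
        (auto intro!: derivative_intros bounded_linear_imp_differentiable_on bounded_linear_Pair
          bounded_linear_Re bounded_linear_Im)
    then have "AE p in lebesgue. p \<notin> (\<lambda>z. (Re z, Im z)) ` Z"
      by (intro AE_not_in) (simp add: negligible_iff_null_sets)
    then have "AE p in lborel. p \<notin> (\<lambda>z. (Re z, Im z)) ` Z"
      by (simp add: AE_completion_iff)
    moreover have "AE p in lborel. p \<notin> C'"
      by (intro AE_not_in countable_imp_null_set_lborel C')
    ultimately have "AE p in lborel. indicator F0 p *\<^sub>R Dx p + \<i> * (indicator F0 p *\<^sub>R Dy p) = 0"
    proof eventually_elim
      case (elim p)
      obtain x y where p: "p = (x, y)" by force
      have "Complex x y \<notin> Z"
        using elim(1) by (auto simp: p image_iff)
      then show ?case
        using CR[of "Complex x y"] F0U[of x y] elim(2)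
        by (auto simp: p Dx_def Dy_def dbar_def indicator_def)
    qed
    then have "(\<integral>p. indicator F0 p *\<^sub>R Dx p + \<i> * (indicator F0 p *\<^sub>R Dy p) \<partial>lborel) = 0"
      by (rule integral_eq_zero_AE)
    moreover have "(\<integral>p. indicator F0 p *\<^sub>R Dx p + \<i> * (indicator F0 p *\<^sub>R Dy p) \<partial>lborel) = A + \<i> * B"
      unfolding A_def B_def
      by (subst Bochner_Integration.integral_add[OF ix integrable_mult_right[OF iy]])
        (simp only: integral_mult_right_zero)
    ultimately show ?thesis by simp
  qed
  have intv: "(\<lambda>y. W x y) integrable_on {c1..d1}" if "x \<in> {a..b}" for x
    unfolding W_def using that ord
    by (intro integrable_continuous_real continuous_on_vertical[OF cont] QI) auto
  have inth: "(\<lambda>x. W x y) integrable_on {a1..b1}" if "y \<in> {c..d}" for y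
    unfolding W_def using that ord
    by (intro integrable_continuous_real continuous_on_horizontal[OF cont] QI) auto
  have "integral {c1..d1} (\<lambda>y. W b1 y - W a1 y) = integral {c1..d1} (W b1) - integral {c1..d1} (W a1)"
    using ord intv[of b1] intv[of a1] by (subst Henstock_Kurzweil_Integration.integral_diff) auto
  moreover have "integral {a1..b1} (\<lambda>x. W x d1 - W x c1) = integral {a1..b1} (\<lambda>x. W x d1) - integral {a1..b1} (\<lambda>x. W x c1)"
    using ord inth[of c1] inth[of d1] by (subst Henstock_Kurzweil_Integration.integral_diff) auto
  moreover have "rect_integral w a1 b1 c1 d1 =
      \<i> * (integral {c1..d1} (W b1) - integral {c1..d1} (W a1))
      - (integral {a1..b1} (\<lambda>x. W x d1) - integral {a1..b1} (\<lambda>x. W x c1))"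
    by (simp add: rect_integral_def W_def[abs_def])
  moreover have "\<i> * A - B = 0" using AB by (auto simp: complex_eq_iff)
  ultimately have "rect_integral w a1 b1 c1 d1 =
      \<i> * (integral {c1..d1} (\<lambda>y. W b1 y - W a1 y) - A) - (integral {a1..b1} (\<lambda>x. W x d1 - W x c1) - B)"
    by (simp add: right_diff_distrib)
  also have "norm \<dots> \<le> N * (1 + 3 * \<kappa>) * ?m + N * (1 + 3 * \<kappa>) * ?m"
    by (rule order_trans[OF norm_triangle_ineq4 add_mono[OF _ Y]]) (use X in \<open>simp add: norm_mult\<close>)
  finally show ?thesis by (simp add: shrink)
qed

end

lemma lborel_line_null:
  "{x::real} \<times> UNIV \<in> null_sets (lborel :: (real \<times> real) measure)"
  "UNIV \<times> {y::real} \<in> null_sets (lborel :: (real \<times> real) measure)"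
proof -
  have "{x} \<times> UNIV \<in> null_sets (lborel \<Otimes>\<^sub>M (lborel :: real measure))"
    by (rule lborel.times_in_null_sets1) auto
  then show "{x::real} \<times> UNIV \<in> null_sets (lborel :: (real \<times> real) measure)" by (simp add: lborel_prod)
  have "UNIV \<times> {y} \<in> null_sets ((lborel :: real measure) \<Otimes>\<^sub>M lborel)"
    by (rule lborel.times_in_null_sets2) auto
  then show "UNIV \<times> {y::real} \<in> null_sets (lborel :: (real \<times> real) measure)" by (simp add: lborel_prod)
qed

lemma box_Int_fmeasurable:
  "S \<in> sets borel \<Longrightarrow> ({a..b} \<times> {c..d}) \<inter> S \<in> fmeasurable (lborel :: (real \<times> real) measure)"
  by (intro fmeasurable_Int_fmeasurable fmeasurable_compact compact_Times compact_Icc) simp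

lemma measure_box_split:
  fixes S :: "(real \<times> real) set"
  assumes S: "S \<in> sets borel" and m: "a \<le> m" "m \<le> b" "c \<le> n" "n \<le> d"
  shows "measure lborel ({a..b} \<times> {c..d} \<inter> S) =
     measure lborel ({a..m} \<times> {c..n} \<inter> S) + measure lborel ({a..m} \<times> {n..d} \<inter> S)
   + measure lborel ({m..b} \<times> {c..n} \<inter> S) + measure lborel ({m..b} \<times> {n..d} \<inter> S)"
proof -
  have Im: "measure lborel ({s..t} \<times> {c..d} \<inter> S) =
      measure lborel ({s..t} \<times> {c..n} \<inter> S) + measure lborel ({s..t} \<times> {n..d} \<inter> S)" for s t
  proof -
    have "AE p in lborel. p \<notin> (UNIV :: real set) \<times> {n}" by (intro AE_not_in lborel_line_null(2))
    then have "AE p in lborel. p \<notin> {s..t} \<times> {c..n} \<inter> S \<or> p \<notin> {s..t} \<times> {n..d} \<inter> S"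
      by eventually_elim auto
    from measure_Un_AE[OF this box_Int_fmeasurable[OF S] box_Int_fmeasurable[OF S]]
    show ?thesis using m by (simp flip: Int_Un_distrib2 Sigma_Un_distrib2 add: ivl_disj_un_two_touch)
  qed
  have "AE p in lborel. p \<notin> {m} \<times> (UNIV :: real set)" by (intro AE_not_in lborel_line_null(1))
  then have "AE p in lborel. p \<notin> {a..m} \<times> {c..d} \<inter> S \<or> p \<notin> {m..b} \<times> {c..d} \<inter> S"
    by eventually_elim auto
  from measure_Un_AE[OF this box_Int_fmeasurable[OF S] box_Int_fmeasurable[OF S]]
  have "measure lborel ({a..b} \<times> {c..d} \<inter> S) =
      measure lborel ({a..m} \<times> {c..d} \<inter> S) + measure lborel ({m..b} \<times> {c..d} \<inter> S)"
    using m by (simp flip: Int_Un_distrib2 Sigma_Un_distrib1 add: ivl_disj_un_two_touch)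
  then show ?thesis by (simp add: Im)
qed

context axis_lipschitz_CR
begin

text \<open>
Subdivide the rectangle into \<open>4 ^ n\<close> similar ones. Those that do not meet \<open>F\<close> contribute nothing;
for the others the bound involves points outside \<open>F\<close> whose distance from \<open>F\<close> is at most the sum of
the side lengths. Adding up, the integral is at most a constant times the area of the points
outside \<open>F\<close> at distance at most \<open>L / 2 ^ n\<close> from \<open>F\<close>. As \<open>F\<close> is closed, these sets decrease to the
empty set. This replaces the use of density points in the classical argument.
\<close>
lemma rect_integral_0:
  assumes ab: "a < b" "c < d" and Q: "cbox (Complex a c) (Complex b d) \<subseteq> U"
  shows "rect_integral w a b c d = 0"
proof (cases "F \<inter> cbox (Complex a c) (Complex b d) = {}")
  case True
  then show ?thesis using ab Q box_subset_cbox by (intro rect_integral_off_F) (auto, blast)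
next
  case False
  define F0 where "F0 = {p \<in> {a..b} \<times> {c..d}. Complex (fst p) (snd p) \<in> F}"
  have F0: "closed F0" "F0 \<noteq> {}"
  proof -
    have "F0 = ({a..b} \<times> {c..d}) \<inter> (\<lambda>p. Complex (fst p) (snd p)) -` F" by (auto simp: F0_def)
    moreover have "closed ((\<lambda>p. Complex (fst p) (snd p)) -` F)"
      by (intro closed_vimage[OF F] continuous_on_Complex continuous_on_fst continuous_on_snd continuous_on_id)
    ultimately show "closed F0" by (auto intro!: closed_Int closed_Times)
    obtain z where "z \<in> F" "z \<in> cbox (Complex a c) (Complex b d)" using False by blast
    then have "(Re z, Im z) \<in> F0" by (auto simp: F0_def in_cbox_complex_iff)
    then show "F0 \<noteq> {}" by blast
  qed
  define \<kappa> where "\<kappa> = max ((d - c) / (b - a)) ((b - a) / (d - c))"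
  have \<kappa>: "\<kappa> \<ge> 0" "d - c \<le> \<kappa> * (b - a)" "b - a \<le> \<kappa> * (d - c)"
    using ab by (auto simp: \<kappa>_def le_max_iff_disj simp flip: pos_divide_le_eq)
  define K where "K = 2 * N * (1 + 3 * \<kappa>)"
  have K: "K \<ge> 0" using N \<kappa> by (simp add: K_def)
  define T where "T e = {p. infdist p F0 \<le> e} - F0" for e
  have Tb: "T e \<in> sets borel" for e
  proof -
    have "{p. infdist p F0 \<le> e} = (\<lambda>p. infdist p F0) -` {..e}" by auto
    then have "closed {p. infdist p F0 \<le> e}"
      by (simp add: closed_vimage continuous_on_infdist continuous_on_id)
    then show ?thesis using F0(1) by (auto simp: T_def)
  qed
  have step: "norm (rect_integral w s t u v) \<le> K * measure lborel ({s..t} \<times> {u..v} \<inter> T ((t - s + (v - u)) / 2 ^ n))"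
    if "a \<le> s" "s < t" "t \<le> b" "c \<le> u" "u < v" "v \<le> d" "v - u \<le> \<kappa> * (t - s)" "t - s \<le> \<kappa> * (v - u)" for s t u v n
    using that
  proof (induction n arbitrary: s t u v)
    case 0
    have sub: "cbox (Complex s u) (Complex t v) \<subseteq> cbox (Complex a c) (Complex b d)"
      using 0 by (auto simp: in_cbox_complex_iff)
    define F1 where "F1 = {p \<in> {s..t} \<times> {u..v}. Complex (fst p) (snd p) \<in> F}"
    show ?case
    proof (cases "F1 = {}")
      case True
      have "F \<inter> box (Complex s u) (Complex t v) = {}"
      proof (rule ccontr)
        assume "F \<inter> box (Complex s u) (Complex t v) \<noteq> {}"
        then obtain z where "z \<in> F" "z \<in> box (Complex s u) (Complex t v)" by blast
        then have "(Re z, Im z) \<in> F1" by (auto simp: F1_def in_box_complex_iff)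
        then show False using True by blast
      qed
      then have "rect_integral w s t u v = 0"
        using 0 sub Q by (intro rect_integral_off_F) auto
      then show ?thesis using K by simp
    next
      case False
      have eq: "{s..t} \<times> {u..v} - F1 = {s..t} \<times> {u..v} \<inter> T ((t - s + (v - u)) / 2 ^ 0)"
      proof -
        have "infdist p F0 \<le> t - s + (v - u)" if p: "p \<in> {s..t} \<times> {u..v}" for p
        proof -
          obtain q where q: "q \<in> F1" using False by blast
          then have "q \<in> F0" using 0 by (auto simp: F1_def F0_def)
          then have "infdist p F0 \<le> dist p q" by (rule infdist_le)
          also have "\<dots> = norm (p - q)" by (simp add: dist_norm)
          also have "\<dots> \<le> norm (fst (p - q)) + norm (snd (p - q))"
            by (metis norm_Pair_le prod.collapse)
          also have "\<dots> \<le> t - s + (v - u)" using p q by (intro add_mono) (auto simp: F1_def)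
          finally show ?thesis .
        qed
        then show ?thesis using 0 by (auto simp: T_def F1_def F0_def)
      qed
      show ?thesis
        using rect_integral_bound[OF 0(2,5) order_trans[OF sub Q] 0(7,8) \<kappa>(1) F1_def False] eq
        by (simp add: K_def)
    qed
  next
    case (Suc n)
    \<comment> \<open>Quartering preserves the aspect ratio, hence the constant.\<close>
    define x y where "x = (s + t) / 2" and "y = (u + v) / 2"
    have xy: "s < x" "x < t" "u < y" "y < v" using Suc.prems by (auto simp: x_def y_def)
    have half: "x - s = (t - s) / 2" "t - x = (t - s) / 2" "y - u = (v - u) / 2" "v - y = (v - u) / 2"
      by (auto simp: x_def y_def field_simps)
    define e where "e = (t - s + (v - u)) / 2 ^ Suc n"
    have e: "((t - s) / 2 + (v - u) / 2) / 2 ^ n = e" by (simp add: e_def field_simps)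
    have sub: "cbox (Complex s' u') (Complex t' v') \<subseteq> U" if "s \<le> s'" "t' \<le> t" "u \<le> u'" "v' \<le> v" for s' t' u' v'
    proof -
      have "cbox (Complex s' u') (Complex t' v') \<subseteq> cbox (Complex a c) (Complex b d)"
        using Suc.prems that by (auto simp: in_cbox_complex_iff)
      then show ?thesis using Q by blast
    qed
    have "rect_integral w s t u v = rect_integral w s x u v + rect_integral w x t u v"
      using xy by (intro rect_integral_split_Re continuous_on_cbox sub) auto
    moreover have "rect_integral w s x u v = rect_integral w s x u y + rect_integral w s x y v"
      using xy by (intro rect_integral_split_Im continuous_on_cbox sub) auto
    moreover have "rect_integral w x t u v = rect_integral w x t u y + rect_integral w x t y v"
      using xy by (intro rect_integral_split_Im continuous_on_cbox sub) auto
    ultimately have eq: "rect_integral w s t u v = rect_integral w s x u y + rect_integral w s x y v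
        + rect_integral w x t u y + rect_integral w x t y v" by simp
    have IH: "norm (rect_integral w s' t' u' v') \<le> K * measure lborel ({s'..t'} \<times> {u'..v'} \<inter> T e)"
      if "s' \<in> {s, x}" "t' - s' = (t - s) / 2" "u' \<in> {u, y}" "v' - u' = (v - u) / 2" for s' t' u' v'
    proof -
      have "s \<le> s'" "t' \<le> t" "u \<le> u'" "v' \<le> v" "s' < t'" "u' < v'"
        using that half xy by auto
      then have "norm (rect_integral w s' t' u' v') \<le> K * measure lborel ({s'..t'} \<times> {u'..v'} \<inter> T ((t' - s' + (v' - u')) / 2 ^ n))"
      proof (intro Suc.IH)
        show "v' - u' \<le> \<kappa> * (t' - s')" "t' - s' \<le> \<kappa> * (v' - u')"
          unfolding that(2,4) using Suc.prems(7,8) by simp_all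
      qed (use Suc.prems in linarith)+
      then show ?thesis by (simp only: that e)
    qed
    have "norm (rect_integral w s t u v) \<le> norm (rect_integral w s x u y) + norm (rect_integral w s x y v)
        + norm (rect_integral w x t u y) + norm (rect_integral w x t y v)"
      unfolding eq by (intro norm_triangle_le add_mono order_refl)
    also have "\<dots> \<le> K * measure lborel ({s..x} \<times> {u..y} \<inter> T e) + K * measure lborel ({s..x} \<times> {y..v} \<inter> T e)
        + K * measure lborel ({x..t} \<times> {u..y} \<inter> T e) + K * measure lborel ({x..t} \<times> {y..v} \<inter> T e)"
      using half by (intro add_mono IH) auto
    also have "\<dots> = K * measure lborel ({s..t} \<times> {u..v} \<inter> T e)"
      using xy by (subst measure_box_split[OF Tb, of s x t u y v]) (auto simp: algebra_simps)
    finally show ?case by (simp only: e_def)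
  qed
  define L where "L = b - a + (d - c)"
  define X where "X n = {a..b} \<times> {c..d} \<inter> T (L / 2 ^ n)" for n
  have L: "L \<ge> 0" using ab by (simp add: L_def)
  have "(\<lambda>n. measure lborel (X n)) \<longlonglongrightarrow> measure lborel (\<Inter>n. X n)"
  proof (rule Lim_measure_decseq)
    show "range X \<subseteq> sets lborel" 
      using box_Int_fmeasurable[OF Tb] by (auto simp: X_def fmeasurable_def)
    have "L / 2 ^ n \<le> L / 2 ^ m" if "m \<le> n" for m n :: nat
      using L that by (intro divide_left_mono power_increasing) auto
    then show "decseq X" unfolding decseq_def X_def T_def by (auto intro: order_trans)
    show "emeasure lborel (X i) \<noteq> \<infinity>" for i
      using fmeasurableD2[OF box_Int_fmeasurable[OF Tb]] by (simp add: X_def)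
  qed
  moreover have "(\<Inter>n. X n) = {}"
  proof -
    have False if "p \<in> (\<Inter>n. X n)" for p
    proof -
      have p: "infdist p F0 \<le> L / 2 ^ n" "p \<notin> F0" for n
        using that by (auto simp: X_def T_def)
      have "(\<lambda>n. L * (1 / 2) ^ n) \<longlonglongrightarrow> L * 0"
        by (intro tendsto_mult_left LIMSEQ_realpow_zero) auto
      then have "infdist p F0 \<le> L * 0"
        by (rule LIMSEQ_le_const) (use p(1) in \<open>auto simp: power_divide\<close>)
      then show False using infdist_eq_0_closed[OF F0] p(2) by simp
    qed
    then show ?thesis by blast
  qed
  ultimately have lim: "(\<lambda>n. K * measure lborel (X n)) \<longlonglongrightarrow> K * 0"
    by (intro tendsto_mult_left) simp
  have "norm (rect_integral w a b c d) \<le> K * measure lborel (X n)" for n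
    using step[of a b c d n] ab \<kappa> by (simp add: X_def L_def)
  then have "norm (rect_integral w a b c d) \<le> K * 0"
    by (intro LIMSEQ_le_const[OF lim]) auto
  then show ?thesis by simp
qed

lemma holomorphic: "w holomorphic_on U"
  by (rule Morera_rectangle[OF U cont rect_integral_0])

end

section \<open>The Looman--Menchoff theorem\<close>

lemma differentiable_at_0_lipschitz:
  fixes f :: "real \<Rightarrow> complex"
  assumes "f differentiable (at 0)"
  obtains M d where "d > 0" "\<And>t. \<bar>t\<bar> < d \<Longrightarrow> norm (f t - f 0) \<le> M * \<bar>t\<bar>"
proof -
  obtain D where "(f has_vector_derivative D) (at 0)"
    using assms vector_derivative_works by blast
  then obtain d where d: "d > 0" "\<And>t. \<bar>t\<bar> < d \<Longrightarrow> norm (f t - f 0 - t *\<^sub>R D) \<le> 1 * \<bar>t\<bar>"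
    unfolding has_vector_derivative_within_alt using zero_less_one by (metis UNIV_I diff_zero)
  have "norm (f t - f 0) \<le> (1 + norm D) * \<bar>t\<bar>" if "\<bar>t\<bar> < d" for t
    using d(2)[OF that] norm_triangle_ineq2[of "f t - f 0" "t *\<^sub>R D"] by (simp add: algebra_simps)
  with d(1) show ?thesis by (rule that)
qed

text \<open>
Let \<open>F\<close> be the set of points of \<open>U\<close> near which \<open>w\<close> is not holomorphic, relatively closed in \<open>U\<close>,
and suppose that it is not empty. A piece \<open>S\<close> of \<open>F\<close> is covered by the countably many closed sets
\<open>T n\<close>, where difference quotients along the axes are bounded by \<open>n\<close> on a fixed scale, and by the
singletons of \<open>C\<close>. By Baire's theorem one of these sets contains all points of \<open>F\<close> in some disc
centred on \<open>F\<close>. If it is a singleton, \<open>w\<close> has an isolated singularity at which it is continuous;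
otherwise the Lipschitz situation treated above applies. In both cases \<open>w\<close> is holomorphic on a
disc centred at a point of \<open>F\<close>, a contradiction.
\<close>
theorem Looman_Menchoff:
  fixes w :: "complex \<Rightarrow> complex"
  assumes U: "open U" and cont: "continuous_on U w"
    and C: "countable C" and partials: "\<And>z. z \<in> U - C \<Longrightarrow> has_partials_at w z"
    and Z: "negligible Z" and CR: "\<And>z. z \<in> U - Z \<Longrightarrow> dbar w z = 0"
  shows "w holomorphic_on U"
proof -
  define G where "G = \<Union>{V. open V \<and> V \<subseteq> U \<and> w holomorphic_on V}"
  have G: "open G" "G \<subseteq> U" by (auto simp: G_def)
  have holG: "w holomorphic_on G"
  proof (rule holomorphic_onI)
    fix z assume "z \<in> G"
    then obtain V where "open V" "z \<in> V" "w holomorphic_on V" by (auto simp: G_def)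
    then show "w field_differentiable at z within G"
      using holomorphic_on_imp_differentiable_at field_differentiable_at_within by blast
  qed
  define F where "F = U - G"
  have "F = {}"
  proof (rule ccontr)
    assume "F \<noteq> {}"
    then obtain p where p: "p \<in> U" "p \<notin> G" by (auto simp: F_def)
    obtain r where r: "r > 0" "cball p (2 * r) \<subseteq> U"
    proof -
      obtain e where "e > 0" "cball p e \<subseteq> U" using U p open_contains_cball by blast
      then show ?thesis using that[of "e / 2"] by simp
    qed
    \<comment> \<open>Taking the closure of \<open>F \<inter> ball p r\<close>, rather than \<open>F \<inter> cball p r\<close>, ensures that every nonempty relatively open subset of \<open>S\<close> meets the open disc.\<close>
    define S where "S = closure (F \<inter> ball p r)"
    have S: "closed S" "S \<subseteq> cball p r" "S \<subseteq> F"
    proof -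
      show "closed S" by (simp add: S_def)
      show Sr: "S \<subseteq> cball p r" unfolding S_def by (rule closure_minimal) auto
      have "S \<subseteq> closure (- G)" unfolding S_def by (intro closure_mono) (auto simp: F_def)
      then have "S \<subseteq> - G" using G by (simp add: closed_Compl)
      moreover have "S \<subseteq> U" using Sr r by force
      ultimately show "S \<subseteq> F" by (auto simp: F_def)
    qed
    have pS: "p \<in> S" using closure_subset[of "F \<inter> ball p r"] p r by (auto simp: S_def F_def)
    define T where "T n = {z \<in> S. \<forall>t. \<bar>t\<bar> \<le> r / real (Suc n) \<longrightarrow>
       norm (w (z + of_real t) - w z) \<le> real n * \<bar>t\<bar> \<and> norm (w (z + \<i> * of_real t) - w z) \<le> real n * \<bar>t\<bar>}" for n
    have inU: "z + h \<in> U" if "z \<in> S" "norm h \<le> r" for z h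
    proof -
      have "norm (p - (z + h)) \<le> norm (p - z) + norm h"
        using norm_triangle_ineq4[of "p - z" h] by (simp add: diff_diff_eq)
      also have "\<dots> \<le> 2 * r" using that S(2) by (auto simp: dist_norm)
      finally show ?thesis using r by (auto simp: dist_norm)
    qed
    have SU: "S \<subseteq> U" using S by (auto simp: F_def)
    have cl: "closed (T n)" for n
    proof -
      have ct: "closed {z \<in> S. norm (w (z + h) - w z) \<le> k}" if "norm h \<le> r" for h k
      proof -
        have "continuous_on S (\<lambda>z. norm (w (z + h) - w z))"
          using that inU SU by (intro continuous_on_norm continuous_on_diff continuous_on_subset[OF cont]
              continuous_on_compose2[OF cont, of _ "\<lambda>z. z + h"] continuous_intros) auto
        from continuous_closed_preimage[OF this S(1) closed_atMost[of k]]
        show ?thesis by (simp add: vimage_def Int_def)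
      qed
      have eq: "T n = S \<inter> (\<Inter>t\<in>{t. \<bar>t\<bar> \<le> r / real (Suc n)}.
          {z \<in> S. norm (w (z + of_real t) - w z) \<le> real n * \<bar>t\<bar>} \<inter> {z \<in> S. norm (w (z + \<i> * of_real t) - w z) \<le> real n * \<bar>t\<bar>})"
        by (auto simp: T_def)
      have le: "\<bar>t\<bar> \<le> r" if "\<bar>t\<bar> \<le> r / real (Suc n)" for t
      proof -
        have "r / real (Suc n) \<le> r / 1" using r by (intro divide_left_mono) auto
        then show ?thesis using that by simp
      qed
      show ?thesis
        unfolding eq using le by (intro closed_Int S closed_INT ballI ct) (auto simp: norm_mult)
    qed
    have cover: "\<exists>n. z \<in> T n" if z: "z \<in> S - C" for z
    proof -
      have "has_partials_at w z" using partials z SU by auto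
      then have "(\<lambda>t. w (z + of_real t)) differentiable (at 0)" "(\<lambda>t. w (z + \<i> * of_real t)) differentiable (at 0)"
        by (simp_all add: has_partials_at_def)
      note this[THEN differentiable_at_0_lipschitz]
      from this(1) obtain M1 d1 where d1: "d1 > 0"
        and 1: "\<And>t. \<bar>t\<bar> < d1 \<Longrightarrow> norm (w (z + of_real t) - w (z + of_real 0)) \<le> M1 * \<bar>t\<bar>" by blast
      from \<open>\<And>thesis. (\<And>M d. d > 0 \<Longrightarrow> (\<And>t. \<bar>t\<bar> < d \<Longrightarrow>
          norm (w (z + \<i> * of_real t) - w (z + \<i> * of_real 0)) \<le> M * \<bar>t\<bar>) \<Longrightarrow> thesis) \<Longrightarrow> thesis\<close>
      obtain M2 d2 where d2: "d2 > 0"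
        and 2: "\<And>t. \<bar>t\<bar> < d2 \<Longrightarrow> norm (w (z + \<i> * of_real t) - w (z + \<i> * of_real 0)) \<le> M2 * \<bar>t\<bar>" by blast
      note d = d1 d2
      obtain n where n: "max (max M1 M2) (max (r / d1) (r / d2)) < real n"
        using reals_Archimedean2 by blast
      have rn: "r / real (Suc n) < d1" "r / real (Suc n) < d2"
        using n d by (auto simp: field_simps)
      have "M1 * \<bar>t\<bar> \<le> real n * \<bar>t\<bar>" "M2 * \<bar>t\<bar> \<le> real n * \<bar>t\<bar>" for t
        using n by (auto intro!: mult_right_mono)
      moreover have "norm (w (z + of_real t) - w z) \<le> M1 * \<bar>t\<bar>"
          "norm (w (z + \<i> * of_real t) - w z) \<le> M2 * \<bar>t\<bar>" if "\<bar>t\<bar> \<le> r / real (Suc n)" for t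
        using 1[of t] 2[of t] that rn by auto
      ultimately have "z \<in> T n"
        using z unfolding T_def by (blast intro: order_trans)
      then show ?thesis ..
    qed
    define \<G> where "\<G> = range T \<union> (\<lambda>c. {c}) ` (C \<inter> S)"
    have "\<exists>Y\<in>\<G>. \<not> S \<subseteq> closure (S - Y)"
    proof (rule ccontr)
      assume "\<not> (\<exists>Y\<in>\<G>. \<not> S \<subseteq> closure (S - Y))"
      then have dense: "S \<subseteq> closure (S - Y)" if "Y \<in> \<G>" for Y using that by blast
      have "S \<subseteq> closure (\<Inter>((\<lambda>Y. S - Y) ` \<G>))"
      proof (rule Baire[OF S(1)])
        show "countable ((\<lambda>Y. S - Y) ` \<G>)" using C by (auto simp: \<G>_def)
        fix V assume "V \<in> (\<lambda>Y. S - Y) ` \<G>"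
        then obtain Y where Y: "Y \<in> \<G>" "V = S - Y" by blast
        have "closed Y" using Y(1) cl by (auto simp: \<G>_def)
        then have "openin (top_of_set S) V"
          by (simp add: Y(2) Diff_eq openin_open_Int open_Compl)
        then show "openin (top_of_set S) V \<and> S \<subseteq> closure V" using dense[OF Y(1)] Y(2) by simp
      qed
      moreover have "\<Inter>((\<lambda>Y. S - Y) ` \<G>) = {}"
      proof -
        have False if z: "z \<in> \<Inter>((\<lambda>Y. S - Y) ` \<G>)" for z
        proof -
          have zY: "z \<in> S" "z \<notin> Y" if "Y \<in> \<G>" for Y using z that by blast+
          have zS: "z \<in> S" using zY(1)[of "T 0"] by (simp add: \<G>_def)
          show False
          proof (cases "z \<in> C")
            case True then show False using zY(2)[of "{z}"] zS by (auto simp: \<G>_def)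
          next
            case False
            then obtain n where "z \<in> T n" using cover zS by blast
            then show False using zY(2)[of "T n"] by (simp add: \<G>_def)
          qed
        qed
        then show ?thesis by blast
      qed
      ultimately show False using pS by simp
    qed
    then obtain Y where Y: "Y \<in> \<G>" "\<not> S \<subseteq> closure (S - Y)" by blast
    then obtain q where q: "q \<in> S" "q \<in> - closure (S - Y)" by blast
    obtain q' where q': "q' \<in> - closure (S - Y)" "q' \<in> F" "q' \<in> ball p r"
    proof -
      have "- closure (S - Y) \<inter> (F \<inter> ball p r) \<noteq> {}"
        using q open_Int_closure_eq_empty[of "- closure (S - Y)" "F \<inter> ball p r"]
        unfolding S_def[symmetric] by blast
      then show ?thesis using that by blast
    qed
    have "open (- closure (S - Y) \<inter> ball p r)" by (intro open_Int) auto
    then obtain \<rho> where \<rho>: "\<rho> > 0" "ball q' \<rho> \<subseteq> - closure (S - Y) \<inter> ball p r"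
      using q' open_contains_ball[of "- closure (S - Y) \<inter> ball p r"] by blast
    have pr: "ball p r \<subseteq> U" using r by (auto simp: subset_iff)
    have FY: "z \<in> S \<and> z \<in> Y" if "z \<in> F" "z \<in> ball q' \<rho>" for z
    proof -
      have z: "z \<in> ball p r" "z \<notin> closure (S - Y)" using that(2) \<rho>(2) by blast+
      then have "z \<in> S" unfolding S_def using that(1) closure_subset[of "F \<inter> ball p r"] by blast
      then show ?thesis using z(2) closure_subset[of "S - Y"] by blast
    qed
    have notin: False if "w holomorphic_on ball q' e" "0 < e" "e \<le> \<rho>" for e
    proof -
      have "ball q' e \<subseteq> U" using \<rho>(2) pr that(3) subset_ball[of e \<rho> q'] by blast
      then have "ball q' e \<subseteq> G" unfolding G_def using that(1) by blast
      then have "q' \<in> G" using that(2) by auto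
      then show False using q' by (simp add: F_def)
    qed
    from Y(1) consider c where "Y = {c}" | n where "Y = T n" by (auto simp: \<G>_def)
    then show False
    proof cases
      case 1
      have "w holomorphic_on ball q' \<rho>"
      proof (rule no_isolated_singularity[where K = "{c}"])
        have sub: "ball q' \<rho> \<subseteq> U" using \<rho> pr by blast
        then show "continuous_on (ball q' \<rho>) w" by (rule continuous_on_subset[OF cont])
        have "ball q' \<rho> - {c} \<subseteq> G" using FY 1 sub by (auto simp: F_def)
        then show "w holomorphic_on ball q' \<rho> - {c}" by (rule holomorphic_on_subset[OF holG])
      qed auto
      then show False using notin \<rho> by blast
    next
      case 2
      define e where "e = min \<rho> (r / real (Suc n) / 2)"
      have e: "e > 0" "e \<le> \<rho>" using \<rho> r by (simp_all add: e_def)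
      have "e \<le> r / real (Suc n) / 2" unfolding e_def by (rule min.cobounded2)
      moreover have "x \<le> y / 2 \<Longrightarrow> 2 * x \<le> y" for x y :: real by simp
      ultimately have e2: "2 * e \<le> r / real (Suc n)" by blast
      have sub: "ball q' e \<subseteq> U" "ball q' e \<subseteq> ball q' \<rho>"
        using \<rho>(2) pr subset_ball[OF e(2), of q'] by blast+
      have "axis_lipschitz_CR (ball q' e) S C Z w (real n)"
      proof
        show "continuous_on (ball q' e) w" by (rule continuous_on_subset[OF cont sub(1)])
        have "ball q' e - S \<subseteq> G" using FY sub unfolding F_def by blast
        then show "w holomorphic_on ball q' e - S" by (rule holomorphic_on_subset[OF holG])
        show "has_partials_at w z" if "z \<in> S \<inter> ball q' e - C" for z
          using that SU by (intro partials) auto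
        show "dbar w z = 0" if "z \<in> S \<inter> ball q' e - Z" for z
          using that SU by (intro CR) auto
        show "norm (w z' - w z) \<le> real n * norm (z' - z)"
          if z: "z \<in> S \<inter> ball q' e" "z' \<in> ball q' e" and ax: "Re z' = Re z \<or> Im z' = Im z" for z z'
        proof -
          have "z \<in> T n" using FY[of z] S(3) z(1) sub(2) 2 by blast
          have "norm (z' - z) \<le> norm (q' - z) + norm (q' - z')"
            using norm_triangle_ineq4[of "q' - z" "q' - z'"] by simp
          also have "\<dots> < 2 * e" using z by (simp add: dist_norm)
          also note e2
          finally have small: "norm (z' - z) \<le> r / real (Suc n)" by (rule less_imp_le)
          from ax show ?thesis
          proof
            assume "Re z' = Re z"
            then have zz: "z' = z + \<i> * of_real (Im z' - Im z)" "norm (z' - z) = \<bar>Im z' - Im z\<bar>"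
              by (auto simp: complex_eq_iff cmod_def)
            then have "norm (w (z + \<i> * of_real (Im z' - Im z)) - w z) \<le> real n * \<bar>Im z' - Im z\<bar>"
              using \<open>z \<in> T n\<close> small unfolding T_def by auto
            then show ?thesis using zz by metis
          next
            assume "Im z' = Im z"
            then have zz: "z' = z + of_real (Re z' - Re z)" "norm (z' - z) = \<bar>Re z' - Re z\<bar>"
              by (auto simp: complex_eq_iff cmod_def)
            then have "norm (w (z + of_real (Re z' - Re z)) - w z) \<le> real n * \<bar>Re z' - Re z\<bar>"
              using \<open>z \<in> T n\<close> small unfolding T_def by auto
            then show ?thesis using zz by metis
          qed
        qed
      qed (use S C Z in auto)
      then have "w holomorphic_on ball q' e" by (rule axis_lipschitz_CR.holomorphic)
      then show False using notin e by blast
    qed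
  qed
  then have "U = G" using G by (auto simp: F_def)
  then show ?thesis using holG by simp
qed

section \<open>Continuously differentiable functions\<close>

lemma has_partials_atI:
  assumes "((\<lambda>t. v (z + of_real t)) has_vector_derivative a) (at 0)"
    and "((\<lambda>t. v (z + \<i> * of_real t)) has_vector_derivative b) (at 0)"
  shows "has_partials_at v z" "partial_x v z = a" "partial_y v z = b"
  using assms by (auto simp: has_partials_at_def partial_x_def partial_y_def
      intro: differentiableI_vector vector_derivative_at)

lemma has_partials_atD:
  assumes "has_partials_at v z"
  shows "((\<lambda>t. v (z + of_real t)) has_vector_derivative partial_x v z) (at 0)"
    and "((\<lambda>t. v (z + \<i> * of_real t)) has_vector_derivative partial_y v z) (at 0)"
  using assms by (simp_all add: has_partials_at_def partial_x_def partial_y_def flip: vector_derivative_works)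

lemma partials_add:
  assumes "has_partials_at u z" "has_partials_at v z"
  shows "has_partials_at (\<lambda>z. u z + v z) z"
    and "partial_x (\<lambda>z. u z + v z) z = partial_x u z + partial_x v z"
    and "partial_y (\<lambda>z. u z + v z) z = partial_y u z + partial_y v z"
  using has_vector_derivative_add[OF has_partials_atD(1)[OF assms(1)] has_partials_atD(1)[OF assms(2)]]
    has_vector_derivative_add[OF has_partials_atD(2)[OF assms(1)] has_partials_atD(2)[OF assms(2)]]
  by (simp_all add: has_partials_atI)

lemma partials_mult:
  assumes "has_partials_at u z" "has_partials_at v z"
  shows "has_partials_at (\<lambda>z. u z * v z) z"
    and "partial_x (\<lambda>z. u z * v z) z = u z * partial_x v z + partial_x u z * v z"
    and "partial_y (\<lambda>z. u z * v z) z = u z * partial_y v z + partial_y u z * v z"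
  using has_vector_derivative_mult[OF has_partials_atD(1)[OF assms(1)] has_partials_atD(1)[OF assms(2)]]
    has_vector_derivative_mult[OF has_partials_atD(2)[OF assms(1)] has_partials_atD(2)[OF assms(2)]]
  by (simp_all add: has_partials_atI)

lemma partials_compose:
  assumes "(\<phi> has_field_derivative d) (at (v z))" "has_partials_at v z"
  shows "has_partials_at (\<lambda>z. \<phi> (v z)) z"
    and "partial_x (\<lambda>z. \<phi> (v z)) z = d * partial_x v z"
    and "partial_y (\<lambda>z. \<phi> (v z)) z = d * partial_y v z"
proof -
  have "((\<lambda>t. \<phi> (v (z + of_real t))) has_vector_derivative partial_x v z * d) (at 0)"
    and "((\<lambda>t. \<phi> (v (z + \<i> * of_real t))) has_vector_derivative partial_y v z * d) (at 0)"
    using field_vector_diff_chain_at[OF has_partials_atD(1)[OF assms(2)], of \<phi> d]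
      field_vector_diff_chain_at[OF has_partials_atD(2)[OF assms(2)], of \<phi> d] assms(1)
    by (simp_all add: o_def)
  note has_partials_atI[OF this]
  then show "has_partials_at (\<lambda>z. \<phi> (v z)) z"
    and "partial_x (\<lambda>z. \<phi> (v z)) z = d * partial_x v z"
    and "partial_y (\<lambda>z. \<phi> (v z)) z = d * partial_y v z" by (simp_all add: mult.commute)
qed

lemma partials_const:
  "has_partials_at (\<lambda>z. c) z" "partial_x (\<lambda>z. c) z = 0" "partial_y (\<lambda>z. c) z = 0"
  using has_partials_atI[of "\<lambda>z. c" z 0 0] by simp_all

lemma partials_ident:
  "has_partials_at (\<lambda>z. z) z" "partial_x (\<lambda>z. z) z = 1" "partial_y (\<lambda>z. z) z = \<i>"
proof -
  have "((\<lambda>t. z + of_real t) has_vector_derivative 1) (at 0)"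
    and "((\<lambda>t. z + \<i> * of_real t) has_vector_derivative \<i>) (at 0)"
    by (auto intro!: derivative_eq_intros)
  then show "has_partials_at (\<lambda>z. z) z" "partial_x (\<lambda>z. z) z = 1" "partial_y (\<lambda>z. z) z = \<i>"
    by (rule has_partials_atI)+
qed

lemma partials_cong:
  assumes U: "open U" "z \<in> U" and eq: "\<And>z. z \<in> U \<Longrightarrow> u z = v z" and u: "has_partials_at u z"
  shows "has_partials_at v z" "partial_x v z = partial_x u z" "partial_y v z = partial_y u z"
proof -
  have op: "open ((\<lambda>t::real. z + of_real t) -` U)" "open ((\<lambda>t::real. z + \<i> * of_real t) -` U)"
    by (intro open_vimage U(1) continuous_intros)+
  have "((\<lambda>t. v (z + of_real t)) has_vector_derivative partial_x u z) (at 0)"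
    by (rule has_vector_derivative_transform_within_open[OF has_partials_atD(1)[OF u] op(1)]) (use U eq in auto)
  moreover have "((\<lambda>t. v (z + \<i> * of_real t)) has_vector_derivative partial_y u z) (at 0)"
    by (rule has_vector_derivative_transform_within_open[OF has_partials_atD(2)[OF u] op(2)]) (use U eq in auto)
  ultimately show "has_partials_at v z" "partial_x v z = partial_x u z" "partial_y v z = partial_y u z"
    by (rule has_partials_atI)+
qed

lemma Ck_on_subset: "Ck_on k v U \<Longrightarrow> V \<subseteq> U \<Longrightarrow> Ck_on k v V"
proof (induction k arbitrary: v)
  case 0 then show ?case by (auto intro: continuous_on_subset)
next
  case (Suc k)
  then have "continuous_on V v" "Ck_on k (partial_x v) V" "Ck_on k (partial_y v) V"
    by (auto intro: continuous_on_subset)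
  then show ?case using Suc.prems by auto
qed

lemma Ck_on_cong:
  assumes "open U"
  shows "Ck_on k u U \<Longrightarrow> (\<And>z. z \<in> U \<Longrightarrow> u z = v z) \<Longrightarrow> Ck_on k v U"
proof (induction k arbitrary: u v)
  case 0 then show ?case using continuous_on_cong[of U U u v] by simp
next
  case (Suc k)
  have hp: "has_partials_at u z" if "z \<in> U" for z using Suc.prems(1) that by simp
  note c = partials_cong[OF \<open>open U\<close> _ Suc.prems(2) hp]
  have "continuous_on U v"
    using continuous_on_cong[of U U u v] Suc.prems by simp
  moreover have "Ck_on k (partial_x v) U"
    by (rule Suc.IH[of "partial_x u"]) (use Suc.prems(1) c(2) in auto)
  moreover have "Ck_on k (partial_y v) U"
    by (rule Suc.IH[of "partial_y u"]) (use Suc.prems(1) c(3) in auto)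
  ultimately show ?case using c(1) by simp
qed

lemma Ck_on_SucD: "Ck_on (Suc k) v U \<Longrightarrow> Ck_on k v U"
proof (induction k arbitrary: v)
  case (Suc k)
  have "Ck_on k (partial_x v) U" "Ck_on k (partial_y v) U"
    by (rule Suc.IH, use Suc.prems in simp)+
  then show ?case using Suc.prems by simp
qed simp

lemma Ck_on_imp_continuous_on: "Ck_on k v U \<Longrightarrow> continuous_on U v"
  by (cases k) auto

lemma Ck_on_local:
  assumes "open U"
  shows "(\<And>z. z \<in> U \<Longrightarrow> \<exists>V. open V \<and> z \<in> V \<and> Ck_on k v V) \<Longrightarrow> Ck_on k v U"
proof (induction k arbitrary: v)
  case 0
  have "isCont v z" if "z \<in> U" for z
    using 0[OF that] by (auto simp: continuous_on_eq_continuous_at)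
  then show ?case by (simp add: continuous_at_imp_continuous_on)
next
  case (Suc k)
  have "isCont v z \<and> has_partials_at v z" if "z \<in> U" for z
    using Suc.prems[OF that] by (auto simp: continuous_on_eq_continuous_at)
  moreover have "Ck_on k (partial_x v) U" "Ck_on k (partial_y v) U"
  proof -
    have "\<exists>V. open V \<and> z \<in> V \<and> Ck_on k (partial_x v) V \<and> Ck_on k (partial_y v) V" if "z \<in> U" for z
      using Suc.prems[OF that] by auto
    then show "Ck_on k (partial_x v) U" "Ck_on k (partial_y v) U" by (meson Suc.IH)+
  qed
  ultimately show ?case by (simp add: continuous_at_imp_continuous_on)
qed

lemma Ck_on_add:
  assumes "open U"
  shows "Ck_on k u U \<Longrightarrow> Ck_on k v U \<Longrightarrow> Ck_on k (\<lambda>z. u z + v z) U"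
proof (induction k arbitrary: u v)
  case 0 then show ?case by (auto intro: continuous_on_add)
next
  case (Suc k)
  have hp: "has_partials_at u z" "has_partials_at v z" if "z \<in> U" for z using Suc.prems that by simp_all
  note p = partials_add[OF hp]
  have x: "Ck_on k (\<lambda>z. partial_x u z + partial_x v z) U" and y: "Ck_on k (\<lambda>z. partial_y u z + partial_y v z) U"
    using Suc.prems by (auto intro!: Suc.IH)
  have "Ck_on k (partial_x (\<lambda>z. u z + v z)) U" "Ck_on k (partial_y (\<lambda>z. u z + v z)) U"
    by (rule Ck_on_cong[OF assms x], simp add: p(2), rule Ck_on_cong[OF assms y], simp add: p(3))
  then show ?case using Suc.prems p(1) by (auto intro: continuous_on_add)
qed

lemma Ck_on_mult:
  assumes "open U"
  shows "Ck_on k u U \<Longrightarrow> Ck_on k v U \<Longrightarrow> Ck_on k (\<lambda>z. u z * v z) U"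
proof (induction k arbitrary: u v)
  case 0 then show ?case by (auto intro: continuous_on_mult)
next
  case (Suc k)
  have hp: "has_partials_at u z" "has_partials_at v z" if "z \<in> U" for z using Suc.prems that by simp_all
  note p = partials_mult[OF hp]
  have *: "Ck_on k u U" "Ck_on k v U" "Ck_on k (partial_x u) U" "Ck_on k (partial_y u) U"
    "Ck_on k (partial_x v) U" "Ck_on k (partial_y v) U"
    using Suc.prems Ck_on_SucD[OF Suc.prems(1)] Ck_on_SucD[OF Suc.prems(2)] by auto
  have x: "Ck_on k (\<lambda>z. u z * partial_x v z + partial_x u z * v z) U"
    and y: "Ck_on k (\<lambda>z. u z * partial_y v z + partial_y u z * v z) U"
    by (intro Ck_on_add assms Suc.IH *)+
  have "Ck_on k (partial_x (\<lambda>z. u z * v z)) U" "Ck_on k (partial_y (\<lambda>z. u z * v z)) U"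
    by (rule Ck_on_cong[OF assms x], simp add: p(2), rule Ck_on_cong[OF assms y], simp add: p(3))
  then show ?case using Suc.prems p(1) by (auto intro: continuous_on_mult)
qed

text \<open>
By induction on \<open>k\<close> for all \<open>\<phi>\<close> at once: the partial derivatives of \<open>\<phi> \<circ> v\<close> involve \<open>deriv \<phi>\<close>,
which is again holomorphic.
\<close>
lemma Ck_on_compose:
  assumes "open U" "open V"
  shows "\<phi> holomorphic_on V \<Longrightarrow> v ` U \<subseteq> V \<Longrightarrow> Ck_on k v U \<Longrightarrow> Ck_on k (\<lambda>z. \<phi> (v z)) U"
proof (induction k arbitrary: \<phi>)
  case 0
  have "continuous_on U v" using 0(3) by simp
  from continuous_on_compose2[OF holomorphic_on_imp_continuous_on[OF 0(1)] this 0(2)]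
  show ?case by simp
next
  case (Suc k)
  have d: "(\<phi> has_field_derivative deriv \<phi> (v z)) (at (v z))" if "z \<in> U" for z
  proof -
    have "v z \<in> V" using Suc.prems(2) that by blast
    then show ?thesis by (rule holomorphic_derivI[OF Suc.prems(1) assms(2)])
  qed
  have hp: "has_partials_at v z" if "z \<in> U" for z using Suc.prems(3) that by simp
  note p = partials_compose[OF d hp]
  have "Ck_on k (\<lambda>z. deriv \<phi> (v z)) U"
    by (rule Suc.IH[OF holomorphic_deriv[OF Suc.prems(1) assms(2)] Suc.prems(2) Ck_on_SucD[OF Suc.prems(3)]])
  then have x: "Ck_on k (\<lambda>z. deriv \<phi> (v z) * partial_x v z) U" and y: "Ck_on k (\<lambda>z. deriv \<phi> (v z) * partial_y v z) U"
    using Suc.prems(3) by (auto intro!: Ck_on_mult assms)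
  have "Ck_on k (partial_x (\<lambda>z. \<phi> (v z))) U" "Ck_on k (partial_y (\<lambda>z. \<phi> (v z))) U"
    by (rule Ck_on_cong[OF assms(1) x], simp add: p(2), rule Ck_on_cong[OF assms(1) y], simp add: p(3))
  moreover have "continuous_on U (\<lambda>z. \<phi> (v z))"
    by (rule continuous_on_compose2[OF holomorphic_on_imp_continuous_on[OF Suc.prems(1)]
          Ck_on_imp_continuous_on[OF Suc.prems(3)] Suc.prems(2)])
  ultimately show ?case using p(1) by simp
qed

lemma Ck_on_const: "open U \<Longrightarrow> Ck_on k (\<lambda>z. c) U"
proof (induction k arbitrary: c)
  case (Suc k)
  have "partial_x (\<lambda>z. c) = (\<lambda>z. 0)" "partial_y (\<lambda>z. c) = (\<lambda>z. 0)"
    by (simp_all add: fun_eq_iff partials_const)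
  then show ?case using Suc.IH[OF Suc.prems, of 0] by (simp add: partials_const(1))
qed simp

lemma Ck_on_ident: "open U \<Longrightarrow> Ck_on k (\<lambda>z. z) U"
proof (cases k)
  case (Suc n)
  assume "open U"
  have "partial_x (\<lambda>z. z) = (\<lambda>z. 1)" "partial_y (\<lambda>z. z) = (\<lambda>z. \<i>)"
    by (simp_all add: fun_eq_iff partials_ident)
  then show ?thesis using \<open>open U\<close> by (simp add: Suc partials_ident Ck_on_const)
qed auto

section \<open>Real analytic functions\<close>

lemma summable_times:
  fixes f :: "'a \<Rightarrow> real" and g :: "'b \<Rightarrow> real"
  assumes "f summable_on A" "g summable_on B" "\<And>x. x \<in> A \<Longrightarrow> f x \<ge> 0" "\<And>x. x \<in> B \<Longrightarrow> g x \<ge> 0"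
  shows "(\<lambda>(x, y). f x * g y) summable_on A \<times> B"
proof (rule summable_on_SigmaI)
  show "((\<lambda>y. case (x, y) of (x, y) \<Rightarrow> f x * g y) has_sum f x * infsum g B) B" for x
    using has_sum_cmult_right[OF has_sum_infsum[OF assms(2)], of "f x"] by simp
  show "(\<lambda>x. f x * infsum g B) summable_on A"
    by (rule summable_on_cmult_left[OF assms(1)])
qed (use assms in auto)

lemma has_sum_times:
  fixes f :: "'a \<Rightarrow> complex" and g :: "'b \<Rightarrow> complex"
  assumes f: "(f has_sum s) A" and g: "(g has_sum t) B"
  shows "((\<lambda>(x, y). f x * g y) has_sum s * t) (A \<times> B)"
proof (rule has_sum_SigmaI)
  show "((\<lambda>y. case (x, y) of (x, y) \<Rightarrow> f x * g y) has_sum f x * t) B" for x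
    using has_sum_cmult_right[OF g, of "f x"] by simp
  show "((\<lambda>x. f x * t) has_sum s * t) A" by (rule has_sum_cmult_left[OF f])
  have "(\<lambda>x. norm (f x)) summable_on A" "(\<lambda>x. norm (g x)) summable_on B"
    using f g by (auto simp: summable_on_iff_abs_summable_on_complex dest!: has_sum_imp_summable)
  from summable_times[OF this] have "(\<lambda>(x, y). norm (f x) * norm (g y)) summable_on A \<times> B" by simp
  then have "(\<lambda>p. norm (case p of (x, y) \<Rightarrow> f x * g y)) summable_on A \<times> B"
    by (simp add: split_def norm_mult)
  then show "(\<lambda>(x, y). f x * g y) summable_on A \<times> B"
    by (simp add: summable_on_iff_abs_summable_on_complex)
qed

text \<open>
Powers of a series are indexed by words of fixed length over its index set, and compositions of
power series by all words. This avoids computing any coefficients.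
\<close>
definition words :: "'a set \<Rightarrow> nat \<Rightarrow> 'a list set" where
  "words J k = {xs. set xs \<subseteq> J \<and> length xs = k}"

lemma words_0: "words J 0 = {[]}" by (auto simp: words_def)

lemma bij_betw_words_Suc: "bij_betw (\<lambda>(x, xs). x # xs) (J \<times> words J k) (words J (Suc k))"
proof (rule bij_betwI[where g = "\<lambda>xs. (hd xs, tl xs)"])
  show "(\<lambda>xs. (hd xs, tl xs)) \<in> words J (Suc k) \<rightarrow> J \<times> words J k"
  proof
    fix xs assume "xs \<in> words J (Suc k)"
    then show "(hd xs, tl xs) \<in> J \<times> words J k" by (cases xs) (auto simp: words_def)
  qed
  show "(\<lambda>(x, xs). x # xs) ((hd xs, tl xs)) = xs" if "xs \<in> words J (Suc k)" for xs
    using that by (cases xs) (auto simp: words_def)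
qed (auto simp: words_def)

lemma has_sum_words:
  fixes f :: "'a \<Rightarrow> complex"
  assumes "(f has_sum s) J"
  shows "((\<lambda>xs. prod_list (map f xs)) has_sum s ^ k) (words J k)"
proof (induction k)
  case 0 then show ?case by (simp add: words_0 has_sum_finite_iff)
next
  case (Suc k)
  from has_sum_times[OF assms Suc]
  have "((\<lambda>p. prod_list (map f (case p of (x, xs) \<Rightarrow> x # xs))) has_sum s * s ^ k) (J \<times> words J k)"
    by (simp add: split_def)
  then show ?case
    by (simp only: has_sum_reindex_bij_betw[OF bij_betw_words_Suc, of "\<lambda>xs. prod_list (map f xs)"] power_Suc)
qed

text \<open>
The substitution of an absolutely convergent series into a power series with coefficients \<open>d\<close>
converges absolutely as a series over all words.
\<close>
lemma summable_words:
  fixes f :: "'a \<Rightarrow> real" and d :: "nat \<Rightarrow> real"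
  assumes f: "f summable_on J" "\<And>x. x \<in> J \<Longrightarrow> f x \<ge> 0"
    and d: "(\<lambda>k. d k * (infsum f J) ^ k) summable_on UNIV" "\<And>k. d k \<ge> 0"
  shows "(\<lambda>(k, xs). d k * prod_list (map f xs)) summable_on (SIGMA k:UNIV. words J k)"
proof (rule summable_on_SigmaI)
  fix k :: nat
  have s: "((\<lambda>x. complex_of_real (f x)) has_sum of_real (infsum f J)) J"
    by (rule has_sum_of_real[OF has_sum_infsum[OF f(1)]])
  moreover have "prod_list (map (\<lambda>x. complex_of_real (f x)) xs) = of_real (prod_list (map f xs))" for xs
    by (induction xs) auto
  ultimately have "((\<lambda>xs. complex_of_real (prod_list (map f xs))) has_sum of_real (infsum f J ^ k)) (words J k)"
    using has_sum_words[OF s, of k] by simp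
  then have "((\<lambda>xs. prod_list (map f xs)) has_sum infsum f J ^ k) (words J k)"
    by (simp only: has_sum_of_real_iff)
  then show "((\<lambda>xs. case (k, xs) of (k, xs) \<Rightarrow> d k * prod_list (map f xs)) has_sum d k * infsum f J ^ k) (words J k)"
    using has_sum_cmult_right by force
next
  show "(case (k, xs) of (k, xs) \<Rightarrow> d k * prod_list (map f xs)) \<ge> 0" if "xs \<in> words J k" for k xs
  proof -
    have "prod_list (map f xs) \<ge> 0"
      using that f(2) by (intro prod_list_nonneg) (auto simp: words_def)
    then show ?thesis using d(2) by simp
  qed
qed (use d in auto)

definition real_analytic_at :: "(complex \<Rightarrow> complex) \<Rightarrow> complex \<Rightarrow> bool" where
  "real_analytic_at v w \<longleftrightarrow> (\<exists>\<rho>>0. \<exists>a :: nat \<Rightarrow> nat \<Rightarrow> complex. \<forall>z\<in>ball w \<rho>.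
        ((\<lambda>(m, n). a m n * of_real (Re (z - w)) ^ m * of_real (Im (z - w)) ^ n)
           has_sum v z) UNIV)"

lemma real_analytic_on_iff: "real_analytic_on v U \<longleftrightarrow> (\<forall>w\<in>U. real_analytic_at v w)"
  by (simp add: real_analytic_on_def real_analytic_at_def)

text \<open>
A function is real analytic as soon as it is an absolutely convergent sum of monomials over an
arbitrary index set, with repetitions of exponents allowed: summing first over the indices with
given exponents produces the power series. Products and compositions then only need a suitable
index set.
\<close>
lemma real_analytic_atI:
  fixes c :: "'i \<Rightarrow> complex" and m n :: "'i \<Rightarrow> nat"
  assumes \<rho>: "\<rho> > 0"
    and summ: "(\<lambda>i. norm (c i) * \<rho> ^ (m i + n i)) summable_on I"
    and sum: "\<And>z. z \<in> ball w \<rho> \<Longrightarrow>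
      ((\<lambda>i. c i * of_real (Re (z - w)) ^ m i * of_real (Im (z - w)) ^ n i) has_sum v z) I"
  shows "real_analytic_at v w"
proof -
  define B where "B p = {i \<in> I. (m i, n i) = p}" for p
  define a where "a k l = infsum c (B (k, l))" for k l
  have c: "(c has_sum a k l) (B (k, l))" for k l
  proof -
    have "(\<lambda>i. norm (c i) * \<rho> ^ (m i + n i)) summable_on B (k, l)"
      by (rule summable_on_subset_banach[OF summ]) (auto simp: B_def)
    then have "(\<lambda>i. norm (c i) * \<rho> ^ (k + l)) summable_on B (k, l)"
      by (rule summable_on_cong[THEN iffD1, rotated]) (auto simp: B_def)
    then have "(\<lambda>i. norm (c i)) summable_on B (k, l)"
      using \<rho> by (subst (asm) summable_on_cmult_left') auto
    then show ?thesis
      by (simp add: a_def summable_on_iff_abs_summable_on_complex)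
  qed
  have bij: "bij_betw snd (Sigma UNIV B) I"
    by (rule bij_betwI[where g = "\<lambda>i. ((m i, n i), i)"]) (auto simp: B_def)
  have "((\<lambda>(k, l). a k l * of_real (Re (z - w)) ^ k * of_real (Im (z - w)) ^ l) has_sum v z) UNIV"
    if z: "z \<in> ball w \<rho>" for z
  proof (rule has_sum_Sigma'[where B = B])
    show "((\<lambda>p. c (snd p) * of_real (Re (z - w)) ^ m (snd p) * of_real (Im (z - w)) ^ n (snd p)) has_sum v z) (Sigma UNIV B)"
      using sum[OF z]
      by (subst has_sum_reindex_bij_betw[OF bij,
            of "\<lambda>i. c i * of_real (Re (z - w)) ^ m i * of_real (Im (z - w)) ^ n i"])
    show "((\<lambda>i. c (snd (p, i)) * of_real (Re (z - w)) ^ m (snd (p, i)) * of_real (Im (z - w)) ^ n (snd (p, i)))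
        has_sum (case p of (k, l) \<Rightarrow> a k l * of_real (Re (z - w)) ^ k * of_real (Im (z - w)) ^ l)) (B p)" for p
    proof -
      obtain k l where p: "p = (k, l)" by force
      have "((\<lambda>i. c i * (of_real (Re (z - w)) ^ k * of_real (Im (z - w)) ^ l))
        has_sum a k l * (of_real (Re (z - w)) ^ k * of_real (Im (z - w)) ^ l)) (B (k, l))"
        by (rule has_sum_cmult_left[OF c])
      then show ?thesis unfolding p
        by (subst has_sum_cong[where g = "\<lambda>i. c i * (of_real (Re (z - w)) ^ k * of_real (Im (z - w)) ^ l)"])
          (auto simp: B_def mult.assoc)
    qed
  qed
  then show ?thesis unfolding real_analytic_at_def using \<rho> by blast
qed

text \<open>
Convergence at the point with both coordinates, relative to \<open>w\<close>, equal to \<open>\<rho>\<close> is absolute, which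
is the bound needed for manipulating the series on the disc of radius \<open>\<rho>\<close>.
\<close>
lemma real_analytic_atE:
  assumes "real_analytic_at v w"
  obtains \<rho> and a :: "nat \<times> nat \<Rightarrow> complex" where "\<rho> > 0"
    "(\<lambda>p. norm (a p) * \<rho> ^ (fst p + snd p)) summable_on UNIV"
    "\<And>z. z \<in> ball w \<rho> \<Longrightarrow>
      ((\<lambda>p. a p * of_real (Re (z - w)) ^ fst p * of_real (Im (z - w)) ^ snd p) has_sum v z) UNIV"
proof -
  obtain \<rho> a where \<rho>: "\<rho> > 0" and a: "\<And>z. z \<in> ball w \<rho> \<Longrightarrow>
      ((\<lambda>(m, n). a m n * of_real (Re (z - w)) ^ m * of_real (Im (z - w)) ^ n) has_sum v z) UNIV"
    using assms unfolding real_analytic_at_def by blast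
  \<comment> \<open>The point \<open>Complex \<sigma> \<sigma>\<close> has to lie in the disc of radius \<open>\<rho>\<close>, so \<open>\<sigma> < \<rho> / sqrt 2\<close> is required.\<close>
  define \<sigma> where "\<sigma> = \<rho> / 2"
  define z where "z = w + Complex \<sigma> \<sigma>"
  have "norm (Complex \<sigma> \<sigma>) < \<rho>"
  proof -
    have "(norm (Complex \<sigma> \<sigma>))\<^sup>2 = \<sigma>\<^sup>2 + \<sigma>\<^sup>2" by (simp only: cmod_power2 complex.sel)
    also have "\<dots> < \<rho>\<^sup>2" using \<rho> by (simp add: \<sigma>_def power_divide)
    finally show ?thesis by (rule power_less_imp_less_base) (use \<rho> in simp)
  qed
  then have "z \<in> ball w \<rho>" by (simp add: z_def dist_norm)
  from has_sum_imp_summable[OF a[OF this]]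
  have "(\<lambda>p. norm (case p of (m, n) \<Rightarrow> a m n * of_real \<sigma> ^ m * of_real \<sigma> ^ n)) summable_on UNIV"
    by (simp add: z_def summable_on_iff_abs_summable_on_complex)
  then have "(\<lambda>p. norm (case p of (m, n) \<Rightarrow> a m n) * \<sigma> ^ (fst p + snd p)) summable_on UNIV"
    using \<rho> by (simp add: split_def norm_mult norm_power \<sigma>_def power_add mult.assoc)
  moreover have "((\<lambda>p. (case p of (m, n) \<Rightarrow> a m n) * of_real (Re (z - w)) ^ fst p * of_real (Im (z - w)) ^ snd p) has_sum v z) UNIV"
    if "z \<in> ball w \<sigma>" for z
    using a[of z] that \<rho> by (simp add: split_def \<sigma>_def)
  ultimately show ?thesis using that[of \<sigma>] \<rho> by (simp add: \<sigma>_def)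
qed

lemma summable_smaller_radius:
  assumes "(\<lambda>i. norm (c i) * \<sigma> ^ k i) summable_on I" "0 < \<tau>" "\<tau> \<le> \<sigma>"
  shows "(\<lambda>i. norm (c i) * \<tau> ^ k i) summable_on I"
  by (rule summable_on_comparison_test[OF assms(1)])
     (use assms in \<open>auto intro!: mult_left_mono power_mono\<close>)

lemma real_analytic_at_cong:
  assumes "real_analytic_at u w" "open U" "w \<in> U" "\<And>z. z \<in> U \<Longrightarrow> u z = v z"
  shows "real_analytic_at v w"
proof -
  obtain \<rho> a where \<rho>: "\<rho> > 0" and a: "\<And>z. z \<in> ball w \<rho> \<Longrightarrow>
      ((\<lambda>(m, n). a m n * of_real (Re (z - w)) ^ m * of_real (Im (z - w)) ^ n) has_sum u z) UNIV"
    using assms(1) unfolding real_analytic_at_def by blast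
  obtain e where e: "e > 0" "ball w e \<subseteq> U" using assms(2,3) open_contains_ball by blast
  have "((\<lambda>(m, n). a m n * of_real (Re (z - w)) ^ m * of_real (Im (z - w)) ^ n) has_sum v z) UNIV"
    if z: "z \<in> ball w (min \<rho> e)" for z
  proof -
    have "u z = v z" using z e(2) by (intro assms(4)) auto
    with a[of z] z show ?thesis by (simp only: ball_min_Int Int_iff)
  qed
  moreover have "min \<rho> e > 0" using \<rho> e by simp
  ultimately show ?thesis unfolding real_analytic_at_def by blast
qed

lemma real_analytic_at_ident: "real_analytic_at (\<lambda>z. z) w"
proof (rule real_analytic_atI)
  define c :: "nat \<Rightarrow> complex" where "c i = (if i = 0 then w else if i = 1 then 1 else \<i>)" for i
  define m n :: "nat \<Rightarrow> nat" where "m i = (if i = 1 then 1 else 0)" and "n i = (if i = 2 then 1 else 0)" for i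
  show "(\<lambda>i. norm (c i) * 1 ^ (m i + n i)) summable_on {0, 1, 2}" by (rule summable_on_finite) simp
  show "((\<lambda>i. c i * of_real (Re (z - w)) ^ m i * of_real (Im (z - w)) ^ n i) has_sum z) {0, 1, 2}" for z
    by (rule has_sum_finiteI) (auto simp: c_def m_def n_def complex_eq_iff)
qed simp

lemma real_analytic_at_mult:
  assumes "real_analytic_at u w" "real_analytic_at v w"
  shows "real_analytic_at (\<lambda>z. u z * v z) w"
proof -
  obtain \<rho>1 and a :: "nat \<times> nat \<Rightarrow> complex" where 1: "\<rho>1 > 0"
    "(\<lambda>p. norm (a p) * \<rho>1 ^ (fst p + snd p)) summable_on UNIV"
    "\<And>z. z \<in> ball w \<rho>1 \<Longrightarrow>
      ((\<lambda>p. a p * of_real (Re (z - w)) ^ fst p * of_real (Im (z - w)) ^ snd p) has_sum u z) UNIV"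
    using real_analytic_atE[OF assms(1)] by blast
  obtain \<rho>2 and b :: "nat \<times> nat \<Rightarrow> complex" where 2: "\<rho>2 > 0"
    "(\<lambda>p. norm (b p) * \<rho>2 ^ (fst p + snd p)) summable_on UNIV"
    "\<And>z. z \<in> ball w \<rho>2 \<Longrightarrow>
      ((\<lambda>p. b p * of_real (Re (z - w)) ^ fst p * of_real (Im (z - w)) ^ snd p) has_sum v z) UNIV"
    using real_analytic_atE[OF assms(2)] by blast
  define \<rho> where "\<rho> = min \<rho>1 \<rho>2"
  have \<rho>: "\<rho> > 0" "\<rho> \<le> \<rho>1" "\<rho> \<le> \<rho>2" using 1 2 by (auto simp: \<rho>_def)
  show ?thesis
  proof (rule real_analytic_atI[OF \<rho>(1), where I = UNIV and c = "\<lambda>(p, q). a p * b q"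
        and m = "\<lambda>(p, q). fst p + fst q" and n = "\<lambda>(p, q). snd p + snd q"])
    have "(\<lambda>(p, q). (norm (a p) * \<rho> ^ (fst p + snd p)) * (norm (b q) * \<rho> ^ (fst q + snd q))) summable_on UNIV \<times> UNIV"
      using \<rho> by (intro summable_times summable_smaller_radius[OF 1(2)] summable_smaller_radius[OF 2(2)]) auto
    then show "(\<lambda>i. norm (case i of (p, q) \<Rightarrow> a p * b q) *
        \<rho> ^ ((case i of (p, q) \<Rightarrow> fst p + fst q) + (case i of (p, q) \<Rightarrow> snd p + snd q))) summable_on UNIV"
      by (simp add: split_def norm_mult power_add mult_ac)
    fix z assume z: "z \<in> ball w \<rho>"
    have "((\<lambda>(p, q). (a p * of_real (Re (z - w)) ^ fst p * of_real (Im (z - w)) ^ snd p)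
        * (b q * of_real (Re (z - w)) ^ fst q * of_real (Im (z - w)) ^ snd q)) has_sum u z * v z) (UNIV \<times> UNIV)"
      using z \<rho> by (intro has_sum_times 1(3) 2(3)) auto
    then show "((\<lambda>i. (case i of (p, q) \<Rightarrow> a p * b q) * of_real (Re (z - w)) ^ (case i of (p, q) \<Rightarrow> fst p + fst q)
        * of_real (Im (z - w)) ^ (case i of (p, q) \<Rightarrow> snd p + snd q)) has_sum u z * v z) UNIV"
      by (simp add: split_def power_add mult_ac)
  qed
qed

text \<open>
Substitute the power series of \<open>v\<close> without its constant term into the Taylor series of \<open>\<phi>\<close> at
\<open>v w\<close>. The sum of the absolute values of the non-constant terms tends to zero with the radius,
because each of them contains at least one factor of the radius; so on a small disc the
substituted values stay where the Taylor series converges absolutely.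
\<close>
lemma real_analytic_at_compose:
  assumes v: "real_analytic_at v w" and \<phi>: "\<phi> holomorphic_on V" "open V" "v w \<in> V"
  shows "real_analytic_at (\<lambda>z. \<phi> (v z)) w"
proof -
  obtain \<sigma> and a :: "nat \<times> nat \<Rightarrow> complex" where \<sigma>: "\<sigma> > 0"
    and summ: "(\<lambda>p. norm (a p) * \<sigma> ^ (fst p + snd p)) summable_on UNIV"
    and sum: "\<And>z. z \<in> ball w \<sigma> \<Longrightarrow>
      ((\<lambda>p. a p * of_real (Re (z - w)) ^ fst p * of_real (Im (z - w)) ^ snd p) has_sum v z) UNIV"
    using real_analytic_atE[OF v] by blast
  obtain R where R: "R > 0" "ball (v w) R \<subseteq> V" using \<phi> open_contains_ball by blast
  define d where "d k = (deriv ^^ k) \<phi> (v w) / fact k" for k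
  have series: "(\<lambda>k. d k * (x - v w) ^ k) sums \<phi> x" if "x \<in> ball (v w) R" for x
    using holomorphic_power_series[OF holomorphic_on_subset[OF \<phi>(1) R(2)] that] by (simp add: d_def)
  define J where "J = (UNIV :: (nat \<times> nat) set) - {(0, 0)}"
  define f where "f z p = a p * of_real (Re (z - w)) ^ fst p * of_real (Im (z - w)) ^ snd p" for z and p :: "nat \<times> nat"
  have sumJ': "(f z has_sum v z - a (0, 0)) J" if "z \<in> ball w \<sigma>" for z
  proof -
    have "(f z has_sum f z (0, 0)) {(0, 0)}" by (simp add: has_sum_finite_iff)
    moreover have "(f z has_sum v z) UNIV" using sum[OF that] by (simp only: f_def[abs_def])
    ultimately have "(f z has_sum v z - f z (0, 0)) J"
      unfolding J_def by (intro has_sum_Diff) auto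
    then show ?thesis by (simp add: f_def)
  qed
  have a0: "a (0, 0) = v w"
  proof -
    have "(f w has_sum 0) J" by (rule has_sum_0) (auto simp: f_def J_def)
    then show ?thesis using has_sum_unique sumJ'[of w] \<sigma> by fastforce
  qed
  have sumJ: "(f z has_sum v z - v w) J" if "z \<in> ball w \<sigma>" for z
    using sumJ'[OF that] by (simp add: a0)
  define S where "S = infsum (\<lambda>p. norm (a p) * \<sigma> ^ (fst p + snd p)) J"
  have summJ: "(\<lambda>p. norm (a p) * \<sigma> ^ (fst p + snd p)) summable_on J"
    by (rule summable_on_subset_banach[OF summ]) auto
  have S: "S \<ge> 0" unfolding S_def using \<sigma> by (intro infsum_nonneg) auto
  \<comment> \<open>Shrinking the radius by the factor \<open>\<theta>\<close> brings the sum of the non-constant terms below \<open>R / 2\<close>.\<close>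
  define \<theta> where "\<theta> = min 1 (R / (2 * (S + 1)))"
  have \<theta>: "0 < \<theta>" "\<theta> \<le> 1" using R S by (auto simp: \<theta>_def)
  have \<theta>S: "\<theta> * S < R / 2"
  proof -
    have "\<theta> * S \<le> R / (2 * (S + 1)) * S" using S by (intro mult_right_mono) (auto simp: \<theta>_def)
    also have "\<dots> < R / 2" using R S by (simp add: field_simps)
    finally show ?thesis .
  qed
  define \<tau> where "\<tau> = \<theta> * \<sigma>"
  have \<tau>: "0 < \<tau>" "\<tau> \<le> \<sigma>" using \<theta> \<sigma> by (auto simp: \<tau>_def mult_left_le_one_le)
  define M where "M p = norm (a p) * \<tau> ^ (fst p + snd p)" for p
  have Mpos: "M p \<ge> 0" for p using \<tau> by (simp add: M_def)
  have M: "M summable_on J" unfolding M_def by (rule summable_smaller_radius[OF summJ \<tau>])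
  have "infsum M J \<le> infsum (\<lambda>p. \<theta> * (norm (a p) * \<sigma> ^ (fst p + snd p))) J"
  proof (rule infsum_mono[OF M summable_on_cmult_right[OF summJ]])
    fix p assume "p \<in> J"
    then obtain k where k: "fst p + snd p = Suc k"
      by (cases p) (auto simp: J_def gr0_conv_Suc intro: that dest!: not0_implies_Suc)
    have "\<theta> ^ Suc k \<le> \<theta> * 1" unfolding power_Suc using \<theta> by (intro mult_left_mono power_le_one) auto
    then have "norm (a p) * \<sigma> ^ Suc k * \<theta> ^ Suc k \<le> norm (a p) * \<sigma> ^ Suc k * \<theta>"
      using \<sigma> by (intro mult_left_mono) auto
    then show "M p \<le> \<theta> * (norm (a p) * \<sigma> ^ (fst p + snd p))"
      by (simp only: M_def \<tau>_def k power_mult_distrib mult_ac)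
  qed
  also have "\<dots> = \<theta> * S" unfolding S_def by (rule infsum_cmult_right) (use summJ in auto)
  finally have MR: "infsum M J < R / 2" using \<theta>S by simp
  have M0: "infsum M J \<ge> 0" using \<tau> by (intro infsum_nonneg) (simp add: M_def)
  have dsumm: "summable (\<lambda>k. norm (d k * x ^ k))" if "norm x < R / 2" for x :: complex
  proof (rule powser_insidea)
    show "summable (\<lambda>k. d k * of_real (R / 2) ^ k)"
      using series[of "v w + of_real (R / 2)"] R by (auto simp: sums_iff dist_norm)
    show "norm x < norm (of_real (R / 2) :: complex)" using that R by simp
  qed
  show ?thesis
  proof (rule real_analytic_atI[OF \<tau>(1), where I = "SIGMA k:UNIV. words J k"
        and c = "\<lambda>(k, xs). d k * prod_list (map a xs)"
        and m = "\<lambda>(k, xs). sum_list (map fst xs)" and n = "\<lambda>(k, xs). sum_list (map snd xs)"])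
    have dM: "(\<lambda>k. norm (d k) * infsum M J ^ k) summable_on UNIV"
      using dsumm[of "of_real (infsum M J)"] MR M0
      by (subst summable_on_UNIV_nonneg_real_iff) (auto simp: norm_mult norm_power)
    have prodM: "norm (prod_list (map a xs)) * \<tau> ^ (sum_list (map fst xs) + sum_list (map snd xs)) = prod_list (map M xs)" for xs
      by (induction xs) (auto simp: M_def norm_mult power_add mult_ac)
    have summW: "(\<lambda>(k, xs). norm (d k) * prod_list (map M xs)) summable_on (SIGMA k:UNIV. words J k)"
      by (rule summable_words[OF M _ dM]) (use \<tau> in \<open>auto simp: M_def\<close>)
    then show "(\<lambda>i. norm (case i of (k, xs) \<Rightarrow> d k * prod_list (map a xs)) *
        \<tau> ^ ((case i of (k, xs) \<Rightarrow> sum_list (map fst xs)) + (case i of (k, xs) \<Rightarrow> sum_list (map snd xs))))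
        summable_on (SIGMA k:UNIV. words J k)"
      by (simp add: split_def norm_mult mult.assoc prodM)
    fix z assume z: "z \<in> ball w \<tau>"
    have zs: "z \<in> ball w \<sigma>" using z \<tau> by auto
    have prodf: "d k * prod_list (map a xs) * of_real (Re (z - w)) ^ sum_list (map fst xs) * of_real (Im (z - w)) ^ sum_list (map snd xs)
        = d k * prod_list (map (f z) xs)" for k xs
      by (induction xs) (auto simp: f_def power_add mult_ac)
    have fM: "norm (f z p) \<le> M p" for p
    proof -
      have "\<bar>Re (z - w)\<bar> \<le> \<tau>" "\<bar>Im (z - w)\<bar> \<le> \<tau>"
        using z abs_Re_le_cmod[of "z - w"] abs_Im_le_cmod[of "z - w"]
        by (auto simp: dist_norm norm_minus_commute)
      then have "\<bar>Re (z - w)\<bar> ^ fst p * \<bar>Im (z - w)\<bar> ^ snd p \<le> \<tau> ^ fst p * \<tau> ^ snd p"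
        using \<tau> by (intro mult_mono power_mono) auto
      then show ?thesis
        by (simp add: f_def M_def norm_mult norm_power power_add mult.assoc mult_left_mono del: minus_complex.sel)
    qed
    have "norm (v z - v w) \<le> infsum M J"
      using norm_infsum_le[OF sumJ[OF zs] has_sum_infsum[OF M] fM] .
    then have small: "norm (v z - v w) < R / 2" using MR by linarith
    have outer: "((\<lambda>k. d k * (v z - v w) ^ k) has_sum \<phi> (v z)) UNIV"
      using small R by (intro norm_summable_imp_has_sum dsumm series) (auto simp: dist_norm norm_minus_commute)
    have inner: "((\<lambda>xs. d k * prod_list (map (f z) xs)) has_sum d k * (v z - v w) ^ k) (words J k)" for k
      by (intro has_sum_cmult_right has_sum_words sumJ zs)
    have "((\<lambda>(k, xs). d k * prod_list (map (f z) xs)) has_sum \<phi> (v z)) (SIGMA k:UNIV. words J k)"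
    proof (rule has_sum_SigmaI[OF _ outer])
      have "norm (prod_list (map (f z) xs)) \<le> prod_list (map M xs)" for xs
      proof (induction xs)
        case (Cons p xs)
        have "norm (f z p) * norm (prod_list (map (f z) xs)) \<le> M p * prod_list (map M xs)"
          using Mpos by (intro mult_mono fM Cons.IH norm_ge_zero) auto
        then show ?case by (simp add: norm_mult)
      qed simp
      then have "(\<lambda>i. norm (case i of (k, xs) \<Rightarrow> d k * prod_list (map (f z) xs))) summable_on (SIGMA k:UNIV. words J k)"
        by (intro summable_on_comparison_test[OF summW]) (auto simp: norm_mult intro!: mult_left_mono)
      then show "(\<lambda>(k, xs). d k * prod_list (map (f z) xs)) summable_on (SIGMA k:UNIV. words J k)"
        by (simp add: summable_on_iff_abs_summable_on_complex)
    qed (use inner in simp)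
    then show "((\<lambda>i. (case i of (k, xs) \<Rightarrow> d k * prod_list (map a xs))
        * of_real (Re (z - w)) ^ (case i of (k, xs) \<Rightarrow> sum_list (map fst xs))
        * of_real (Im (z - w)) ^ (case i of (k, xs) \<Rightarrow> sum_list (map snd xs))) has_sum \<phi> (v z)) (SIGMA k:UNIV. words J k)"
      by (simp only: split_def prodf)
  qed
qed

lemma real_analytic_at_imp_isCont:
  assumes "real_analytic_at v w"
  shows "isCont v w"
proof -
  obtain \<sigma> and a :: "nat \<times> nat \<Rightarrow> complex" where \<sigma>: "\<sigma> > 0"
    and summ: "(\<lambda>p. norm (a p) * \<sigma> ^ (fst p + snd p)) summable_on UNIV"
    and sum: "\<And>z. z \<in> ball w \<sigma> \<Longrightarrow>
      ((\<lambda>p. a p * of_real (Re (z - w)) ^ fst p * of_real (Im (z - w)) ^ snd p) has_sum v z) UNIV"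
    using real_analytic_atE[OF assms] by blast
  define f where "f p z = a p * of_real (Re (z - w)) ^ fst p * of_real (Im (z - w)) ^ snd p" for z and p :: "nat \<times> nat"
  have "uniform_limit (ball w \<sigma>) (\<lambda>X z. \<Sum>p\<in>X. f p z) v (finite_subsets_at_top UNIV)"
  proof (rule Weierstrass_m_test_general'[OF _ _ summ])
    fix p z assume z: "z \<in> ball w \<sigma>"
    have "\<bar>Re (z - w)\<bar> \<le> \<sigma>" "\<bar>Im (z - w)\<bar> \<le> \<sigma>"
      using z abs_Re_le_cmod[of "z - w"] abs_Im_le_cmod[of "z - w"]
      by (auto simp: dist_norm norm_minus_commute)
    then have "\<bar>Re (z - w)\<bar> ^ fst p * \<bar>Im (z - w)\<bar> ^ snd p \<le> \<sigma> ^ fst p * \<sigma> ^ snd p"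
      using \<sigma> by (intro mult_mono power_mono) auto
    then show "norm (f p z) \<le> norm (a p) * \<sigma> ^ (fst p + snd p)"
      by (simp add: f_def norm_mult norm_power power_add mult.assoc mult_left_mono del: minus_complex.sel)
  qed (use sum in \<open>simp add: f_def\<close>)
  moreover have "\<forall>\<^sub>F X in finite_subsets_at_top UNIV. continuous_on (ball w \<sigma>) (\<lambda>z. \<Sum>p\<in>X. f p z)"
    unfolding f_def by (intro always_eventually allI continuous_intros)
  ultimately have "continuous_on (ball w \<sigma>) v"
    by (intro uniform_limit_theorem) auto
  then show ?thesis using \<sigma> by (simp add: continuous_on_eq_continuous_at)
qed

section \<open>Closure properties common to all smoothness classes\<close>

lemma Cr_on_cong:
  assumes "open U" "Cr_on r u U" "\<And>z. z \<in> U \<Longrightarrow> u z = v z"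
  shows "Cr_on r v U"
proof (cases r)
  case (Order k) then show ?thesis using Ck_on_cong[OF assms(1), of k u v] assms(2,3) by simp
next
  case Smooth then show ?thesis using Ck_on_cong[OF assms(1), of _ u v] assms(2,3) by simp
next
  case Analytic then show ?thesis
    using real_analytic_at_cong[OF _ assms(1), of u _ v] assms(2,3) by (simp add: real_analytic_on_iff)
qed

lemma Cr_on_local:
  assumes "open U" "\<And>z. z \<in> U \<Longrightarrow> \<exists>V. open V \<and> z \<in> V \<and> Cr_on r v V"
  shows "Cr_on r v U"
proof (cases r)
  case (Order k) then show ?thesis using Ck_on_local[OF assms(1), of k v] assms(2) by simp
next
  case Smooth
  have "Ck_on k v U" for k
    using assms(2) by (intro Ck_on_local[OF assms(1)]) (auto simp: Smooth)
  then show ?thesis by (simp add: Smooth)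
next
  case Analytic
  have "real_analytic_at v z" if "z \<in> U" for z
    using assms(2)[OF that] by (auto simp: Analytic real_analytic_on_iff)
  then show ?thesis by (simp add: Analytic real_analytic_on_iff)
qed

lemma Cr_on_subset:
  assumes "Cr_on r v U" "V \<subseteq> U" shows "Cr_on r v V"
proof (cases r)
  case (Order k) then show ?thesis using Ck_on_subset[of k v U V] assms by simp
next
  case Smooth then show ?thesis using Ck_on_subset[of _ v U V] assms by simp
next
  case Analytic then show ?thesis using assms by (auto simp: real_analytic_on_iff)
qed

lemma Cr_on_imp_continuous_on:
  assumes "Cr_on r v U" shows "continuous_on U v"
proof (cases r)
  case (Order k) then show ?thesis using Ck_on_imp_continuous_on[of k] assms by simp
next
  case Smooth
  then have "Ck_on 0 v U" using assms unfolding Smooth Cr_on.simps by blast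
  then show ?thesis by (rule Ck_on_imp_continuous_on)
next
  case Analytic then show ?thesis
    using assms by (auto simp: real_analytic_on_iff intro!: continuous_at_imp_continuous_on real_analytic_at_imp_isCont)
qed

lemma Cr_on_mult:
  assumes "open U" "Cr_on r u U" "Cr_on r v U"
  shows "Cr_on r (\<lambda>z. u z * v z) U"
proof (cases r)
  case (Order k) then show ?thesis using Ck_on_mult[OF assms(1), of k u v] assms by simp
next
  case Smooth then show ?thesis using Ck_on_mult[OF assms(1), of _ u v] assms by simp
next
  case Analytic then show ?thesis using assms real_analytic_at_mult[of u _ v] by (simp add: real_analytic_on_iff)
qed

lemma Cr_on_compose:
  assumes "open U" "open V" "\<phi> holomorphic_on V" "v ` U \<subseteq> V" "Cr_on r v U"
  shows "Cr_on r (\<lambda>z. \<phi> (v z)) U"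
proof (cases r)
  case (Order k) then show ?thesis using Ck_on_compose[OF assms(1-4), of k] assms by simp
next
  case Smooth then show ?thesis using Ck_on_compose[OF assms(1-4)] assms by simp
next
  case Analytic
  have "real_analytic_at (\<lambda>z. \<phi> (v z)) z" if "z \<in> U" for z
    using assms that by (intro real_analytic_at_compose[of v z \<phi> V]) (auto simp: Analytic real_analytic_on_iff)
  then show ?thesis by (simp add: Analytic real_analytic_on_iff)
qed

lemma Cr_on_holomorphic:
  assumes "open U" "F holomorphic_on U" shows "Cr_on r F U"
proof -
  have "Cr_on r (\<lambda>z. z) U"
    by (cases r) (auto simp: Ck_on_ident assms(1) real_analytic_on_iff real_analytic_at_ident)
  from Cr_on_compose[OF assms(1,1,2) _ this] show ?thesis by simp
qed

section \<open>Linearising the equation\<close>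

text \<open>
A solution \<open>h\<close> of \<open>h' f = \<mu> h\<close> that is a local coordinate at \<open>a\<close>; it turns the equation
\<open>dbar v = f(v) g\<close> into the linear equation \<open>dbar (h(v)) = \<mu> h(v) g\<close>. Where \<open>f\<close> does not vanish,
\<open>h\<close> is the exponential of a primitive of \<open>1 / f\<close>, with \<open>\<mu> = 1\<close>. At a zero of \<open>f\<close> the function
\<open>1 / f\<close> has a simple pole with residue \<open>1 / f'(a)\<close>; with \<open>\<mu> = f'(a)\<close> the quotient \<open>\<mu> / f\<close> has
residue one, so the exponential of its primitive is \<open>x - a\<close> times a nonvanishing holomorphic
function. This is where the zeros of \<open>f\<close> have to be simple.
\<close>
lemma linearising_coordinate:
  assumes S: "open S" "f holomorphic_on S" "a \<in> S" and simple: "f a = 0 \<Longrightarrow> deriv f a \<noteq> 0"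
  obtains \<mu> h e where "e > 0" "ball a e \<subseteq> S" "h holomorphic_on ball a e" "deriv h a \<noteq> 0"
    "\<And>x. x \<in> ball a e \<Longrightarrow> deriv h x * f x = \<mu> * h x"
proof (cases "f a = 0")
  case False
  have "isCont f a" using S holomorphic_on_imp_continuous_on continuous_on_eq_continuous_at by blast
  then obtain e1 where e1: "e1 > 0" "\<And>x. dist a x < e1 \<Longrightarrow> f x \<noteq> 0"
    using continuous_at_avoid[of a f 0] False by blast
  obtain e2 where e2: "e2 > 0" "ball a e2 \<subseteq> S" using S open_contains_ball by blast
  define e where "e = min e1 e2"
  have e: "e > 0" "ball a e \<subseteq> S" "\<And>x. x \<in> ball a e \<Longrightarrow> f x \<noteq> 0"
    using e1 e2 by (auto simp: e_def subset_iff)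
  have "(\<lambda>x. 1 / f x) holomorphic_on ball a e"
    using e by (intro holomorphic_intros holomorphic_on_subset[OF S(2)]) auto
  then obtain g where g: "\<And>x. x \<in> ball a e \<Longrightarrow> (g has_field_derivative 1 / f x) (at x)"
    using holomorphic_convex_primitive'[of "ball a e"] by (metis at_within_open convex_ball open_ball)
  have h': "((\<lambda>x. exp (g x)) has_field_derivative exp (g x) * (1 / f x)) (at x)" if "x \<in> ball a e" for x
    by (rule DERIV_chain'[OF g[OF that] DERIV_exp, THEN DERIV_cong]) simp
  show ?thesis
  proof (rule that[of e "\<lambda>x. exp (g x)" 1])
    show "(\<lambda>x. exp (g x)) holomorphic_on ball a e"
      using h' holomorphic_on_open[of "ball a e"] by blast
    show "deriv (\<lambda>x. exp (g x)) a \<noteq> 0"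
      using DERIV_imp_deriv[OF h'[of a]] e by simp
    show "deriv (\<lambda>x. exp (g x)) x * f x = 1 * exp (g x)" if "x \<in> ball a e" for x
      using DERIV_imp_deriv[OF h'[OF that]] e(3)[OF that] by simp
  qed (use e in auto)
next
  case True
  define \<mu> where "\<mu> = deriv f a"
  have \<mu>: "\<mu> \<noteq> 0" using simple True by (simp add: \<mu>_def)
  define k where "k x = (if x = a then \<mu> else f x / (x - a))" for x
  have fk: "f x = (x - a) * k x" for x using True by (simp add: k_def)
  obtain e2 where e2: "e2 > 0" "ball a e2 \<subseteq> S" using S open_contains_ball by blast
  have holk: "k holomorphic_on ball a e2"
  proof (rule holomorphic_transform)
    show "(\<lambda>z. if z = a then deriv f a else (f z - f a) / (z - a)) holomorphic_on ball a e2"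
      using e2 by (intro pole_lemma_open holomorphic_on_subset[OF S(2)]) auto
  qed (simp add: k_def \<mu>_def True)
  have "isCont k a"
    using holomorphic_on_imp_continuous_on[OF holk] e2(1) by (simp add: continuous_on_eq_continuous_at)
  then obtain e1 where e1: "e1 > 0" "\<And>x. dist a x < e1 \<Longrightarrow> k x \<noteq> 0"
    using continuous_at_avoid[of a k 0] \<mu> by (auto simp: k_def)
  define e where "e = min e1 e2"
  have e: "e > 0" "ball a e \<subseteq> ball a e2" "\<And>x. x \<in> ball a e \<Longrightarrow> k x \<noteq> 0"
    using e1 e2 by (auto simp: e_def)
  \<comment> \<open>\<open>q\<close> is \<open>\<mu> / f x - 1 / (x - a)\<close> with its removable singularity at \<open>a\<close> filled in.\<close>
  define q where "q x = (if x = a then deriv (\<lambda>x. \<mu> / k x) a else (\<mu> / k x - \<mu> / k a) / (x - a))" for x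
  have holq: "q holomorphic_on ball a e"
    unfolding q_def using e
    by (intro pole_lemma_open holomorphic_intros holomorphic_on_subset[OF holk]) auto
  obtain g where g: "\<And>x. x \<in> ball a e \<Longrightarrow> (g has_field_derivative q x) (at x)"
    using holomorphic_convex_primitive'[of "ball a e", OF _ _ holq] by (metis at_within_open convex_ball open_ball)
  have ka: "k a = \<mu>" by (simp add: k_def)
  have h': "((\<lambda>x. (x - a) * exp (g x)) has_field_derivative exp (g x) * \<mu> / k x) (at x)" if x: "x \<in> ball a e" for x
  proof -
    have "(x - a) * q x = \<mu> / k x - 1" using \<mu> by (simp add: q_def ka)
    then have "(x - a) * (exp (g x) * q x) + 1 * exp (g x) = exp (g x) * \<mu> / k x"
      by (metis (no_types) add.commute diff_add_cancel distrib_left mult.left_commute mult.right_neutral mult_1 times_divide_eq_right)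
    moreover have "((\<lambda>x. (x - a) * exp (g x)) has_field_derivative (x - a) * (exp (g x) * q x) + 1 * exp (g x)) (at x)"
      by (auto intro!: derivative_eq_intros g[OF x])
    ultimately show ?thesis by simp
  qed
  show ?thesis
  proof (rule that[of e "\<lambda>x. (x - a) * exp (g x)" \<mu>])
    show "(\<lambda>x. (x - a) * exp (g x)) holomorphic_on ball a e"
      using h' holomorphic_on_open[of "ball a e"] by blast
    show "deriv (\<lambda>x. (x - a) * exp (g x)) a \<noteq> 0"
      using DERIV_imp_deriv[OF h'[of a]] e \<mu> by simp
    show "deriv (\<lambda>x. (x - a) * exp (g x)) x * f x = \<mu> * ((x - a) * exp (g x))" if "x \<in> ball a e" for x
      using DERIV_imp_deriv[OF h'[OF that]] e(3)[OF that] by (simp add: fk)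
  qed (use e e2 in auto)
qed

lemma dbar_mult:
  assumes "has_partials_at u z" "has_partials_at v z"
  shows "dbar (\<lambda>z. u z * v z) z = u z * dbar v z + dbar u z * v z"
  by (simp add: dbar_def partials_mult[OF assms] field_simps)

lemma dbar_compose:
  assumes "(\<phi> has_field_derivative d) (at (v z))" "has_partials_at v z"
  shows "dbar (\<lambda>z. \<phi> (v z)) z = d * dbar v z"
  by (simp add: dbar_def partials_compose[OF assms] field_simps)

theorem theorem4p8:
  fixes \<Omega>1 \<Omega>2 :: "complex set"
    and f g G v :: "complex \<Rightarrow> complex"
    and r :: smoothness
  assumes "open \<Omega>1" and "open \<Omega>2"
    and "f holomorphic_on \<Omega>2" and "only_simple_zeros f \<Omega>2"
    and "Cr_on r G \<Omega>1"
    and "\<forall>z\<in>\<Omega>1. has_partials_at G z \<and> g z = dbar G z"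
    and "v \<in> \<Omega>1 \<rightarrow> \<Omega>2" and "continuous_on \<Omega>1 v"
    and "condition_star v \<Omega>1"
    and "AE z in lebesgue_on \<Omega>1. has_partials_at v z \<and> dbar v z = f (v z) * g z"
  shows "Cr_on r v \<Omega>1"
proof (rule Cr_on_local[OF \<open>open \<Omega>1\<close>])
  fix z0 assume z0: "z0 \<in> \<Omega>1"
  have "v z0 \<in> \<Omega>2" using z0 assms(7) by auto
  then obtain \<mu> h e where e: "e > 0" "h holomorphic_on ball (v z0) e" "deriv h (v z0) \<noteq> 0"
    and hf: "\<And>x. x \<in> ball (v z0) e \<Longrightarrow> deriv h x * f x = \<mu> * h x"
    using linearising_coordinate[OF assms(2,3), of "v z0"] assms(4) unfolding only_simple_zeros_def by metis
  obtain \<rho> where \<rho>: "\<rho> > 0" "ball (v z0) \<rho> \<subseteq> ball (v z0) e" "open (h ` ball (v z0) \<rho>)" "inj_on h (ball (v z0) \<rho>)"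
    using has_complex_derivative_locally_invertible[OF e(2) _ open_ball e(3)] e(1) by auto
  let ?B = "ball (v z0) \<rho>"
  have holh: "h holomorphic_on ?B" by (rule holomorphic_on_subset[OF e(2) \<rho>(2)])
  obtain k where k: "k holomorphic_on h ` ?B" "\<And>x. x \<in> ?B \<Longrightarrow> k (h x) = x"
    using holomorphic_has_inverse[OF holh open_ball \<rho>(4)] by metis
  define V where "V = \<Omega>1 \<inter> v -` ?B"
  have V: "open V" "z0 \<in> V" "V \<subseteq> \<Omega>1"
    unfolding V_def using continuous_open_preimage[OF assms(8,1) open_ball] z0 \<rho> by auto
  have vB: "v z \<in> ?B" if "z \<in> V" for z using that by (simp add: V_def)
  have contv: "continuous_on V v" and contG: "continuous_on V G"
    using continuous_on_subset[OF assms(8) V(3)]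
      continuous_on_subset[OF Cr_on_imp_continuous_on[OF assms(5)] V(3)] by auto
  \<comment> \<open>\<open>dbar (h(v)) = \<mu> h(v) g\<close>, and the integrating factor \<open>E\<close> cancels the right-hand side.\<close>
  define E where "E z = exp (- \<mu> * G z)" for z
  define u where "u z = h (v z) * E z" for z
  define C where "C = {z \<in> \<Omega>1. \<not> has_partials_at v z}"
  define Z where "Z = {z \<in> \<Omega>1. \<not> (has_partials_at v z \<and> dbar v z = f (v z) * g z)}"
  have "negligible Z"
  proof -
    have "AE z in lebesgue. z \<in> \<Omega>1 \<longrightarrow> has_partials_at v z \<and> dbar v z = f (v z) * g z"
      using assms(1,10) by (subst (asm) AE_restrict_space_iff) auto
    then obtain N where "N \<in> null_sets lebesgue" "Z \<subseteq> N"
      unfolding eventually_ae_filter Z_def by auto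
    then show ?thesis using negligible_subset negligible_iff_null_sets by blast
  qed
  have derh: "(h has_field_derivative deriv h (v z)) (at (v z))" if "z \<in> V" for z
    by (rule holomorphic_derivI[OF holh open_ball vB[OF that]])
  have derE: "((\<lambda>\<zeta>. exp (- \<mu> * \<zeta>)) has_field_derivative - \<mu> * exp (- \<mu> * \<zeta>)) (at \<zeta>)" for \<zeta>
    by (auto intro!: derivative_eq_intros)
  have G: "has_partials_at G z" "g z = dbar G z" if "z \<in> V" for z
    using assms(6) V(3) that by auto
  have E: "has_partials_at E z" "dbar E z = - \<mu> * E z * g z" if "z \<in> V" for z
    using partials_compose(1)[where \<phi> = "\<lambda>\<zeta>. exp (- \<mu> * \<zeta>)" and v = G, OF derE G(1)[OF that]] dbar_compose[where \<phi> = "\<lambda>\<zeta>. exp (- \<mu> * \<zeta>)" and v = G, OF derE G(1)[OF that]] G(2)[OF that]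
    by (simp_all add: E_def[abs_def])
  have "u holomorphic_on V"
  proof (rule Looman_Menchoff[OF V(1)])
    show "continuous_on V u"
      unfolding u_def E_def using vB
      by (intro continuous_intros contG continuous_on_compose2[OF holomorphic_on_imp_continuous_on[OF holh] contv]) auto
    show "countable C" using assms(9) by (simp add: C_def condition_star_def)
    show "has_partials_at u z" if "z \<in> V - C" for z
    proof -
      have "z \<in> V" "has_partials_at v z" using that V(3) by (auto simp: C_def)
      then show ?thesis
        unfolding u_def by (intro partials_mult(1) partials_compose(1)[where \<phi> = h and v = v, OF derh] E(1))
    qed
    show "negligible Z" by fact
    show "dbar u z = 0" if "z \<in> V - Z" for z
    proof -
      have z: "z \<in> V" "has_partials_at v z" "dbar v z = f (v z) * g z"
        using that V(3) by (auto simp: Z_def)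
      have "dbar u z = h (v z) * dbar E z + deriv h (v z) * dbar v z * E z"
        unfolding u_def
        by (subst dbar_mult[OF partials_compose(1)[where \<phi> = h and v = v, OF derh[OF z(1)] z(2)] E(1)[OF z(1)]])
          (simp only: dbar_compose[where \<phi> = h and v = v, OF derh[OF z(1)] z(2)])
      also have "\<dots> = (deriv h (v z) * f (v z) - \<mu> * h (v z)) * g z * E z"
        by (simp add: E(2)[OF z(1)] z(3) algebra_simps)
      also have "\<dots> = 0" using hf[of "v z"] vB[OF z(1)] \<rho>(2) by auto
      finally show ?thesis .
    qed
  qed
  then have "Cr_on r u V" by (rule Cr_on_holomorphic[OF V(1)])
  moreover have "Cr_on r (\<lambda>z. exp (\<mu> * G z)) V"
    by (rule Cr_on_compose[OF V(1) open_UNIV _ _ Cr_on_subset[OF assms(5) V(3)]])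
      (auto intro!: holomorphic_intros)
  ultimately have "Cr_on r (\<lambda>z. u z * exp (\<mu> * G z)) V"
    by (rule Cr_on_mult[OF V(1)])
  moreover have uE: "u z * exp (\<mu> * G z) = h (v z)" for z
    by (simp add: u_def E_def mult.assoc flip: exp_add)
  ultimately have "Cr_on r (\<lambda>z. h (v z)) V" by simp
  then have "Cr_on r (\<lambda>z. k (h (v z))) V"
    by (rule Cr_on_compose[OF V(1) \<rho>(3) k(1), rotated]) (use vB in auto)
  then have "Cr_on r v V"
    by (rule Cr_on_cong[OF V(1)]) (use k(2) vB in auto)
  then show "\<exists>V. open V \<and> z0 \<in> V \<and> Cr_on r v V" using V by blast
qed

end
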